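(* Let $C>0$ be arbitrary. For all integers $N \geq 3$ and all real $0<t \le (\log N)^C$, we have \[ \frac{1}{\varphi (N)} \left| \left\{ a \in \mathbb{Z}_N^* \, : \, \left| S \left( \frac{a}{N} \right) - \frac{12}{\pi^2} \log N \log \log N \right| \ge t \log N \right\} \right| \ll \frac{1}{t} \] with an implied constant depending only on $C$.
   Context: For an integer $N\ge 2$, $\mathbb{Z}_N^*$ denotes the set of integers $1\le a\le N$ coprime to $N$, and $\varphi$ is Euler's totient function. For $a\in\mathbb{Z}_N^*$, $a/N=[0;a_1,a_2,\ldots,a_r]$ denotes the continued fraction expansion of $a/N$ in its canonical form with $a_r>1$. The sum of partial quotients is $S(a/N)=\sum_{i=1}^r a_i$. The notation $X\ll Y$ means $|X|\le KY$ for some constant $K$. *)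

theory Defs
  imports Complex_Main "HOL-Number_Theory.Totient"
begin

text \<open>\<open>cf_value [a\<^sub>1, \<dots>, a\<^sub>r]\<close> is the value of \<open>[0; a\<^sub>1, \<dots>, a\<^sub>r]\<close>.\<close>

fun cf_value :: "nat list \<Rightarrow> real" where
  "cf_value [] = 0"
| "cf_value (a # as) = 1 / (real a + cf_value as)"

definition is_canonical_cf :: "real \<Rightarrow> nat list \<Rightarrow> bool" where
  "is_canonical_cf x as \<longleftrightarrow>
     as \<noteq> [] \<and> (\<forall>a\<in>set as. a \<ge> 1) \<and> last as > 1 \<and> cf_value as = x"

text \<open>Only meaningful for rational \<open>x\<close> with \<open>0 < x < 1\<close>;
  see \<open>ex1_canonical_cf\<close> below for existence and uniqueness.\<close>

definition cf_expansion :: "real \<Rightarrow> nat list" where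
  "cf_expansion x = (THE as. is_canonical_cf x as)"

definition sum_partial_quotients :: "real \<Rightarrow> nat" where
  "sum_partial_quotients x = sum_list (cf_expansion x)"

lemma cf_value_canonical_bounds:
  assumes "as \<noteq> []" "\<forall>a\<in>set as. a \<ge> 1" "last as > 1"
  shows "0 < cf_value as \<and> cf_value as < 1"
  using assms
proof (induction as)
  case (Cons a as)
  show ?case
  proof (cases "as = []")
    case True
    then show ?thesis using Cons.prems by simp
  next
    case False
    then have "0 < cf_value as" using Cons by simp
    moreover have "real a \<ge> 1" using Cons.prems by simp
    ultimately show ?thesis by (simp add: field_simps)
  qed
qed simp

lemma canonical_cf_unique:
  assumes "is_canonical_cf x as" "is_canonical_cf x bs"
  shows "as = bs"
  using assms
proof (induction as arbitrary: x bs)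
  case Nil
  then show ?case by (simp add: is_canonical_cf_def)
next
  case (Cons a as)
  obtain b cs where bs: "bs = b # cs"
    using Cons.prems by (cases bs) (auto simp: is_canonical_cf_def)
  have tail: "(us = [] \<and> cf_value us = 0) \<or>
      (us \<noteq> [] \<and> is_canonical_cf (cf_value us) us \<and> 0 < cf_value us \<and> cf_value us < 1)"
    if "is_canonical_cf x (u # us)" for u us
    using that cf_value_canonical_bounds[of us]
    by (auto simp: is_canonical_cf_def split: if_splits)
  note ta = tail[OF Cons.prems(1)] and tb = tail[OF Cons.prems(2)[unfolded bs]]
  have "1 / (real a + cf_value as) = 1 / (real b + cf_value cs)"
    using Cons.prems bs by (simp add: is_canonical_cf_def)
  then have eq: "real a + cf_value as = real b + cf_value cs" by simp
  have "\<bar>cf_value as - cf_value cs\<bar> < 1" using ta tb by auto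
  then have ab: "a = b" using eq by linarith
  then have v: "cf_value as = cf_value cs" using eq by simp
  have "as = cs"
  proof (cases "as = []")
    case True
    then show ?thesis using ta tb v by auto
  next
    case False
    then show ?thesis using ta tb v Cons.IH[of "cf_value as" cs] by auto
  qed
  then show ?case using ab bs by simp
qed

lemma canonical_cf_exists:
  fixes a N :: nat
  assumes "0 < a" "a < N"
  shows "\<exists>as. is_canonical_cf (real a / real N) as"
  using assms
proof (induction a arbitrary: N rule: less_induct)
  case (less a)
  define q r where "q = N div a" and "r = N mod a"
  have N: "N = q * a + r" and ra: "r < a" using less.prems by (simp_all add: q_def r_def)
  have q1: "q \<ge> 1" using less.prems by (simp add: q_def div_greater_zero_iff Suc_le_eq)
  have val: "real a / real N = 1 / (real q + real r / real a)"
    using less.prems(1) by (simp add: N field_simps)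
  show ?case
  proof (cases "r = 0")
    case True
    have "q \<noteq> 1" using True N less.prems by auto
    then have "is_canonical_cf (real a / real N) [q]"
      using q1 True val by (simp add: is_canonical_cf_def)
    then show ?thesis by blast
  next
    case False
    then obtain as where "is_canonical_cf (real r / real a) as"
      using less.IH[of r a] ra by auto
    then have "is_canonical_cf (real a / real N) (q # as)"
      using q1 val by (auto simp: is_canonical_cf_def)
    then show ?thesis by blast
  qed
qed

lemma ex1_canonical_cf:
  fixes a N :: nat
  assumes "0 < a" "a < N"
  shows "\<exists>!as. is_canonical_cf (real a / real N) as"
  using canonical_cf_exists[OF assms] canonical_cf_unique by blast

end

theory Submission
  imports Defs "HOL-Analysis.Analysis" "HOL-Real_Asymp.Real_Asymp"
begin

text \<open>
  Write \<open>L = ln N\<close>. If \<open>p/q\<close> is a convergent of \<open>a/N\<close> and \<open>m = \<bar>q a - p N\<bar>\<close>, the next partial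
  quotient differs from \<open>N / (q m)\<close> by at most 2, and by Legendre's theorem every primitive
  \<open>(q, m)\<close> with \<open>3 q m \<le> N\<close> arises from a convergent. Up to \<open>O(L)\<close>, \<open>S(a/N)\<close> is thus the number of
  triples \<open>(q, m, \<tau>)\<close> with \<open>\<tau> \<ge> 3\<close>, \<open>\<tau> q m \<le> N\<close> and \<open>(q, m)\<close> primitive for \<open>a\<close>.
  Replacing \<open>a\<close> by its inverse modulo \<open>N\<close> exchanges \<open>q\<close> and \<open>m\<close>, so only \<open>q \<le> Q\<close> matters, where
  \<open>Q\<close> is \<open>\<surd>N\<close> divided by \<open>exp(11 (ln L)\<^sup>2)\<close>; the few triples with \<open>q, m > Q\<close> are negligible in mean.

  For \<open>q \<le> Q\<close> the condition says that \<open>a/N\<close> lies within \<open>1 / (\<tau> q\<^sup>2)\<close> of a reduced fraction \<open>p/q\<close>.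
  Brun's pure sieve shows that the residues coprime to \<open>N\<close> are equidistributed in such intervals,
  with relative error \<open>1/L\<close>. Two such conditions with \<open>q\<^sub>1 < q\<^sub>2\<close> are asymptotically independent:
  in a basis of the integer lattice containing \<open>(q\<^sub>1, p\<^sub>1)\<close>, the vector \<open>(q\<^sub>2, p\<^sub>2)\<close> is
  again an arbitrary primitive vector. Hence the count truncated to \<open>\<tau> \<le> T = t L\<close> has variance
  \<open>O(T L) = O(t L\<^sup>2)\<close>, and Chebyshev's inequality gives \<open>O(1/t)\<close>; the probability that some \<open>\<tau> > T\<close>
  occurs is \<open>O(1/t)\<close> by a first moment bound.
\<close>

section \<open>A truncated sieve\<close>

text \<open>For a fixed fraction the number of levels \<tau> is heavy-tailed: cut off at T, its
  second moment grows like T. Truncating at T = t L balances the variance against the tail. The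
  sieve dictates Q. Using about 10 ln L prime factors makes the relative error small but involves up
  to exp(21 (ln L)^2) subsets, an absolute error that intervals of length about N / (\<tau> q^2)
  must exceed. For q \<le> Q these are longer than exp(22 (ln L)^2) / \<tau>, and the spare factor
  exp((ln L)^2) beats every power of L, in particular the range of \<tau>. The price is a middle
  range of logarithmic length O((ln L)^2). Its mean carries a factor N / totient N, for which a
  bound O(sqrt L) is enough. The constant: each half has mean h \<Phi> with h = ln L + O(t) and
  \<Phi> = (12 / pi^2) L / 2 + O((ln L)^2). In the variance the terms of size (h \<Phi>)^2 have to
  cancel, so \<Phi>(n) is needed up to O(1) and sums built from it with the sharp leading
  constant.\<close>

lemma alternating_binomial_sum_bound:
  assumes "r > 0"
  shows "\<bar>(if n = 0 then 1 else 0) - (\<Sum>k\<le>r. (-1) ^ k * real (n choose k))\<bar> \<le> real (n choose r)"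
proof (cases n)
  case 0
  have "(\<Sum>k\<le>r. (-1) ^ k * real (0 choose k)) = (\<Sum>k\<in>{0}. (-1) ^ k * real (0 choose k))"
    by (rule sum.mono_neutral_right) (auto simp: binomial_eq_0)
  then show ?thesis using 0 by simp
next
  case (Suc m)
  have "(\<Sum>k\<le>r. (-1) ^ k * real (n choose k)) = (\<Sum>k\<le>r. (real n gchoose k) * (-1) ^ k)"
    by (simp add: binomial_gbinomial mult.commute)
  \<comment> \<open>The partial alternating sum of a binomial row telescopes to a single entry of
    the row above it.\<close>
  also have "\<dots> = (-1) ^ r * real (m choose r)"
    using Suc by (simp add: gbinomial_sum_lower_neg binomial_gbinomial)
  finally have "\<bar>(if n = 0 then 1 else 0) - (\<Sum>k\<le>r. (-1) ^ k * real (n choose k))\<bar> = real (m choose r)"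
    using Suc by (simp add: abs_mult)
  also have "\<dots> \<le> real (n choose r)"
    using Suc assms by (cases r) auto
  finally show ?thesis .
qed

lemma prod_primes_dvd_iff:
  fixes \<alpha> :: int
  assumes "finite X" "\<And>p. p \<in> X \<Longrightarrow> prime p"
  shows "int (\<Prod>X) dvd \<alpha> \<longleftrightarrow> (\<forall>p\<in>X. int p dvd \<alpha>)"
  using assms
proof (induction X)
  case (insert p X)
  have "coprime (int p) (int (\<Prod>X))"
    unfolding coprime_int_iff
    using insert.prems insert.hyps by (intro prod_coprime_right) (metis insertCI primes_coprime)
  then show ?case using insert 
    by (simp add: divides_mult) (meson dvd_mult_left dvd_mult_right divides_mult)
qed simp

text \<open>The products \<open>\<Prod>X\<close> dividing \<alpha> are those with \<open>X\<close>
  inside the set \<open>D\<close> of primes of \<open>P\<close> that divide \<alpha>. Both sums thus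
  depend on \<open>card D\<close> alone, and what remains is the Bonferroni inequality for a set of
  that size.\<close>

lemma truncated_sieve_pointwise:
  fixes \<alpha> :: int
  assumes "finite P" "\<And>p. p \<in> P \<Longrightarrow> prime p" "r > 0"
  shows "\<bar>(if \<forall>p\<in>P. \<not> int p dvd \<alpha> then 1 else 0) -
      (\<Sum>X | X \<subseteq> P \<and> card X \<le> r. (-1) ^ card X * (if int (\<Prod>X) dvd \<alpha> then 1 else 0))\<bar>
    \<le> (\<Sum>X | X \<subseteq> P \<and> card X = r. (if int (\<Prod>X) dvd \<alpha> then 1 else (0::real)))"
proof -
  define D where "D = {p\<in>P. int p dvd \<alpha>}"
  have fD: "finite D" and DP: "D \<subseteq> P" using assms by (auto simp: D_def)
  have dv: "int (\<Prod>X) dvd \<alpha> \<longleftrightarrow> X \<subseteq> D" if "X \<subseteq> P" for X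
    using prod_primes_dvd_iff[of X \<alpha>] that assms finite_subset[of X P] by (auto simp: D_def)
  have fin: "finite {X. X \<subseteq> P \<and> Q X}" for Q
    using assms(1) by (auto intro: finite_subset[of _ "Pow P"])
  have "(\<Sum>X | X \<subseteq> P \<and> card X = r. (if int (\<Prod>X) dvd \<alpha> then 1 else (0::real))) =
     (\<Sum>X | X \<subseteq> P \<and> card X = r. (if X \<subseteq> D then 1 else 0))"
    by (rule sum.cong) (simp_all add: dv del: of_nat_prod)
  also have "\<dots> = real (card {X. X \<subseteq> D \<and> card X = r})"
  proof -
    have "{X. X \<subseteq> P \<and> card X = r} \<inter> {X. X \<subseteq> D} = {X. X \<subseteq> D \<and> card X = r}"
      using DP by auto
    then show ?thesis by (simp add: sum.If_cases fin)
  qed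
  also have "\<dots> = real (card D choose r)"
    using n_subsets[OF fD] by simp
  finally have 1: "(\<Sum>X | X \<subseteq> P \<and> card X = r. (if int (\<Prod>X) dvd \<alpha> then 1 else (0::real))) = real (card D choose r)" .
  have "(\<Sum>X | X \<subseteq> P \<and> card X \<le> r. (-1) ^ card X * (if int (\<Prod>X) dvd \<alpha> then 1 else (0::real))) =
      (\<Sum>X | X \<subseteq> D \<and> card X \<le> r. (-1) ^ card X)"
    using DP by (intro sum.mono_neutral_cong_right fin) (auto simp: dv[simplified])
  also have "\<dots> = (\<Sum>k\<le>r. \<Sum>X | X \<in> {X. X \<subseteq> D \<and> card X \<le> r} \<and> card X = k. (-1) ^ card X)"
    using fD by (intro sum.group[symmetric]) (auto intro: finite_subset[of _ "Pow D"])
  also have "\<dots> = (\<Sum>k\<le>r. (-1) ^ k * real (card D choose k))"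
  proof (rule sum.cong[OF refl])
    fix k assume "k \<in> {..r}"
    then have "{X. X \<in> {X. X \<subseteq> D \<and> card X \<le> r} \<and> card X = k} = {X. X \<subseteq> D \<and> card X = k}" by auto
    then show "(\<Sum>X | X \<in> {X. X \<subseteq> D \<and> card X \<le> r} \<and> card X = k. (-1) ^ card X) = (-1) ^ k * real (card D choose k)"
      by (simp add: n_subsets[OF fD, symmetric])
  qed
  finally have 2: "(\<Sum>X | X \<subseteq> P \<and> card X \<le> r. (-1) ^ card X * (if int (\<Prod>X) dvd \<alpha> then 1 else (0::real))) = \<dots>" .
  have 3: "(\<forall>p\<in>P. \<not> int p dvd \<alpha>) \<longleftrightarrow> card D = 0"
    using fD by (auto simp: D_def)
  show ?thesis
    unfolding 1 2 3 using alternating_binomial_sum_bound[OF assms(3), of "card D"] by simp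
qed

text \<open>Averaging the pointwise bound with weight \<open>f\<close> turns indicators into the
  sums \<open>S X\<close>, each equal to \<open>M / \<Prod>X\<close> up to \<open>E\<close>. One
  \<open>E\<close> per small subset comes from the main sum, another from the remainder over subsets
  of size \<open>r\<close>.\<close>

lemma truncated_sieve:
  fixes f :: "int \<Rightarrow> real"
  assumes P: "finite P" "\<And>p. p \<in> P \<Longrightarrow> prime p" and r: "r > 0"
    and A: "finite A" and f: "\<And>\<alpha>. \<alpha> \<in> A \<Longrightarrow> f \<alpha> \<ge> 0"
    and main: "\<And>d. d > 0 \<Longrightarrow> (\<exists>X\<subseteq>P. d = \<Prod>X) \<Longrightarrow> \<bar>(\<Sum>\<alpha>\<in>{\<alpha>\<in>A. int d dvd \<alpha>}. f \<alpha>) - M / real d\<bar> \<le> E"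
  shows "\<bar>(\<Sum>\<alpha>\<in>{\<alpha>\<in>A. \<forall>p\<in>P. \<not> int p dvd \<alpha>}. f \<alpha>) -
      M * (\<Sum>X | X \<subseteq> P \<and> card X \<le> r. (-1) ^ card X / real (\<Prod>X))\<bar>
    \<le> M * (\<Sum>X | X \<subseteq> P \<and> card X = r. 1 / real (\<Prod>X)) + 2 * E * card {X. X \<subseteq> P \<and> card X \<le> r}"
proof -
  define S where "S X = (\<Sum>\<alpha>\<in>{\<alpha>\<in>A. int (\<Prod>X) dvd \<alpha>}. f \<alpha>)" for X
  have S: "S X = (\<Sum>\<alpha>\<in>A. f \<alpha> * (if int (\<Prod>X) dvd \<alpha> then 1 else 0))" for X
    unfolding S_def using A by (simp add: sum.inter_filter if_distrib cong: if_cong)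
  have fin: "finite {X. X \<subseteq> P \<and> Q X}" for Q
    using P(1) by (auto intro: finite_subset[of _ "Pow P"])
  have pos: "\<Prod>X > 0" if "X \<subseteq> P" for X
    using that by (intro prod_pos prime_gt_0_nat P(2)) auto
  have SE: "\<bar>S X - M / real (\<Prod>X)\<bar> \<le> E" if "X \<subseteq> P" for X
    unfolding S_def using main[of "\<Prod>X"] pos[OF that] that by blast
  have E0: "E \<ge> 0" using order_trans[OF abs_ge_zero SE[of "{}"]] by simp
  have L: "(\<Sum>\<alpha>\<in>{\<alpha>\<in>A. \<forall>p\<in>P. \<not> int p dvd \<alpha>}. f \<alpha>) = (\<Sum>\<alpha>\<in>A. f \<alpha> * (if \<forall>p\<in>P. \<not> int p dvd \<alpha> then 1 else 0))"
    using A by (simp add: sum.inter_filter if_distrib cong: if_cong)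
  let ?I = "{X. X \<subseteq> P \<and> card X \<le> r}" and ?J = "{X. X \<subseteq> P \<and> card X = r}"
  have "\<bar>(\<Sum>\<alpha>\<in>{\<alpha>\<in>A. \<forall>p\<in>P. \<not> int p dvd \<alpha>}. f \<alpha>) - (\<Sum>X\<in>?I. (-1) ^ card X * S X)\<bar>
     = \<bar>\<Sum>\<alpha>\<in>A. f \<alpha> * ((if \<forall>p\<in>P. \<not> int p dvd \<alpha> then 1 else 0) - (\<Sum>X\<in>?I. (-1) ^ card X * (if int (\<Prod>X) dvd \<alpha> then 1 else 0)))\<bar>"
  proof -
    have "(\<Sum>X\<in>?I. (-1) ^ card X * S X) = (\<Sum>\<alpha>\<in>A. \<Sum>X\<in>?I. (-1) ^ card X * (f \<alpha> * (if int (\<Prod>X) dvd \<alpha> then 1 else 0)))"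
      unfolding S sum_distrib_left by (rule sum.swap)
    also have "\<dots> = (\<Sum>\<alpha>\<in>A. f \<alpha> * (\<Sum>X\<in>?I. (-1) ^ card X * (if int (\<Prod>X) dvd \<alpha> then 1 else 0)))"
      unfolding sum_distrib_left by (intro sum.cong refl) (simp only: mult_ac)
    finally show ?thesis unfolding L by (simp only: right_diff_distrib sum_subtractf)
  qed
  also have "\<dots> \<le> (\<Sum>\<alpha>\<in>A. f \<alpha> * (\<Sum>X\<in>?J. (if int (\<Prod>X) dvd \<alpha> then 1 else 0)))"
  proof (rule order_trans[OF sum_abs], rule sum_mono)
    fix \<alpha> assume "\<alpha> \<in> A"
    then show "\<bar>f \<alpha> * ((if \<forall>p\<in>P. \<not> int p dvd \<alpha> then 1 else 0) - (\<Sum>X\<in>?I. (-1) ^ card X * (if int (\<Prod>X) dvd \<alpha> then 1 else 0)))\<bar>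
      \<le> f \<alpha> * (\<Sum>X\<in>?J. (if int (\<Prod>X) dvd \<alpha> then 1 else 0))"
      unfolding abs_mult using f[of \<alpha>] truncated_sieve_pointwise[OF P r, of \<alpha>]
      by (intro mult_mono) auto
  qed
  also have "\<dots> = (\<Sum>X\<in>?J. S X)"
    unfolding S sum_distrib_left by (rule sum.swap)
  also have "\<dots> \<le> (\<Sum>X\<in>?J. M / real (\<Prod>X) + E)"
  proof (rule sum_mono)
    fix X assume "X \<in> ?J"
    then show "S X \<le> M / real (\<Prod>X) + E" using SE[of X] by (simp add: abs_le_iff)
  qed
  also have "\<dots> = M * (\<Sum>X\<in>?J. 1 / real (\<Prod>X)) + E * card ?J"
    by (simp add: sum.distrib sum_distrib_left)
  also have "\<dots> \<le> M * (\<Sum>X\<in>?J. 1 / real (\<Prod>X)) + E * card ?I"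
    using E0 by (intro add_left_mono mult_left_mono) (auto intro!: card_mono fin)
  finally have 1: "\<bar>(\<Sum>\<alpha>\<in>{\<alpha>\<in>A. \<forall>p\<in>P. \<not> int p dvd \<alpha>}. f \<alpha>) - (\<Sum>X\<in>?I. (-1) ^ card X * S X)\<bar>
     \<le> M * (\<Sum>X\<in>?J. 1 / real (\<Prod>X)) + E * card ?I" .
  have "\<bar>(\<Sum>X\<in>?I. (-1) ^ card X * S X) - M * (\<Sum>X\<in>?I. (-1) ^ card X / real (\<Prod>X))\<bar>
     = \<bar>\<Sum>X\<in>?I. (-1) ^ card X * (S X - M / real (\<Prod>X))\<bar>"
    by (simp add: sum_distrib_left sum_subtractf right_diff_distrib mult.commute)
  also have "\<dots> \<le> (\<Sum>X\<in>?I. E)"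
    using SE by (intro order_trans[OF sum_abs] sum_mono) (simp add: abs_mult)
  finally have 2: "\<bar>(\<Sum>X\<in>?I. (-1) ^ card X * S X) - M * (\<Sum>X\<in>?I. (-1) ^ card X / real (\<Prod>X))\<bar> \<le> E * card ?I"
    by (simp add: mult.commute)
  show ?thesis using 1 2 by linarith
qed

lemma coprime_iff_no_prime_factor_dvd:
  fixes \<alpha> :: int
  assumes "n > 0"
  shows "coprime \<alpha> (int n) \<longleftrightarrow> (\<forall>p\<in>prime_factors n. \<not> int p dvd \<alpha>)"
proof
  assume c: "coprime \<alpha> (int n)"
  show "\<forall>p\<in>prime_factors n. \<not> int p dvd \<alpha>"
  proof (intro ballI notI)
    fix p assume "p \<in> prime_factors n" "int p dvd \<alpha>"
    then have "p dvd n" "prime p" by auto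
    then have "int p dvd 1" using c \<open>int p dvd \<alpha>\<close> by (meson coprime_common_divisor int_dvd_int_iff coprime_def)
    then show False using \<open>prime p\<close> by simp
  qed
next
  assume a: "\<forall>p\<in>prime_factors n. \<not> int p dvd \<alpha>"
  show "coprime \<alpha> (int n)"
  proof (rule ccontr)
    assume "\<not> coprime \<alpha> (int n)"
    then have "gcd (nat \<bar>\<alpha>\<bar>) n \<noteq> 1" 
      by (metis coprime_iff_gcd_eq_1 gcd_int_def nat_int of_nat_1 abs_of_nat)
    then obtain p where p: "prime p" "p dvd gcd (nat \<bar>\<alpha>\<bar>) n" using prime_factor_nat by blast
    have "p dvd n" "p dvd nat \<bar>\<alpha>\<bar>"
      using dvd_trans[OF p(2) gcd_dvd2] dvd_trans[OF p(2) gcd_dvd1] by blast+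
    then have "int p dvd \<alpha>" by (metis dvd_abs_iff int_dvd_int_iff int_nat_eq abs_ge_zero)
    then show False using a p \<open>p dvd n\<close> assms by (auto simp: prime_factors_dvd)
  qed
qed

text \<open>The truncated sum \<open>?K\<close> is compared with totient n / n by a second use of
  the sieve, on {1..n} with weight 1, where multiples of a divisor of n are counted exactly. Each
  use costs one tail \<open>?J\<close>, whence the factor 2.\<close>

lemma coprime_sum_sieve:
  fixes f :: "int \<Rightarrow> real"
  assumes n: "n > 0" and r: "r > 0"
    and A: "finite A" and f: "\<And>\<alpha>. \<alpha> \<in> A \<Longrightarrow> f \<alpha> \<ge> 0" and M: "M \<ge> 0"
    and main: "\<And>d. d > 0 \<Longrightarrow> \<bar>(\<Sum>\<alpha>\<in>{\<alpha>\<in>A. int d dvd \<alpha>}. f \<alpha>) - M / real d\<bar> \<le> E"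
  defines "P \<equiv> prime_factors n"
  shows "\<bar>(\<Sum>\<alpha>\<in>{\<alpha>\<in>A. coprime \<alpha> (int n)}. f \<alpha>) - M * (real (totient n) / real n)\<bar>
    \<le> 2 * M * (\<Sum>X | X \<subseteq> P \<and> card X = r. 1 / real (\<Prod>X)) + 2 * E * card {X. X \<subseteq> P \<and> card X \<le> r}"
proof -
  have P: "finite P" "\<And>p. p \<in> P \<Longrightarrow> prime p" by (auto simp: P_def)
  let ?J = "(\<Sum>X | X \<subseteq> P \<and> card X = r. 1 / real (\<Prod>X))"
  let ?K = "(\<Sum>X | X \<subseteq> P \<and> card X \<le> r. (-1) ^ card X / real (\<Prod>X))"
  have 1: "\<bar>(\<Sum>\<alpha>\<in>{\<alpha>\<in>A. coprime \<alpha> (int n)}. f \<alpha>) - M * ?K\<bar> \<le> M * ?J + 2 * E * card {X. X \<subseteq> P \<and> card X \<le> r}"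
    unfolding coprime_iff_no_prime_factor_dvd[OF n] P_def[symmetric]
    using main by (intro truncated_sieve P r A f) auto
  have dvdn: "\<Prod>X dvd n" if "X \<subseteq> P" for X
  proof -
    have "int (\<Prod>X) dvd int n"
      using that P by (subst prod_primes_dvd_iff) (auto simp: P_def intro: finite_subset)
    then show ?thesis unfolding int_dvd_int_iff .
  qed
  have cnt: "real (card {\<alpha>\<in>{1..int n}. int d dvd \<alpha>}) = real n / real d" if d: "d > 0" "d dvd n" for d
  proof -
    obtain k where k: "n = d * k" using d(2) by (elim dvdE)
    have "{\<alpha>\<in>{1..int n}. int d dvd \<alpha>} = (\<lambda>j. int d * j) ` {1..int k}" (is "?L = ?R")
    proof
      show "?L \<subseteq> ?R"
      proof
        fix \<alpha> assume a: "\<alpha> \<in> ?L"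
        then obtain j where j: "\<alpha> = int d * j" by blast
        have "0 < int d * j" "int d * j \<le> int d * int k" using a k j by auto
        then have "0 < j" "j \<le> int k" using that(1) by (auto simp: zero_less_mult_iff)
        then show "\<alpha> \<in> ?R" using j by auto
      qed
    qed (use that k in \<open>auto simp: Suc_le_eq int_one_le_iff_zero_less\<close>)
    moreover have "inj_on (\<lambda>j. int d * j) {1..int k}" using that by (auto simp: inj_on_def)
    ultimately have "card {\<alpha>\<in>{1..int n}. int d dvd \<alpha>} = k" by (simp add: card_image)
    then show ?thesis using k that by simp
  qed
  have "\<bar>(\<Sum>\<alpha>\<in>{\<alpha>\<in>{1..int n}. \<forall>p\<in>P. \<not> int p dvd \<alpha>}. 1) - real n * ?K\<bar> \<le> real n * ?J + 2 * (0::real) * card {X. X \<subseteq> P \<and> card X \<le> r}"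
    using cnt dvdn by (intro truncated_sieve P r) (auto simp del: of_nat_prod)
  moreover have "{\<alpha>\<in>{1..int n}. \<forall>p\<in>P. \<not> int p dvd \<alpha>} = int ` totatives n"
    unfolding P_def coprime_iff_no_prime_factor_dvd[OF n, symmetric]
  proof (intro equalityI subsetI)
    fix x assume "x \<in> {\<alpha>\<in>{1..int n}. coprime \<alpha> (int n)}"
    then have "x = int (nat x)" "nat x \<in> totatives n"
      by (auto simp: in_totatives_iff simp flip: coprime_int_iff)
    then show "x \<in> int ` totatives n" by blast
  qed (auto simp: in_totatives_iff)
  ultimately have "\<bar>real (totient n) - real n * ?K\<bar> \<le> real n * ?J"
    by (simp add: card_image totient_def)
  then have "\<bar>real (totient n) / real n - ?K\<bar> \<le> ?J"
    using n by (simp add: field_simps abs_le_iff)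
  then have "\<bar>M * (real (totient n) / real n - ?K)\<bar> \<le> M * ?J"
    unfolding abs_mult using M by (intro mult_mono) auto
  then have 2: "\<bar>M * ?K - M * (real (totient n) / real n)\<bar> \<le> M * ?J"
    by (simp add: right_diff_distrib abs_minus_commute)
  show ?thesis using 1 2 by linarith
qed


section \<open>Decreasing weights along arithmetic progressions\<close>

text \<open>\<open>lo\<close> and \<open>hi\<close> express, without derivatives or integrals, that
  \<open>F\<close> is an antiderivative of a decreasing \<open>f\<close>. Telescoping them over
  steps of length \<open>d\<close> is the integral test.\<close>

lemma antitone_progression_bounds:
  fixes f F :: "real \<Rightarrow> real"
  assumes d: "d > 0"
    and lo: "\<And>y y'. z \<le> y \<Longrightarrow> y \<le> y' \<Longrightarrow> f y' * (y' - y) \<le> F y' - F y"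
    and hi: "\<And>y y'. z \<le> y \<Longrightarrow> y \<le> y' \<Longrightarrow> F y' - F y \<le> f y * (y' - y)"
  shows "F (z + real m * d) - F z \<le> d * (\<Sum>j<m. f (z + real j * d))"
    and "d * (\<Sum>j<Suc m. f (z + real j * d)) \<le> d * f z + F (z + real m * d) - F z"
proof (induction m)
  case (Suc m)
  have y: "z \<le> z + real m * d" "z + real m * d \<le> z + real (Suc m) * d"
    using d by (simp_all add: mult_right_mono)
  have e: "z + real (Suc m) * d - (z + real m * d) = d" by (simp add: algebra_simps)
  note lo' = lo[OF y, unfolded e] and hi' = hi[OF y, unfolded e]
  case 1
  show ?case using Suc.IH(1) hi' by (simp add: algebra_simps)
  case 2
  show ?case using Suc.IH(2) lo' by (simp add: algebra_simps)
qed (use d in auto)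

text \<open>The multiples of \<open>d\<close> give a progression that starts within \<open>d\<close>
  of \<open>Y\<close>, so comparing with the integral costs at most one term, the largest one
  \<open>f Y\<close>. The shift \<delta> is real because the weight is later evaluated at points
  \<alpha> + \<beta> \<theta> with rational \<theta>.\<close>

lemma multiples_sum_antitone:
  fixes f F :: "real \<Rightarrow> real" and \<delta> Y Z :: real
  assumes d: "d > 0" and YZ: "Y \<le> Z"
    and nonneg: "\<And>y. y \<ge> Y \<Longrightarrow> f y \<ge> 0"
    and lo: "\<And>y y'. Y \<le> y \<Longrightarrow> y \<le> y' \<Longrightarrow> f y' * (y' - y) \<le> F y' - F y"
    and hi: "\<And>y y'. Y \<le> y \<Longrightarrow> y \<le> y' \<Longrightarrow> F y' - F y \<le> f y * (y' - y)"
  shows "\<bar>(\<Sum>\<alpha>\<in>{\<alpha>\<in>{\<alpha>::int. Y \<le> \<alpha> + \<delta> \<and> \<alpha> + \<delta> \<le> Z}. int d dvd \<alpha>}. f (\<alpha> + \<delta>)) - (F Z - F Y) / d\<bar> \<le> f Y"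
proof -
  define k0 where "k0 = \<lceil>(Y - \<delta>) / d\<rceil>"
  define k1 where "k1 = \<lfloor>(Z - \<delta>) / d\<rfloor>"
  define m where "m = nat (k1 + 1 - k0)"
  define z where "z = d * k0 + \<delta>"
  have dd: "real d > 0" using d by simp
  have "(Y - \<delta>) / d \<le> (Z - \<delta>) / d" using YZ d by (simp add: divide_right_mono)
  \<comment> \<open>This follows from Y \<le> Z even if the window contains no multiple, so
    \<open>nat\<close> loses nothing in \<open>m\<close>.\<close>
  then have "k0 \<le> k1 + 1" unfolding k0_def k1_def by linarith
  then have m: "int m = k1 + 1 - k0" unfolding m_def by simp
  have iff0: "k \<ge> k0 \<longleftrightarrow> Y \<le> d * k + \<delta>" for k :: int
    unfolding k0_def ceiling_le_iff using dd by (simp add: field_simps)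
  have iff1: "k \<le> k1 \<longleftrightarrow> d * k + \<delta> \<le> Z" for k :: int
    unfolding k1_def le_floor_iff using dd by (simp add: field_simps)
  have zY: "Y \<le> z" using iff0[of k0] by (simp add: z_def)
  have zd: "z \<le> Y + d" using iff0[of "k0 - 1"] by (simp add: z_def algebra_simps)
  have zm: "z + real m * d \<ge> Z" 
  proof -
    have "real m = real_of_int (int m)" by simp
    then have "real m = k1 + 1 - k0" unfolding m by simp
    then have "z + real m * d = d * (k1 + 1) + \<delta>" by (simp only: z_def) (simp add: algebra_simps)
    then show ?thesis using iff1[of "k1 + 1"] by simp
  qed
  have Fmono: "F y \<le> F y'" if "Y \<le> y" "y \<le> y'" for y y'
    using lo[OF that] nonneg[of y'] that by (meson diff_ge_0_iff_ge mult_nonneg_nonneg order_trans)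
  have set_eq: "{\<alpha>\<in>{\<alpha>::int. Y \<le> \<alpha> + \<delta> \<and> \<alpha> + \<delta> \<le> Z}. int d dvd \<alpha>} = (\<lambda>j. int d * (k0 + int j)) ` {..<m}" (is "?L = ?R")
  proof
    show "?L \<subseteq> ?R"
    proof
      fix \<alpha> assume a: "\<alpha> \<in> ?L"
      then obtain k where k: "\<alpha> = int d * k" by blast
      then have "k0 \<le> k" "k \<le> k1" using a iff0[of k] iff1[of k] by auto
      then have "\<alpha> = int d * (k0 + int (nat (k - k0)))" "nat (k - k0) < m" using k m by auto
      then show "\<alpha> \<in> ?R" by blast
    qed
    show "?R \<subseteq> ?L"
    proof
      fix \<alpha> assume "\<alpha> \<in> ?R"
      then obtain j where j: "j < m" "\<alpha> = int d * (k0 + int j)" by blast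
      then have "k0 \<le> k0 + int j" "k0 + int j \<le> k1" using m by auto
      then show "\<alpha> \<in> ?L" using iff0[of "k0 + int j"] iff1[of "k0 + int j"] j by auto
    qed
  qed
  have inj: "inj_on (\<lambda>j. int d * (k0 + int j)) {..<m}" using d by (auto simp: inj_on_def)
  have S: "(\<Sum>\<alpha>\<in>{\<alpha>\<in>{\<alpha>::int. Y \<le> \<alpha> + \<delta> \<and> \<alpha> + \<delta> \<le> Z}. int d dvd \<alpha>}. f (\<alpha> + \<delta>)) = (\<Sum>j<m. f (z + real j * d))"
    unfolding set_eq sum.reindex[OF inj] by (intro sum.cong refl) (simp add: z_def algebra_simps)
  have lo': "f y' * (y' - y) \<le> F y' - F y" if "z \<le> y" "y \<le> y'" for y y' using lo that zY by simp
  have hi': "F y' - F y \<le> f y * (y' - y)" if "z \<le> y" "y \<le> y'" for y y' using hi that zY by simp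
  note bounds = antitone_progression_bounds[where f=f and F=F and z=z, OF dd lo' hi']
  have fz: "f z \<le> f Y"
  proof (cases "z = Y")
    case False
    then have "f z * (z - Y) \<le> f Y * (z - Y)" using lo[of Y z] hi[of Y z] zY by linarith
    then show ?thesis using False zY by simp
  qed simp
  have low: "F Z - F Y - d * f Y \<le> d * (\<Sum>j<m. f (z + real j * d))"
  proof -
    have "F z - F Y \<le> f Y * (z - Y)" using hi[of Y z] zY by simp
    also have "\<dots> \<le> f Y * d" using zd nonneg[of Y] by (intro mult_left_mono) auto
    finally have "F Z - F Y - d * f Y \<le> F (z + real m * d) - F z" using Fmono[OF YZ zm] by (simp add: mult.commute)
    then show ?thesis using bounds(1)[of m] by linarith
  qed
  have up: "d * (\<Sum>j<m. f (z + real j * d)) \<le> d * f Y + F Z - F Y"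
  proof (cases m)
    case 0
    have "0 \<le> d * f Y" using nonneg[of Y] by simp
    then show ?thesis using 0 Fmono[of Y Z] YZ by simp
  next
    case (Suc m')
    have "k0 + int m' \<le> k1" using m Suc by simp
    then have "z + real m' * d \<le> Z" using iff1[of "k0 + int m'"] by (simp add: z_def algebra_simps)
    then have "F (z + real m' * d) \<le> F Z" using zY dd by (intro Fmono) (auto intro: add_increasing2)
    moreover have "F Y \<le> F z" using zY by (intro Fmono) auto
    moreover have "d * f z \<le> d * f Y" using fz dd by simp
    ultimately show ?thesis using bounds(2)[of m'] Suc by simp
  qed
  show ?thesis unfolding S using low up dd by (simp add: abs_le_iff field_simps)
qed

lemma finite_ints_between: "finite {\<alpha>::int. Y \<le> \<alpha> + \<delta> \<and> \<alpha> + \<delta> \<le> (Z::real)}"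
proof (rule finite_subset)
  show "{\<alpha>::int. Y \<le> \<alpha> + \<delta> \<and> \<alpha> + \<delta> \<le> Z} \<subseteq> {\<lceil>Y - \<delta>\<rceil>..\<lfloor>Z - \<delta>\<rfloor>}"
    by (auto simp: le_floor_iff ceiling_le_iff algebra_simps)
qed simp

text \<open>Applied twice: with constant weight 1 to count residues, where \<open>r\<close> is about
  10 ln ln N, and with weight 1 / y^2 for the second moment, where \<open>r\<close> exceeds the
  number of primes and the first error term is an empty sum.\<close>

lemma coprime_sum_antitone:
  fixes f F :: "real \<Rightarrow> real" and \<delta> Y Z :: real
  assumes n: "n > 0" and r: "r > 0" and YZ: "Y \<le> Z"
    and nonneg: "\<And>y. y \<ge> Y \<Longrightarrow> f y \<ge> 0"
    and lo: "\<And>y y'. Y \<le> y \<Longrightarrow> y \<le> y' \<Longrightarrow> f y' * (y' - y) \<le> F y' - F y"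
    and hi: "\<And>y y'. Y \<le> y \<Longrightarrow> y \<le> y' \<Longrightarrow> F y' - F y \<le> f y * (y' - y)"
  defines "P \<equiv> prime_factors n"
  shows "\<bar>(\<Sum>\<alpha>\<in>{\<alpha>::int. Y \<le> \<alpha> + \<delta> \<and> \<alpha> + \<delta> \<le> Z \<and> coprime \<alpha> (int n)}. f (\<alpha> + \<delta>)) - (F Z - F Y) * (real (totient n) / real n)\<bar>
    \<le> 2 * (F Z - F Y) * (\<Sum>X | X \<subseteq> P \<and> card X = r. 1 / real (\<Prod>X)) + 2 * f Y * card {X. X \<subseteq> P \<and> card X \<le> r}"
proof -
  have e: "{\<alpha>::int. Y \<le> \<alpha> + \<delta> \<and> \<alpha> + \<delta> \<le> Z \<and> coprime \<alpha> (int n)} = {\<alpha>\<in>{\<alpha>::int. Y \<le> \<alpha> + \<delta> \<and> \<alpha> + \<delta> \<le> Z}. coprime \<alpha> (int n)}" by auto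
  have M: "F Z - F Y \<ge> 0"
    using lo[OF _ YZ] nonneg[OF YZ] YZ by (meson diff_ge_0_iff_ge mult_nonneg_nonneg order_refl order_trans)
  show ?thesis unfolding e P_def
    by (intro coprime_sum_sieve n r finite_ints_between M multiples_sum_antitone YZ nonneg lo hi) auto
qed

section \<open>Sizes of n / totient n and of the sieve errors\<close>

text \<open>The largest of k distinct odd numbers from 3 on is at least 2 k + 1, and (1 + 1 / (2 k))
  sqrt(2 k - 1) \<le> sqrt(2 k + 1). This weak substitute for Mertens' theorem suffices, since n /
  totient n only has to be O(sqrt(ln n)).\<close>

lemma prod_odd_ratio_le:
  assumes "finite P" "\<And>p. p \<in> P \<Longrightarrow> odd p \<and> p \<ge> (3::nat)"
  shows "(\<Prod>p\<in>P. real p / (real p - 1)) \<le> sqrt (2 * card P + 1)"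
  using assms
proof (induction P rule: finite_linorder_max_induct)
  case (insert b A)
  define k where "k = real (card A) + 1"
  have k1: "k \<ge> 1" by (simp add: k_def)
  have "insert b A \<subseteq> (\<lambda>i. 2 * i + 1) ` {1..(b - 1) div 2}"
  proof
    fix x assume x: "x \<in> insert b A"
    then have "odd x" "x \<ge> 3" "x \<le> b" using insert by (auto intro: less_imp_le)
    then have "x = 2 * ((x - 1) div 2) + 1" "(x - 1) div 2 \<in> {1..(b - 1) div 2}"
      by (auto intro: div_le_mono diff_le_mono)
    then show "x \<in> (\<lambda>i. 2 * i + 1) ` {1..(b - 1) div 2}" by blast
  qed
  then have "card (insert b A) \<le> card ((\<lambda>i. 2 * i + 1) ` {1..(b - 1) div 2})"
    by (intro card_mono) auto
  also have "\<dots> \<le> (b - 1) div 2" using card_image_le[of "{1..(b - 1) div 2}" "\<lambda>i. 2 * i + 1"] by simp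
  finally have "card A + 1 \<le> (b - 1) div 2" using insert by (subst (asm) card_insert_disjoint) auto
  then have "2 * (card A + 1) \<le> 2 * ((b - 1) div 2)" by (rule mult_le_mono2)
  also have "\<dots> \<le> b - 1" by simp
  finally have "2 * (card A + 1) \<le> b - 1" .
  moreover have "b \<ge> 3" using insert by auto
  ultimately have "b \<ge> 2 * (card A + 1) + 1" by linarith
  then have "real b \<ge> real (2 * (card A + 1) + 1)" by (rule of_nat_mono)
  then have b: "real b \<ge> 2 * k + 1" by (simp add: k_def)
  have "real b / (real b - 1) \<le> (2 * k + 1) / (2 * k)"
    using b k1 by (simp add: field_simps)
  moreover have "(\<Prod>p\<in>A. real p / (real p - 1)) \<le> sqrt (2 * k - 1)"
    using insert.IH insert.prems by (simp add: k_def)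
  moreover have "(\<Prod>p\<in>A. real p / (real p - 1)) \<ge> 0"
    using insert.prems by (intro prod_nonneg) (fastforce intro!: divide_nonneg_nonneg)
  ultimately have "(real b / (real b - 1)) * (\<Prod>p\<in>A. real p / (real p - 1)) \<le> ((2 * k + 1) / (2 * k)) * sqrt (2 * k - 1)"
    using k1 by (intro mult_mono) auto
  also have "\<dots> \<le> sqrt (2 * k + 1)"
  proof (rule real_le_rsqrt)
    have "(2 * k - 1) * (2 * k + 1) \<le> 4 * k\<^sup>2" by (simp add: power2_eq_square algebra_simps)
    then have "((2 * k - 1) * (2 * k + 1)) * (2 * k + 1) \<le> 4 * k\<^sup>2 * (2 * k + 1)"
      using k1 by (intro mult_right_mono) auto
    moreover have "((2 * k + 1) / (2 * k) * sqrt (2 * k - 1))\<^sup>2 = ((2 * k - 1) * (2 * k + 1)) * (2 * k + 1) / (4 * k\<^sup>2)"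
      using k1 by (simp add: power_mult_distrib power_divide power2_eq_square)
    ultimately show "((2 * k + 1) / (2 * k) * sqrt (2 * k - 1))\<^sup>2 \<le> 2 * k + 1"
      using k1 by (simp add: divide_le_eq mult.commute)
  qed
  also have "2 * k + 1 = 2 * card (insert b A) + 1" using insert by (subst card_insert_disjoint) (auto simp: k_def)
  finally show ?case using insert by (subst prod.insert) auto
qed simp

lemma inverse_totient_ratio: "n > 0 \<Longrightarrow> real n / real (totient n) = (\<Prod>p\<in>prime_factors n. real p / (real p - 1))"
proof -
  assume n: "n > 0"
  have "real (totient n) / real n = (\<Prod>p\<in>prime_factors n. 1 - 1 / real p)"
    using n by (simp add: totient_formula2)
  also have "\<dots> = (\<Prod>p\<in>prime_factors n. inverse (real p / (real p - 1)))"
    by (intro prod.cong refl) (auto simp: field_simps prime_gt_0_nat dest!: in_prime_factors_imp_prime)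
  also have "\<dots> = inverse (\<Prod>p\<in>prime_factors n. real p / (real p - 1))"
    by (rule prod_inversef[unfolded o_def])
  finally show ?thesis by (metis inverse_divide inverse_inverse_eq)
qed

lemma ratio_totient_le:
  assumes "n > 0"
  shows "real n / real (totient n) \<le> 2 * sqrt (2 * card (prime_factors n) + 1)"
proof -
  let ?P = "prime_factors n" and ?f = "\<lambda>p. real p / (real p - 1)"
  have pr: "prime p" if "p \<in> ?P" for p using that by auto
  have "(\<Prod>p\<in>?P. ?f p) = (\<Prod>p\<in>?P \<inter> {2}. ?f p) * (\<Prod>p\<in>?P - {2}. ?f p)"
    by (subst prod.union_disjoint[symmetric]) (auto simp: Un_Diff_Int intro!: prod.cong)
  also have "\<dots> \<le> 2 * sqrt (2 * card (?P - {2}) + 1)"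
  proof (intro mult_mono prod_odd_ratio_le)
    show "(\<Prod>p\<in>?P \<inter> {2}. ?f p) \<le> 2" by (cases "2 \<in> ?P") auto
    show "odd p \<and> p \<ge> 3" if "p \<in> ?P - {2}" for p
    proof -
      have "prime p" "p \<noteq> 2" using that pr by auto
      then have "p \<ge> 2" using prime_ge_2_nat by blast
      then show ?thesis using \<open>prime p\<close> \<open>p \<noteq> 2\<close> prime_odd_nat[of p] by linarith
    qed
    show "(\<Prod>p\<in>?P - {2}. ?f p) \<ge> 0"
      using pr by (intro prod_nonneg) (auto intro!: divide_nonneg_nonneg simp: prime_ge_Suc_0_nat)
  qed auto
  also have "card (?P - {2}) \<le> card ?P" by (intro card_mono) auto
  finally show ?thesis using assms by (simp add: inverse_totient_ratio)
qed

lemma two_power_prime_factors_le: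
  fixes n :: nat
  assumes "n > 0"
  shows "2 ^ card (prime_factors n) \<le> n"
proof -
  have "2 ^ card (prime_factors n) = (\<Prod>p\<in>prime_factors n. 2::nat)" by simp
  also have "\<dots> \<le> \<Prod>(prime_factors n)"
    by (intro prod_mono) (auto intro: prime_ge_2_nat)
  also have "int (\<Prod>(prime_factors n)) dvd int n"
    by (subst prod_primes_dvd_iff) auto
  then have "\<Prod>(prime_factors n) \<le> n" unfolding int_dvd_int_iff by (rule dvd_imp_le[OF _ assms])
  finally show ?thesis .
qed

text \<open>Rankin's trick: weight every subset \<open>X\<close> by \<open>3 ^ card X\<close>.\<close>

lemma subset_reciprocal_sum_le:
  assumes "n > 0"
  shows "(\<Sum>X | X \<subseteq> prime_factors n \<and> card X = r. 1 / real (\<Prod>X)) \<le> (real n / real (totient n)) ^ 3 / 3 ^ r"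
proof -
  let ?P = "prime_factors n"
  have pr: "real p \<ge> 2" if "p \<in> ?P" for p using that prime_ge_2_nat[of p] by auto
  have "3 ^ r * (\<Sum>X | X \<subseteq> ?P \<and> card X = r. 1 / real (\<Prod>X)) = (\<Sum>X | X \<subseteq> ?P \<and> card X = r. (\<Prod>p\<in>X. 3 / real p))"
    unfolding sum_distrib_left by (intro sum.cong refl) (auto simp: prod_dividef)
  also have "\<dots> \<le> (\<Sum>X\<in>Pow ?P. (\<Prod>p\<in>X. 3 / real p))"
    by (intro sum_mono2) (auto intro!: prod_nonneg)
  also have "\<dots> = (\<Prod>p\<in>?P. 3 / real p + 1)" by (subst prod_add) auto
  also have "\<dots> \<le> (\<Prod>p\<in>?P. (real p / (real p - 1)) ^ 3)"
  proof (intro prod_mono conjI)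
    fix p assume "p \<in> ?P"
    then have p: "real p \<ge> 2" by (rule pr)
    define y where "y = 1 / (real p - 1)"
    have "y \<ge> 1 / real p" using p by (simp add: y_def field_simps)
    moreover have "y \<ge> 0" using p by (simp add: y_def)
    then have "(1 + y) ^ 3 \<ge> 1 + 3 * y" using Bernoulli_inequality[of y 3] by simp
    moreover have "real p / (real p - 1) = 1 + y" using p by (simp add: y_def field_simps)
    ultimately show "3 / real p + 1 \<le> (real p / (real p - 1)) ^ 3" by simp
  qed (use pr in \<open>auto intro!: add_nonneg_nonneg\<close>)
  also have "\<dots> = (real n / real (totient n)) ^ 3" by (simp add: inverse_totient_ratio[OF assms] prod_power_distrib)
  finally show ?thesis by (simp add: le_divide_eq mult.commute del: of_nat_prod)
qed

lemma card_small_subsets_le: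
  assumes "finite P"
  shows "card {X. X \<subseteq> P \<and> card X \<le> r} \<le> (card P + 1) ^ r"
proof -
  have "{X. X \<subseteq> P \<and> card X \<le> r} = (\<Union>k\<in>{..r}. {X. X \<subseteq> P \<and> card X = k})" by auto
  then have "card {X. X \<subseteq> P \<and> card X \<le> r} \<le> (\<Sum>k\<le>r. card {X. X \<subseteq> P \<and> card X = k})"
    by (simp only: card_UN_le finite_atMost)
  also have "\<dots> = (\<Sum>k\<le>r. card P choose k)" using n_subsets[OF assms] by simp
  also have "\<dots> \<le> (\<Sum>k\<le>r. card P ^ k)"
  proof (rule sum_mono)
    fix k show "card P choose k \<le> card P ^ k"
      by (cases "k \<le> card P") (auto simp: binomial_le_pow binomial_eq_0)
  qed
  also have "\<dots> \<le> (card P + 1) ^ r"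
  proof (induction r)
    case (Suc r)
    have "(\<Sum>k\<le>Suc r. card P ^ k) = (\<Sum>k\<le>r. card P ^ k) + card P * card P ^ r" by simp
    also have "\<dots> \<le> (card P + 1) ^ r + card P * (card P + 1) ^ r"
      using Suc by (intro add_mono mult_le_mono2 power_mono) auto
    also have "\<dots> = (card P + 1) ^ Suc r" by simp
    finally show ?case .
  qed simp
  finally show ?thesis .
qed

lemma card_prime_factors_le_ln:
  fixes n :: nat
  assumes "n > 0"
  shows "real (card (prime_factors n)) \<le> 2 * ln n"
proof -
  have "ln (2 ^ card (prime_factors n)) \<le> ln (real n)"
    using two_power_prime_factors_le[OF assms] assms
    by (subst ln_le_cancel_iff) (auto simp flip: of_nat_le_iff)
  then have "card (prime_factors n) * ln 2 \<le> ln n" by (simp add: ln_realpow)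
  moreover have "ln 2 \<ge> (1/2 :: real)" using ln2_ge_two_thirds by simp
  then have "card (prime_factors n) * (1/2) \<le> card (prime_factors n) * ln (2::real)" by (intro mult_left_mono) auto
  ultimately show ?thesis by simp
qed

lemma ratio_totient_le_sqrt_ln:
  assumes "n > 0"
  shows "real n / real (totient n) \<le> 2 * sqrt (4 * ln n + 1)"
proof -
  have "sqrt (2 * card (prime_factors n) + 1) \<le> sqrt (4 * ln n + 1)"
    using card_prime_factors_le_ln[OF assms] by simp
  then show ?thesis using ratio_totient_le[OF assms] by linarith
qed

text \<open>With L = ln N the sieve is cut at \<open>r\<close> near 10 ln L. Then 3^r \<ge> L^10
  beats the cube of N / totient N \<le> L with room for a relative error 1 / (2 L), while there are
  at most (L^2)^r \<le> exp(20 (ln L)^2 + 2 ln L) small subsets; the exponent 21 absorbs the lower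
  order term.\<close>

lemma totative_equidistribution:
  "\<forall>\<^sub>F N in at_top. \<forall>(Y::real) (Z::real). Y \<le> Z \<longrightarrow>
     \<bar>real (card {\<alpha>::int. Y \<le> \<alpha> \<and> \<alpha> \<le> Z \<and> coprime \<alpha> (int N)}) - (Z - Y) * (real (totient N) / real N)\<bar>
     \<le> (Z - Y) * (real (totient N) / real N) / (2 * ln N) + exp (21 * (ln (ln N))\<^sup>2)"
proof -
  have ev1: "\<forall>\<^sub>F N in at_top. 2 * sqrt (4 * ln (real N) + 1) \<le> ln N" by real_asymp
  have ev2: "\<forall>\<^sub>F N in at_top. 2 * ln (real N) + 1 \<le> (ln N)\<^sup>2" by real_asymp
  have ev3: "\<forall>\<^sub>F N in at_top. 2 * exp (2 * ln (ln (real N)) * (10 * ln (ln N) + 1)) \<le> exp (21 * (ln (ln N))\<^sup>2)"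
  proof -
    have "filterlim (\<lambda>N. ln (ln (real N))) at_top at_top" by real_asymp
    moreover have "\<forall>\<^sub>F x in at_top. 2 * exp (2 * x * (10 * x + 1)) \<le> exp (21 * x\<^sup>2 :: real)" by real_asymp
    ultimately show ?thesis by (rule eventually_compose_filterlim[rotated])
  qed
  have ev4: "\<forall>\<^sub>F N in at_top. ln (ln (real N)) \<ge> 1" by real_asymp
  have ev5: "\<forall>\<^sub>F N in at_top. ln (real N) \<ge> 3" by real_asymp
  show ?thesis using ev1 ev2 ev3 ev4 ev5 eventually_gt_at_top[of 1]
  proof eventually_elim
    case (elim N)
    have main: "\<bar>real (card {\<alpha>::int. Y \<le> \<alpha> \<and> \<alpha> \<le> Z \<and> coprime \<alpha> (int N)}) - (Z - Y) * (real (totient N) / real N)\<bar>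
     \<le> (Z - Y) * (real (totient N) / real N) / (2 * ln N) + exp (21 * (ln (ln N))\<^sup>2)" if YZ: "Y \<le> Z" for Y Z :: real
    proof -
    define L where "L = ln (real N)"
    define l where "l = ln L"
    define r where "r = nat \<lceil>10 * l\<rceil>"
    have l1: "l \<ge> 1" and L3: "L \<ge> 3" using elim by (simp_all add: l_def L_def)
    have r: "real r \<ge> 10 * l" "real r \<le> 10 * l + 1" "r > 0" using l1 unfolding r_def by linarith+
    have N: "N > 0" using elim by simp
    have L: "L = exp l" using L3 by (simp add: l_def)
    define \<rho> where "\<rho> = real (totient N) / real N"
    have tp: "totient N > 0" using N by simp
    have \<rho>0: "\<rho> > 0" using N tp by (simp add: \<rho>_def)
    have ratL: "1 / \<rho> \<le> L"
      using order_trans[OF ratio_totient_le_sqrt_ln[OF N]] elim(1) by (simp add: \<rho>_def L_def)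
    let ?S = "(\<Sum>X | X \<subseteq> prime_factors N \<and> card X = r. 1 / real (\<Prod>X))"
    let ?c = "real (card {X. X \<subseteq> prime_factors N \<and> card X \<le> r})"
    have "\<bar>(\<Sum>\<alpha>\<in>{\<alpha>::int. Y \<le> real_of_int \<alpha> + 0 \<and> real_of_int \<alpha> + 0 \<le> Z \<and> coprime \<alpha> (int N)}. 1) - (Z - Y) * \<rho>\<bar>
      \<le> 2 * (Z - Y) * ?S + 2 * 1 * ?c" unfolding \<rho>_def
      by (rule coprime_sum_antitone[where f="\<lambda>_. 1" and F="\<lambda>y. y"]) (use N r YZ in auto)
    then have main: "\<bar>real (card {\<alpha>::int. Y \<le> \<alpha> \<and> \<alpha> \<le> Z \<and> coprime \<alpha> (int N)}) - (Z - Y) * \<rho>\<bar> \<le> 2 * (Z - Y) * ?S + 2 * ?c"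
      by simp
    have "?S \<le> (1 / \<rho>) ^ 3 / 3 ^ r" using subset_reciprocal_sum_le[OF N, of r] by (simp add: \<rho>_def)
    also have "\<dots> \<le> L ^ 3 / L ^ 10"
    proof (intro frac_le power_mono ratL)
      have "L ^ 10 = exp (10 * l)" by (simp add: L exp_of_nat_mult[symmetric])
      also have "\<dots> \<le> exp r" using r by simp
      also have "\<dots> = exp 1 ^ r" by (simp add: exp_of_nat_mult[symmetric])
      also have "\<dots> \<le> 3 ^ r" using exp_le by (intro power_mono) auto
      finally show "L ^ 10 \<le> 3 ^ r" .
    qed (use L3 \<rho>0 in auto)
    also have "\<dots> \<le> 1 / (4 * L * L)"
    proof -
      have "4 * L * L * L ^ 3 = 4 * L ^ 5" by (simp add: eval_nat_numeral)
      also have "\<dots> \<le> L ^ 5 * L ^ 5" using power_mono[of 3 L 5] L3 by (intro mult_right_mono) auto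
      finally have "4 * L * L * L ^ 3 \<le> L ^ 10" by (simp add: power_add[symmetric])
      then show ?thesis using L3 by (simp add: field_simps)
    qed
    also have "\<dots> \<le> \<rho> / (4 * L)" using ratL \<rho>0 L3 by (simp add: field_simps)
    finally have "2 * (Z - Y) * ?S \<le> 2 * (Z - Y) * (\<rho> / (4 * L))" using YZ by (intro mult_left_mono) auto
    also have "\<dots> = (Z - Y) * \<rho> / (2 * L)" using L3 by (simp add: field_simps)
    finally have S: "2 * (Z - Y) * ?S \<le> (Z - Y) * \<rho> / (2 * L)" .
    have "?c \<le> real ((card (prime_factors N) + 1) ^ r)"
      unfolding of_nat_le_iff by (rule card_small_subsets_le) simp
    also have "\<dots> \<le> (L\<^sup>2) ^ r"
      using card_prime_factors_le_ln[OF N] elim(2) by (simp add: L_def) (intro power_mono, auto)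
    also have "\<dots> = exp (2 * l * r)" by (simp add: L exp_of_nat_mult[symmetric] power_mult[symmetric] mult_ac)
    also have "\<dots> \<le> exp (2 * l * (10 * l + 1))" using r l1 by simp
    finally have "2 * ?c \<le> exp (21 * l\<^sup>2)" using elim(3) by (simp add: l_def L_def)
    then show ?thesis
      using main S unfolding \<rho>_def[symmetric] L_def[symmetric] l_def[symmetric]
      by linarith
    qed
    show ?case by (intro allI impI main)
  qed
qed

section \<open>Sums of the totient function\<close>

text \<open>Divided by \<tau>, this is the sum of the lengths, inside the unit interval, of the
  intervals of radius 1 / (\<tau> q^2) around the reduced fractions with denominator q \<le> n; see
  \<open>sum_interval_weight\<close>.\<close>

definition totient_sum :: "nat \<Rightarrow> real" where
  "totient_sum n = (\<Sum>q=1..n. 2 * real (totient q) / (real q)\<^sup>2)"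

text \<open>1 / (m + 1)^2 \<le> 1 / m - 1 / (m + 1), so the partial sums become decreasing once 1 /
  m is added.\<close>

lemma sum_inverse_squares_tail: "n \<ge> 1 \<Longrightarrow> m \<ge> n \<Longrightarrow>
  (\<Sum>k=1..m. 1 / (real k)\<^sup>2) + 1 / m \<le> (\<Sum>k=1..n. 1 / (real k)\<^sup>2) + 1 / n"
proof (induction m)
  case (Suc m)
  show ?case
  proof (cases "n \<le> m")
    case True
    note step = True Suc.prems Suc.IH[OF Suc.prems(1) True]
  have "1 / (real m + 1)\<^sup>2 + 1 / (real m + 1) \<le> 1 / real m"
    using step by (simp add: divide_simps power2_eq_square) (simp add: algebra_simps)
  then show ?thesis using step by (simp add: algebra_simps)
  next
    case False
    then have "n = Suc m" using Suc.prems by simp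
    then show ?thesis by simp
  qed
qed simp

text \<open>7 / 4 = 1 + 1 / 4 + 1 / 2. What matters is that the terms from k = 2 on stay below 1, so
  that the recursion for the totient sum contracts.\<close>

lemma sum_inverse_squares_le: "(\<Sum>k=1..n. 1 / (real k)\<^sup>2) \<le> 7 / 4"
proof (cases "n \<ge> 2")
  case True
  have "{1..2::nat} = {1,2}" by auto
  then have "(\<Sum>k=1..n. 1 / (real k)\<^sup>2) + 1 / n \<le> 7/4"
    using sum_inverse_squares_tail[of 2 n] True by simp
  moreover have "1 / real n \<ge> 0" by simp
  ultimately show ?thesis by linarith
next
  case False
  then have "n = 0 \<or> n = 1" by auto
  then show ?thesis by auto
qed

lemma sum_inverse_squares_limit: "(\<lambda>n. \<Sum>k=1..n. 1 / (real k)\<^sup>2) \<longlonglongrightarrow> pi\<^sup>2 / 6"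
proof -
  have "(\<lambda>n. \<Sum>k<n. 1 / (real k + 1)\<^sup>2) \<longlonglongrightarrow> pi\<^sup>2 / 6"
    using inverse_squares_sums by (simp add: sums_def add.commute)
  moreover have "(\<Sum>k=1..n. 1 / (real k)\<^sup>2) = (\<Sum>k<n. 1 / (real k + 1)\<^sup>2)" for n
    by (rule sum.reindex_bij_witness[of _ Suc "\<lambda>k. k - 1"]) auto
  ultimately show ?thesis by simp
qed

lemma sum_inverse_squares_bounds:
  shows "(\<Sum>k=1..n. 1 / (real k)\<^sup>2) \<le> pi\<^sup>2 / 6"
    and "n \<ge> 1 \<Longrightarrow> (\<Sum>k=1..n. 1 / (real k)\<^sup>2) \<ge> pi\<^sup>2 / 6 - 1 / n"
proof -
  show "(\<Sum>k=1..n. 1 / (real k)\<^sup>2) \<le> pi\<^sup>2 / 6"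
    by (rule incseq_le[OF _ sum_inverse_squares_limit]) (auto simp: incseq_def intro!: sum_mono2)
  assume n: "n \<ge> 1"
  have "pi\<^sup>2 / 6 + 0 \<le> (\<Sum>k=1..n. 1 / (real k)\<^sup>2) + 1 / n"
  proof (rule LIMSEQ_le_const2)
    show "(\<lambda>m. (\<Sum>k=1..m. 1 / (real k)\<^sup>2) + 1 / m) \<longlonglongrightarrow> pi\<^sup>2 / 6 + 0"
      by (intro tendsto_add sum_inverse_squares_limit) real_asymp
    show "\<exists>M. \<forall>m\<ge>M. (\<Sum>k=1..m. 1 / (real k)\<^sup>2) + 1 / m \<le> (\<Sum>k=1..n. 1 / (real k)\<^sup>2) + 1 / n"
      using sum_inverse_squares_tail[OF n] by blast
  qed
  then show "(\<Sum>k=1..n. 1 / (real k)\<^sup>2) \<ge> pi\<^sup>2 / 6 - 1 / n" by simp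
qed

lemma inverse_le_ln_diff: "n \<ge> 2 \<Longrightarrow> 1 / real n \<le> ln n - ln (real n - 1)"
proof -
  assume n: "n \<ge> 2"
  have "ln ((real n - 1) / n) \<le> (real n - 1) / n - 1" using n by (intro ln_le_minus_one) auto
  then show ?thesis using n by (simp add: ln_div field_simps)
qed

lemma ln_Suc_diff_le_inverse: "k \<ge> 1 \<Longrightarrow> ln (real (Suc k)) - ln k \<le> 1 / k"
proof -
  assume k: "k \<ge> 1"
  have "ln (real (Suc k) / k) \<le> real (Suc k) / k - 1" using k by (intro ln_le_minus_one) auto
  then show ?thesis using k by (simp add: ln_div field_simps)
qed

lemma harmonic_sum_bounds:
  assumes "n \<ge> 1"
  shows "ln n \<le> (\<Sum>k=1..n. 1 / real k)" and "(\<Sum>k=1..n. 1 / real k) \<le> 1 + ln n"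
proof -
  show "ln n \<le> (\<Sum>k=1..n. 1 / real k)"
    using assms
  proof (induction n rule: dec_induct)
    case (step n)
    have "ln (real (Suc n) + 1) \<le> (\<Sum>k=1..Suc n. 1 / real k)"
      using ln_le_harm[of "Suc n"] by (simp add: harm_def inverse_eq_divide)
    moreover have "ln (real (Suc n)) \<le> ln (real (Suc n) + 1)" by simp
    ultimately show ?case by linarith
  qed simp
  show "(\<Sum>k=1..n. 1 / real k) \<le> 1 + ln n"
    using assms
  proof (induction n rule: dec_induct)
    case (step n)
    then show ?case using inverse_le_ln_diff[of "Suc n"] by simp
  qed simp
qed

lemma sum_ln_over_square_bounded: "\<exists>B\<ge>0. \<forall>n. (\<Sum>k=1..n. ln (real k) / (real k)\<^sup>2) \<le> B"
proof -
  have s: "summable (\<lambda>k. 2 * real k powr (-3/2))"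
    by (intro summable_mult) (simp add: summable_real_powr_iff)
  have "(\<Sum>k=1..n. ln (real k) / (real k)\<^sup>2) \<le> (\<Sum>k. 2 * real k powr (-3/2))" for n
  proof -
    have "(\<Sum>k=1..n. ln (real k) / (real k)\<^sup>2) \<le> (\<Sum>k=1..n. 2 * real k powr (-3/2))"
    proof (rule sum_mono)
      fix k assume "k \<in> {1..n}"
      then have k: "real k > 0" by simp
      have "ln k = 2 * ln (sqrt k)" using k by (simp add: ln_sqrt)
      also have "\<dots> \<le> 2 * sqrt k" using k ln_le_minus_one[of "sqrt k"] by simp
      finally have "ln k / (real k)\<^sup>2 \<le> 2 * sqrt k / (real k)\<^sup>2" by (simp add: divide_right_mono)
      also have "\<dots> = 2 * (real k powr (1/2) * real k powr (-2))"
      proof -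
        have "real k powr (-2) = 1 / (real k)\<^sup>2" using k by (simp add: powr_minus_divide)
        then show ?thesis using k by (simp add: powr_half_sqrt)
      qed
      also have "\<dots> = 2 * real k powr (-3/2)" by (simp add: powr_add[symmetric])
      finally show "ln k / (real k)\<^sup>2 \<le> 2 * real k powr (-3/2)" .
    qed
    also have "\<dots> \<le> (\<Sum>k. 2 * real k powr (-3/2))"
      by (rule sum_le_suminf[OF s]) auto
    finally show ?thesis .
  qed
  moreover from this[of 0] have "(\<Sum>k. 2 * real k powr (-3/2)) \<ge> 0" by simp
  ultimately show ?thesis by blast
qed

text \<open>Inverting this relation needs no Moebius function: it expresses the error term at \<open>n\<close> by
  the error terms at \<open>n div k\<close>, \<open>k \<ge> 2\<close>, with weights \<open>1 / k\<^sup>2\<close> of sum at most \<open>3 / 4\<close>.\<close>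

lemma harmonic_totient_convolution:
  "(\<Sum>m=1..n. 1 / real m) = (\<Sum>k=1..n. (\<Sum>q=1..n div k. real (totient q) / (real q)\<^sup>2) / (real k)\<^sup>2)"
proof -
  have "(\<Sum>m=1..n. 1 / real m) = (\<Sum>m=1..n. \<Sum>d | d dvd m. real (totient d) / (real m)\<^sup>2)"
  proof (rule sum.cong[OF refl])
    fix m assume "m \<in> {1..n}"
    then have "1 / real m = real (\<Sum>d | d dvd m. totient d) / (real m)\<^sup>2"
      by (simp add: totient_divisor_sum power2_eq_square)
    then show "1 / real m = (\<Sum>d | d dvd m. real (totient d) / (real m)\<^sup>2)"
      by (simp add: sum_divide_distrib)
  qed
  also have "\<dots> = (\<Sum>(m, d)\<in>(SIGMA m:{1..n}. {d. d dvd m}). real (totient d) / (real m)\<^sup>2)"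
    by (rule sum.Sigma) auto
  also have "\<dots> = (\<Sum>(k, q)\<in>(SIGMA k:{1..n}. {1..n div k}). real (totient q) / (real q)\<^sup>2 / (real k)\<^sup>2)"
  proof (rule sum.reindex_bij_witness[where i="\<lambda>(k, q). (k * q, q)" and j="\<lambda>(m, d). (m div d, d)"])
    fix x assume "x \<in> (SIGMA m:{1..n}. {d. d dvd m})"
    then obtain m d where x: "x = (m, d)" and a: "1 \<le> m" "m \<le> n" "d dvd m" by auto
    then obtain k where k: "m = d * k" by (elim dvdE)
    then have pos: "d > 0" "k > 0" using a by (auto intro: gr0I)
    have "k \<le> n" using k a(2) pos(1) by (meson dual_order.trans dvd_imp_le dvd_triv_right le_trans nat_0_less_mult_iff pos(2))
    then show "(case case x of (m, d) \<Rightarrow> (m div d, d) of (k, q) \<Rightarrow> (k * q, q)) = x"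
      "(case x of (m, d) \<Rightarrow> (m div d, d)) \<in> (SIGMA k:{1..n}. {1..n div k})"
      "(case (case x of (m, d) \<Rightarrow> (m div d, d)) of (k, q) \<Rightarrow> real (totient q) / (real q)\<^sup>2 / (real k)\<^sup>2) =
        (case x of (m, d) \<Rightarrow> real (totient d) / (real m)\<^sup>2)"
      using a k pos x by (auto simp: less_eq_div_iff_mult_less_eq power_mult_distrib)
  next
    fix x assume "x \<in> (SIGMA k:{1..n}. {1..n div k})"
    then show "(case case x of (k, q) \<Rightarrow> (k * q, q) of (m, d) \<Rightarrow> (m div d, d)) = x"
      "(case x of (k, q) \<Rightarrow> (k * q, q)) \<in> (SIGMA m:{1..n}. {d. d dvd m})"
      by (auto simp: less_eq_div_iff_mult_less_eq mult.commute)
  qed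
  also have "\<dots> = (\<Sum>k=1..n. \<Sum>q=1..n div k. real (totient q) / (real q)\<^sup>2 / (real k)\<^sup>2)"
    by (rule sum.Sigma[symmetric]) auto
  finally show ?thesis by (simp add: sum_divide_distrib)
qed

lemma ln_div_bounds:
  assumes "1 \<le> k" "k \<le> (n::nat)"
  shows "ln (real (n div k)) \<le> ln n - ln k" and "ln n - ln k - ln 2 \<le> ln (real (n div k))"
proof -
  have d1: "n div k \<ge> 1" using assms by (simp add: div_greater_zero_iff Suc_le_eq)
  have "real (n div k) \<le> real n / real k" by (rule of_nat_div_le_of_nat)
  then have "ln (real (n div k)) \<le> ln (real n / real k)" using d1 by (subst ln_le_cancel_iff) auto
  then show "ln (real (n div k)) \<le> ln n - ln k" using assms by (simp add: ln_div)
  have "n < k * (n div k + 1)" using assms by (simp add: dividend_less_times_div)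
  also have "\<dots> \<le> k * (2 * (n div k))" using d1 by (intro mult_le_mono2) simp
  finally have "real n \<le> real (k * (2 * (n div k)))" by (intro of_nat_mono) simp
  then have "ln (real n) \<le> ln (real k * (2 * real (n div k)))" using assms by (subst ln_le_cancel_iff) auto
  also have "\<dots> = ln k + (ln 2 + ln (real (n div k)))"
    using assms d1 by (subst ln_mult_pos; simp add: ln_mult_pos)+
  finally show "ln n - ln k - ln 2 \<le> ln (real (n div k))" by simp
qed

text \<open>\<open>R\<close> convolves the error \<open>E\<close> with 1 / k^2. It is bounded
  because the harmonic sum and \<kappa> times the convolution of ln are both ln n + O(1), \<kappa>
  being 1 / zeta(2). Isolating the term k = 1 expresses \<open>E n\<close> by \<open>R n\<close> and
  errors at smaller arguments.\<close>

lemma totient_sum_asymptotic: "\<exists>K\<ge>0. \<forall>n\<ge>1. \<bar>totient_sum n - 12 / pi\<^sup>2 * ln n\<bar> \<le> K"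
proof -
  obtain B where B0: "B \<ge> 0" and B: "\<And>n. (\<Sum>k=1..n. ln (real k) / (real k)\<^sup>2) \<le> B"
    using sum_ln_over_square_bounded by blast
  define \<kappa> where "\<kappa> = 6 / pi\<^sup>2"
  have \<kappa>: "\<kappa> > 0" "\<kappa> * (pi\<^sup>2 / 6) = 1" by (auto simp: \<kappa>_def)
  have "pi\<^sup>2 / 6 \<ge> 1" using sum_inverse_squares_bounds(1)[of 1] by simp
  then have \<kappa>1: "\<kappa> \<le> 1" by (simp add: \<kappa>_def)
  define \<psi> where "\<psi> n = (\<Sum>q=1..n. real (totient q) / (real q)\<^sup>2)" for n
  define E where "E n = \<psi> n - \<kappa> * ln (real n)" for n
  define R where "R n = (\<Sum>k=1..n. E (n div k) / (real k)\<^sup>2)" for n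
  have R: "\<bar>R n\<bar> \<le> B + 3" if n: "n \<ge> 1" for n
  proof -
    define U where "U = (\<Sum>k=1..n. ln (real (n div k)) / (real k)\<^sup>2)"
    have RU: "R n = (\<Sum>m=1..n. 1 / real m) - \<kappa> * U"
      unfolding harmonic_totient_convolution R_def E_def \<psi>_def U_def
      by (simp add: diff_divide_distrib sum_subtractf sum_distrib_left)
    have "U \<le> (\<Sum>k=1..n. ln n * (1 / (real k)\<^sup>2))" unfolding U_def
    proof (rule sum_mono)
      fix k assume k: "k \<in> {1..n}"
      have "ln (real (n div k)) \<le> ln n" using ln_div_bounds(1)[of k n] k ln_ge_zero[of "real k"] by (simp del: ln_ge_zero_iff ln_ge_zero)
      then show "ln (real (n div k)) / (real k)\<^sup>2 \<le> ln n * (1 / (real k)\<^sup>2)" by (simp add: divide_right_mono)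
    qed
    also have "\<dots> \<le> ln n * (pi\<^sup>2 / 6)" unfolding sum_distrib_left[symmetric]
      using sum_inverse_squares_bounds(1) n by (intro mult_left_mono) auto
    finally have "\<kappa> * U \<le> \<kappa> * (ln n * (pi\<^sup>2 / 6))" using \<kappa> by (intro mult_left_mono) auto
    also have "\<dots> = ln n" using \<kappa>(2) by (metis mult.left_commute mult.right_neutral)
    finally have 1: "R n \<ge> 0" using RU harmonic_sum_bounds(1)[OF n] by linarith
    have "ln n * (pi\<^sup>2 / 6 - 1 / n) - B - ln 2 * (pi\<^sup>2 / 6)
       \<le> ln n * (\<Sum>k=1..n. 1 / (real k)\<^sup>2) - (\<Sum>k=1..n. ln (real k) / (real k)\<^sup>2) - ln 2 * (\<Sum>k=1..n. 1 / (real k)\<^sup>2)"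
      using sum_inverse_squares_bounds n B by (intro diff_mono mult_left_mono) auto
    also have "\<dots> = (\<Sum>k=1..n. (ln n - ln k - ln 2) / (real k)\<^sup>2)"
      by (simp add: diff_divide_distrib sum_subtractf sum_distrib_left)
    also have "\<dots> \<le> U" unfolding U_def
      by (intro sum_mono divide_right_mono ln_div_bounds) auto
    finally have "\<kappa> * (ln n * (pi\<^sup>2 / 6 - 1 / n) - B - ln 2 * (pi\<^sup>2 / 6)) \<le> \<kappa> * U" using \<kappa> by (intro mult_left_mono) auto
    moreover have "\<kappa> * (ln n * (pi\<^sup>2 / 6 - 1 / n) - B - ln 2 * (pi\<^sup>2 / 6)) = (\<kappa> * (pi\<^sup>2 / 6)) * ln n - \<kappa> * (ln n / n) - \<kappa> * B - ln 2 * (\<kappa> * (pi\<^sup>2 / 6))"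
      by (simp add: algebra_simps)
    moreover have "\<kappa> * (ln n / n) \<le> 1 * 1" using \<kappa> \<kappa>1 n ln_le_minus_one[of "real n"] by (intro mult_mono) (auto simp: field_simps)
    moreover have "\<kappa> * B \<le> 1 * B" using \<kappa>1 B0 by (intro mult_right_mono) auto
    moreover have "ln 2 \<le> (1::real)" using ln_le_minus_one[of 2] by simp
    ultimately have "\<kappa> * U \<ge> ln n - 1 - B - 1" unfolding \<kappa>(2) by linarith
    then have "R n \<le> B + 3" using RU harmonic_sum_bounds(2)[OF n] by linarith
    then show ?thesis using 1 by simp
  qed
  \<comment> \<open>A bound b survives the induction if b \<ge> (B + 3) + 3/4 b; this gives 4 (B +
    3).\<close>
  have E: "\<bar>E n\<bar> \<le> 4 * (B + 3)" if "n \<ge> 1" for n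
    using that
  proof (induction n rule: less_induct)
    case (less n)
    have split: "{1..n} = insert 1 {2..n}" using less.prems by auto
    have "R n = E n + (\<Sum>k=2..n. E (n div k) / (real k)\<^sup>2)"
      unfolding R_def split by (subst sum.insert) auto
    moreover have "\<bar>\<Sum>k=2..n. E (n div k) / (real k)\<^sup>2\<bar> \<le> 3 * (B + 3)"
    proof -
    have "\<bar>\<Sum>k=2..n. E (n div k) / (real k)\<^sup>2\<bar> \<le> (\<Sum>k=2..n. 4 * (B + 3) * (1 / (real k)\<^sup>2))"
    proof (rule order_trans[OF sum_abs], rule sum_mono)
      fix k assume k: "k \<in> {2..n}"
      then have "n div k < n" "n div k \<ge> 1" by (auto simp: div_greater_zero_iff Suc_le_eq)
      then have "\<bar>E (n div k)\<bar> \<le> 4 * (B + 3)" by (rule less.IH)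
      then show "\<bar>E (n div k) / (real k)\<^sup>2\<bar> \<le> 4 * (B + 3) * (1 / (real k)\<^sup>2)"
        by (simp add: divide_right_mono)
    qed
    also have "\<dots> = 4 * (B + 3) * ((\<Sum>k=1..n. 1 / (real k)\<^sup>2) - 1)"
      unfolding split by (subst sum.insert) (auto simp: sum_distrib_left)
    also have "\<dots> \<le> 4 * (B + 3) * (3 / 4)"
      using sum_inverse_squares_le[of n] B0 by (intro mult_left_mono) auto
    finally show ?thesis by simp
    qed
    moreover have "\<bar>R n - (\<Sum>k=2..n. E (n div k) / (real k)\<^sup>2)\<bar> \<le> \<bar>R n\<bar> + \<bar>\<Sum>k=2..n. E (n div k) / (real k)\<^sup>2\<bar>"
      by (rule abs_triangle_ineq4)
    ultimately have "\<bar>E n\<bar> \<le> (B + 3) + 3 * (B + 3)" using R[OF less.prems] by simp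
    then show ?case by simp
  qed
  show ?thesis
  proof (intro exI[of _ "8 * (B + 3)"] conjI allI impI)
    fix n :: nat assume n: "n \<ge> 1"
    have "totient_sum n - 12 / pi\<^sup>2 * ln n = 2 * E n"
      by (simp add: totient_sum_def E_def \<psi>_def \<kappa>_def sum_distrib_left)
    then show "\<bar>totient_sum n - 12 / pi\<^sup>2 * ln n\<bar> \<le> 8 * (B + 3)" using E[OF n] by (simp add: abs_mult)
  qed (use B0 in auto)
qed

text \<open>With a = ln (n + 1) and b = ln n, the increment a^2 - b^2 = (a - b) (a + b) is estimated
  by a - b \<ge> 1 / (n + 1) and a + b \<ge> 2 a - 1 / n. The loss 1 / (n (n + 1)) telescopes to 1 -
  1 / n. The leading constant 1/2 has to be sharp for the variance.\<close>

lemma sum_ln_over_id_le: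
  assumes "n \<ge> 1"
  shows "(\<Sum>k=1..n. ln (real k) / real k) \<le> (ln n)\<^sup>2 / 2 + (1 - 1 / n) / 2"
  using assms
proof (induction n rule: dec_induct)
  case (step n)
  define a b where "a = ln (real (Suc n))" and "b = ln (real n)"
  have n: "real n \<ge> 1" using step by simp
  have d1: "1 / real (Suc n) \<le> a - b" using inverse_le_ln_diff[of "Suc n"] step by (simp add: a_def b_def)
  have d2: "a - b \<le> 1 / n" using ln_Suc_diff_le_inverse[of n] step by (simp add: a_def b_def)
  have ab: "0 \<le> b" "b \<le> a" using n by (auto simp: a_def b_def)
  have y: "(1 / real (Suc n)) * (a + b) \<le> (a - b) * (a + b)" using d1 ab by (intro mult_right_mono) auto
  have "2 * a - 1 / n \<le> a + b" using d2 by simp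
  then have "(1 / real (Suc n)) * (2 * a - 1 / n) \<le> (1 / real (Suc n)) * (a + b)"
    by (rule mult_left_mono) simp
  note order_trans[OF this y]
  also have "(a - b) * (a + b) = a\<^sup>2 - b\<^sup>2" by (simp add: power2_eq_square algebra_simps)
  also have "(1 / real (Suc n)) * (2 * a - 1 / n) = 2 * (a / real (Suc n)) - (1 / n - 1 / real (Suc n))"
    using n by (simp add: divide_simps) (simp add: algebra_simps)?
  finally have "2 * (a / real (Suc n)) - (1 / n - 1 / real (Suc n)) \<le> a\<^sup>2 - b\<^sup>2" .
  moreover have "2 * u - v \<le> z \<Longrightarrow> u \<le> (z + v) / 2" for u v z :: real by simp
  ultimately have "a / real (Suc n) \<le> (a\<^sup>2 - b\<^sup>2 + (1 / n - 1 / real (Suc n))) / 2" by blast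
  then have "a / real (Suc n) \<le> a\<^sup>2 / 2 - b\<^sup>2 / 2 + (1 / n - 1 / real (Suc n)) / 2"
    by (simp only: add_divide_distrib diff_divide_distrib)
  then show ?case using step.IH by (simp add: a_def[symmetric] b_def[symmetric] diff_divide_distrib del: of_nat_Suc)
qed simp

lemma totient_sum_ge_2: "n \<ge> 1 \<Longrightarrow> totient_sum n \<ge> 2"
proof -
  assume "n \<ge> 1"
  then have "(\<Sum>q\<in>{1}. 2 * real (totient q) / (real q)\<^sup>2) \<le> totient_sum n"
    unfolding totient_sum_def by (intro sum_mono2) auto
  then show ?thesis by simp
qed

text \<open>Write \<Phi> for \<open>totient_sum\<close>. Pairs q1 < q2 in the second moment produce
  the sum on the left, which may exceed the squared mean \<Phi>(Q)^2 only by O(\<Phi>(Q)). From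
  \<Phi>(n) = c ln n + O(1), both sides are (c ln Q)^2 to leading order.\<close>

lemma totient_sum_convolution_le:
  "\<exists>K\<ge>0. \<forall>Q\<ge>1. 2 * (\<Sum>q=1..Q. 2 * real (totient q) / (real q)\<^sup>2 * totient_sum (Q div q))
     \<le> (totient_sum Q)\<^sup>2 + K * totient_sum Q"
proof -
  obtain K where K0: "K \<ge> 0" and K: "\<And>n. n \<ge> 1 \<Longrightarrow> \<bar>totient_sum n - 12 / pi\<^sup>2 * ln n\<bar> \<le> K"
    using totient_sum_asymptotic by blast
  define c where "c = 12 / pi\<^sup>2"
  have "pi\<^sup>2 \<ge> 2\<^sup>2" using pi_ge_two by (intro power_mono) auto
  then have c: "c > 0" "c \<le> 3" by (auto simp: c_def field_simps)
  define w where "w q = 2 * real (totient q) / (real q)\<^sup>2" for q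
  have w0: "w q \<ge> 0" for q by (simp add: w_def)
  have \<Phi>: "totient_sum n = (\<Sum>q=1..n. w q)" for n by (simp add: totient_sum_def w_def)
  show ?thesis
  proof (intro exI[of _ "9 + 12 * K + 3 * K\<^sup>2 + 6 * K"] conjI allI impI)
    fix Q :: nat assume Q: "Q \<ge> 1"
    define x where "x = ln (real Q)"
    define F where "F = totient_sum Q"
    have x0: "x \<ge> 0" using Q by (simp add: x_def)
    have F2: "F \<ge> 2" using totient_sum_ge_2[OF Q] by (simp add: F_def)
    have KF: "c * x \<le> F + K" using K[OF Q] by (simp add: c_def x_def F_def abs_le_iff)
    \<comment> \<open>Partial summation: this spreads the factor ln Q - ln q over k, and exchanging
      the sums leaves \<open>totient_sum k / k\<close>, hence a sum of ln k / k.\<close>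
    have lnq: "ln Q - ln q \<le> (\<Sum>k=q..<Q. 1 / real k)" if "1 \<le> q" "q \<le> Q" for q
      using that(2,1)
    proof (induction Q rule: dec_induct)
      case (step m)
      then show ?case using ln_Suc_diff_le_inverse[of m] by (simp add: sum.atLeastLessThan_Suc)
    qed simp
    have "(\<Sum>q=1..Q. w q * (ln Q - ln q)) \<le> (\<Sum>q=1..Q. \<Sum>k=q..<Q. w q / real k)"
    proof (rule sum_mono)
      fix q assume "q \<in> {1..Q}"
      then have "w q * (ln Q - ln q) \<le> w q * (\<Sum>k=q..<Q. 1 / real k)" using lnq w0 by (intro mult_left_mono) auto
      then show "w q * (ln Q - ln q) \<le> (\<Sum>k=q..<Q. w q / real k)" by (simp add: sum_distrib_left)
    qed
    also have "\<dots> = (\<Sum>(q,k)\<in>(SIGMA q:{1..Q}. {q..<Q}). w q / real k)" by (rule sum.Sigma) auto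
    also have "\<dots> = (\<Sum>(k,q)\<in>(SIGMA k:{1..<Q}. {1..k}). w q / real k)"
      by (rule sum.reindex_bij_witness[where i="\<lambda>(a,b). (b,a)" and j="\<lambda>(a,b). (b,a)"]) auto
    also have "\<dots> = (\<Sum>k=1..<Q. \<Sum>q=1..k. w q / real k)" by (rule sum.Sigma[symmetric]) auto
    also have "\<dots> = (\<Sum>k=1..<Q. totient_sum k / real k)" by (simp add: \<Phi> sum_divide_distrib)
    also have "\<dots> \<le> (\<Sum>k=1..<Q. (c * ln k + K) / real k)"
    proof (intro sum_mono divide_right_mono)
      fix k assume "k \<in> {1..<Q}"
      then show "totient_sum k \<le> c * ln k + K" using K[of k] by (simp add: abs_le_iff c_def)
    qed auto
    also have "\<dots> \<le> (\<Sum>k=1..Q. (c * ln k + K) / real k)"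
      using c K0 by (intro sum_mono2) (auto intro!: divide_nonneg_nonneg add_nonneg_nonneg mult_nonneg_nonneg)
    also have "\<dots> = c * (\<Sum>k=1..Q. ln (real k) / real k) + K * (\<Sum>k=1..Q. 1 / real k)"
      by (simp add: add_divide_distrib sum.distrib sum_distrib_left)
    also have "\<dots> \<le> c * (x\<^sup>2 / 2 + 1 / 2) + K * (1 + x)"
    proof (intro add_mono mult_left_mono)
      have "(\<Sum>k=1..Q. ln (real k) / real k) \<le> x\<^sup>2 / 2 + (1 - 1 / Q) / 2"
        unfolding x_def by (rule sum_ln_over_id_le[OF Q])
      also have "\<dots> \<le> x\<^sup>2 / 2 + 1 / 2" by simp
      finally show "(\<Sum>k=1..Q. ln (real k) / real k) \<le> x\<^sup>2 / 2 + 1 / 2" .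
    qed (use harmonic_sum_bounds(2)[OF Q] c K0 in \<open>auto simp: x_def\<close>)
    finally have 1: "(\<Sum>q=1..Q. w q * (ln Q - ln q)) \<le> c * (x\<^sup>2 / 2 + 1 / 2) + K * (1 + x)" .
    have "(\<Sum>q=1..Q. w q * totient_sum (Q div q)) \<le> (\<Sum>q=1..Q. w q * (c * (ln Q - ln q) + K))"
    proof (intro sum_mono mult_left_mono w0)
      fix q assume q: "q \<in> {1..Q}"
      then have "Q div q \<ge> 1" by (simp add: div_greater_zero_iff Suc_le_eq)
      from K[OF this] have "totient_sum (Q div q) \<le> c * ln (real (Q div q)) + K" by (simp add: c_def abs_le_iff)
      also have "\<dots> \<le> c * (ln Q - ln q) + K" using ln_div_bounds(1)[of q Q] q c by (intro add_right_mono mult_left_mono) auto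
      finally show "totient_sum (Q div q) \<le> c * (ln Q - ln q) + K" .
    qed
    also have "\<dots> = c * (\<Sum>q=1..Q. w q * (ln Q - ln q)) + K * F"
      unfolding F_def \<Phi> sum_distrib_left sum.distrib[symmetric] by (intro sum.cong refl) (simp add: algebra_simps)
    also have "\<dots> \<le> c * (c * (x\<^sup>2 / 2 + 1 / 2) + K * (1 + x)) + K * F"
      using 1 c by (intro add_right_mono mult_left_mono) auto
    finally have "2 * (\<Sum>q=1..Q. w q * totient_sum (Q div q)) \<le> 2 * (c * (c * (x\<^sup>2 / 2 + 1 / 2) + K * (1 + x)) + K * F)" by simp
    also have "\<dots> = (c * x)\<^sup>2 + c * c + 2 * c * K + 2 * K * (c * x) + 2 * K * F"
      by (simp add: power2_eq_square algebra_simps)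
    also have "\<dots> \<le> (F + K)\<^sup>2 + 3 * 3 + 2 * 3 * K + 2 * K * (F + K) + 2 * K * F"
      using KF c x0 K0 by (intro add_mono power_mono mult_mono mult_left_mono) auto
    also have "\<dots> = F\<^sup>2 + (9 + 6 * K + 3 * K\<^sup>2) + 6 * K * F"
      by (simp add: power2_eq_square algebra_simps)
    also have "\<dots> \<le> F\<^sup>2 + (9 + 6 * K + 3 * K\<^sup>2) * F + 6 * K * F"
      using F2 K0 mult_left_mono[of 1 F "9 + 6 * K + 3 * K\<^sup>2"] by (simp add: add_nonneg_nonneg)
    also have "\<dots> \<le> F\<^sup>2 + (9 + 12 * K + 3 * K\<^sup>2 + 6 * K) * F"
      using F2 K0 by (simp add: algebra_simps)
    finally show "2 * (\<Sum>q=1..Q. 2 * real (totient q) / (real q)\<^sup>2 * totient_sum (Q div q))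
     \<le> (totient_sum Q)\<^sup>2 + (9 + 12 * K + 3 * K\<^sup>2 + 6 * K) * totient_sum Q" by (simp add: w_def F_def)
  qed (use K0 in auto)
qed

section \<open>Convergents and primitive lattice vectors\<close>

text \<open>\<open>(q, q a - p N)\<close> runs through the primitive vectors of the lattice of all \<open>(x, y)\<close> with
  \<open>y \<equiv> x a\<close> modulo \<open>N\<close>; \<open>m\<close> is the absolute value of the second coordinate.\<close>

definition primitive_pair :: "nat \<Rightarrow> nat \<Rightarrow> nat \<Rightarrow> nat \<Rightarrow> bool" where
  "primitive_pair N a q m \<longleftrightarrow> q > 0 \<and> m > 0 \<and>
     (\<exists>p::int. coprime p (int q) \<and> \<bar>int q * int a - p * int N\<bar> = int m)"

text \<open>Modulo N, q a \<equiv> s m with a sign s implies m b \<equiv> s q, and \<open>p'\<close>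
  is the quotient that arises. Primitivity is inherited because p and q are integer combinations of
  \<open>p'\<close> and m (facts \<open>2\<close> and \<open>3\<close>).\<close>

lemma primitive_pair_swap:
  assumes "int a * int b = 1 + j * int N" "primitive_pair N a q m"
  shows "primitive_pair N b m q"
proof -
  obtain p where p: "coprime p (int q)" "\<bar>int q * int a - p * int N\<bar> = int m" and pos: "q > 0" "m > 0"
    using assms(2) unfolding primitive_pair_def by blast
  define s where "s = sgn (int q * int a - p * int N)"
  have s: "s * s = 1" "int q * int a - p * int N = s * int m"
    using p pos by (auto simp: s_def sgn_if abs_if split: if_splits)
  have m: "int m = s * (int q * int a - p * int N)" unfolding s(2) using s(1) by (simp flip: mult.assoc)
  define p' where "p' = s * (int q * j - p * int b)"
  have ab: "int b * int a = 1 + j * int N" using assms(1) by (simp add: mult.commute)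
  have 1: "int m * int b - p' * int N = s * int q"
  proof -
    have "int m * int b - p' * int N = s * (int q * (int b * int a) - int q * j * int N)"
      unfolding m p'_def by (simp add: algebra_simps)
    then show ?thesis unfolding ab by (simp add: algebra_simps)
  qed
  have 2: "p = s * (j * int m - int a * p')"
  proof -
    have "s * (j * int m - int a * p') = (s * s) * (p * (int b * int a) - p * j * int N)"
      unfolding m p'_def by (simp add: algebra_simps)
    then show ?thesis unfolding ab s(1) by (simp add: algebra_simps)
  qed
  have 3: "int q = s * (int m * int b - p' * int N)" unfolding 1 using s(1) by (simp flip: mult.assoc)
  have "coprime p' (int m)"
  proof (rule coprimeI)
    fix d assume d: "d dvd p'" "d dvd int m"
    then have "d dvd p" by (subst 2) simp
    moreover have "d dvd int q" using d by (subst 3) simp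
    ultimately show "is_unit d" using p(1) coprime_common_divisor by blast
  qed
  moreover have "\<bar>int m * int b - p' * int N\<bar> = int q" unfolding 1 
    using s(1) by (auto simp: abs_mult zmult_eq_1_iff)
  ultimately show ?thesis using pos unfolding primitive_pair_def by blast
qed

text \<open>The arguments are two consecutive denominators of convergents and two consecutive Euclidean
  remainders; the output lists the pairs \<open>(q\<^sub>k, r\<^sub>k)\<close> with \<open>r\<^sub>k = \<bar>q\<^sub>k a - p\<^sub>k N\<bar>\<close>.\<close>

fun convergents :: "nat \<Rightarrow> nat \<Rightarrow> nat \<Rightarrow> nat \<Rightarrow> (nat \<times> nat) list" where
  "convergents q' q r' r =
     (if r = 0 then [] else (q, r) # convergents q (q' + (r' div r) * q) r (r' mod r))"

declare convergents.simps [simp del]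

text \<open>The equation for N is a determinant: two consecutive vectors, whose second coordinates
  r' and r carry opposite signs, span a lattice of index N, hence all of the lattice in question.
  Coprimality makes the last nonzero remainder 1.\<close>

definition euclid_state :: "nat \<Rightarrow> nat \<Rightarrow> nat \<Rightarrow> nat \<Rightarrow> nat \<Rightarrow> bool" where
  "euclid_state N q' q r' r \<longleftrightarrow> q' \<le> q \<and> q > 0 \<and> r < r' \<and> coprime r' r \<and> N = q * r' + q' * r"

lemma euclid_state_step:
  assumes "euclid_state N q' q r' r" "r > 0"
  shows "euclid_state N q (q' + (r' div r) * q) r (r' mod r)"
proof -
  have d: "r' div r \<ge> 1" using assms by (simp add: euclid_state_def div_greater_zero_iff Suc_le_eq)
  have "q * r' + q' * r = q * (r' div r * r + r' mod r) + q' * r" by simp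
  also have "\<dots> = (q' + (r' div r) * q) * r + q * (r' mod r)"
    by (simp only: algebra_simps)
  finally have "q * r' + q' * r = (q' + (r' div r) * q) * r + q * (r' mod r)" .
  moreover have "q \<le> q' + (r' div r) * q" using d by (metis le_add2 mult.commute mult_le_mono2 nat_mult_1_right order_trans)
  moreover have "coprime r (r' mod r)"
    using assms by (simp add: euclid_state_def coprime_commute[of r] coprime_iff_gcd_eq_1 gcd_red_nat[symmetric] gcd.commute)
  ultimately show ?thesis using assms unfolding euclid_state_def by auto
qed

lemma convergents_bounds:
  assumes "euclid_state N q' q r' r" "(x, y) \<in> set (convergents q' q r' r)"
  shows "0 < x \<and> 0 < y \<and> y \<le> r"
  using assms
proof (induction q' q r' r rule: convergents.induct)
  case (1 q' q r' r)
  show ?case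
  proof (cases "r = 0")
    case True then show ?thesis using 1 by (simp add: convergents.simps)
  next
    case False
    note st = euclid_state_step[OF 1(2)]
    have "r' mod r \<le> r" using False by (simp add: less_imp_le)
    moreover have "(x, y) = (q, r) \<or> (x, y) \<in> set (convergents q (q' + (r' div r) * q) r (r' mod r))"
      using 1(3) False by (subst (asm) convergents.simps) auto
    ultimately show ?thesis
    proof (elim disjE)
      assume "(x, y) = (q, r)"
      then show ?thesis using 1(2) False by (simp add: euclid_state_def)
    next
      assume "(x, y) \<in> set (convergents q (q' + (r' div r) * q) r (r' mod r))"
      then have "0 < x \<and> 0 < y \<and> y \<le> r' mod r" using 1(1)[OF False st] False by simp
      then show ?thesis using \<open>r' mod r \<le> r\<close> by simp
    qed
  qed
qed

lemma convergents_distinct: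
  assumes "euclid_state N q' q r' r"
  shows "distinct (convergents q' q r' r)"
  using assms
proof (induction q' q r' r rule: convergents.induct)
  case (1 q' q r' r)
  show ?case
  proof (cases "r = 0")
    case True then show ?thesis by (simp add: convergents.simps)
  next
    case False
    note st = euclid_state_step[OF 1(2)]
    have "(q, r) \<notin> set (convergents q (q' + (r' div r) * q) r (r' mod r))"
      using convergents_bounds[OF st] False by (metis mod_less_divisor not_le neq0_conv)
    then show ?thesis using 1 False st by (subst convergents.simps) auto
  qed
qed

text \<open>The product of two consecutive remainders at least halves in every step, because 2 (r'
  mod r) \<le> r'.\<close>

lemma convergents_length:
  assumes "euclid_state N q' q r' r" "r > 0"
  shows "2 ^ length (convergents q' q r' r) \<le> 2 * r * r'"
  using assms
proof (induction q' q r' r rule: convergents.induct)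
  case (1 q' q r' r)
  note st = euclid_state_step[OF 1(2,3)]
  have r: "r < r'" using 1(2) by (simp add: euclid_state_def)
  show ?case
  proof (cases "r' mod r = 0")
    case True
    have "1 * 1 \<le> r * r'" using 1(3) r by (intro mult_le_mono) auto
    then show ?thesis using 1(3) True by (simp add: convergents.simps)
  next
    case False
    have "r + r' mod r \<le> r'"
      by (metis add.commute add_le_cancel_left div_mult_mod_eq le_eq_less_or_eq mult.commute mult_le_mono2 nat_mult_1_right not_less_eq_eq One_nat_def div_greater_zero_iff r 1(3) Suc_leI)
    then have "2 * (r' mod r) \<le> r'" using 1(3) mod_less_divisor[of r r'] by linarith
    have "2 ^ length (convergents q (q' + (r' div r) * q) r (r' mod r)) \<le> 2 * (r' mod r) * r"
      using 1(1) 1(3) st False by simp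
    also have "\<dots> \<le> r' * r" using \<open>2 * (r' mod r) \<le> r'\<close> by (rule mult_le_mono1)
    finally show ?thesis using 1(3) by (subst convergents.simps) (simp add: mult.commute)
  qed
qed

lemma sum_partial_quotients_step:
  assumes "0 < r" "r < r'"
  shows "sum_partial_quotients (real r / real r') =
    r' div r + (if r' mod r = 0 then 0 else sum_partial_quotients (real (r' mod r) / real r))"
proof -
  have exp: "cf_expansion x = as" if "is_canonical_cf x as" for x as
    unfolding cf_expansion_def using that canonical_cf_unique by blast
  define d where "d = r' div r"
  have r': "r' = d * r + r' mod r" by (simp add: d_def)
  have d1: "d \<ge> 1" using assms by (simp add: d_def div_greater_zero_iff Suc_le_eq)
  have val: "real r / real r' = 1 / (real d + real (r' mod r) / real r)"
    using assms by (subst (1) r') (simp add: field_simps)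
  show ?thesis
  proof (cases "r' mod r = 0")
    case True
    have "d \<noteq> 1" using True r' assms by auto
    then have "is_canonical_cf (real r / real r') [d]" using d1 True val by (simp add: is_canonical_cf_def)
    then show ?thesis using True by (simp add: sum_partial_quotients_def exp d_def)
  next
    case False
    then obtain as where as: "is_canonical_cf (real (r' mod r) / real r) as"
      using canonical_cf_exists[of "r' mod r" r] assms by auto
    then have "is_canonical_cf (real r / real r') (d # as)"
      using d1 val by (auto simp: is_canonical_cf_def)
    then show ?thesis using False as by (simp add: sum_partial_quotients_def exp d_def)
  qed
qed

text \<open>Let d = r' div r be the next partial quotient. In N = q r' + q' r the first term lies
  between d q r and (d + 1) q r, and the second is at most q r, so N div (q r) is d or d +
  1.\<close>

lemma convergents_sum:
  assumes "euclid_state N q' q r' r" "r > 0"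
  shows "sum_partial_quotients (real r / real r') \<le> (\<Sum>(x, y)\<leftarrow>convergents q' q r' r. N div (x * y)) \<and>
    (\<Sum>(x, y)\<leftarrow>convergents q' q r' r. N div (x * y)) \<le>
      sum_partial_quotients (real r / real r') + length (convergents q' q r' r)"
  using assms
proof (induction q' q r' r rule: convergents.induct)
  case (1 q' q r' r)
  note st = euclid_state_step[OF 1(2,3)]
  define d where "d = r' div r"
  have s: "r < r'" "q' \<le> q" "q > 0" "N = q * r' + q' * r" using 1(2) by (simp_all add: euclid_state_def)
  have "d * r \<le> r'" by (simp add: d_def)
  then have "d * (q * r) \<le> q * r'" by (metis mult.left_commute mult_le_mono2)
  then have "d * (q * r) \<le> N" unfolding s(4) by (rule trans_le_add1)
  then have lo: "d \<le> N div (q * r)" using s(3) 1(3) by (subst less_eq_div_iff_mult_less_eq) simp_all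
  have "r' < (d + 1) * r" using 1(3) dividend_less_times_div[of r r'] by (simp add: d_def mult.commute)
  then have "q * r' < q * ((d + 1) * r)" using s by simp
  moreover have "q' * r \<le> q * r" using s by (intro mult_le_mono1)
  ultimately have "N < q * ((d + 1) * r) + q * r" unfolding s(4) by (rule add_less_le_mono)
  also have "\<dots> = (d + 2) * (q * r)" by (simp add: algebra_simps)
  finally have "N < (d + 2) * (q * r)" .
  then have "N div (q * r) < d + 2" by (rule less_mult_imp_div_less)
  then have hi: "N div (q * r) \<le> d + 1" by simp
  have conv: "convergents q' q r' r = (q, r) # convergents q (q' + d * q) r (r' mod r)"
    using 1(3) by (subst convergents.simps) (simp add: d_def)
  have spq: "sum_partial_quotients (real r / real r') =
    d + (if r' mod r = 0 then 0 else sum_partial_quotients (real (r' mod r) / real r))"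
    unfolding d_def by (rule sum_partial_quotients_step) (use s 1(3) in auto)
  show ?case
  proof (cases "r' mod r = 0")
    case True
    then have "convergents q (q' + d * q) r (r' mod r) = []" by (simp add: convergents.simps)
    then show ?thesis unfolding conv spq using lo hi True by simp
  next
    case False
    then show ?thesis unfolding conv spq using lo hi 1(1)[OF _ st] 1(3) by (simp add: d_def)
  qed
qed

text \<open>Legendre's theorem: a vector with nonnegative coordinates \<open>x, y\<close> in the basis of two
  consecutive convergents stays in the cone of the next basis, unless it is so far from the boundary
  of the cone that \<open>q m \<ge> N / 2\<close>.\<close>

lemma convergents_complete:
  assumes "euclid_state N q' q r' r" "coprime x y" "y > 0" "m > 0"
    and "int m = \<bar>int y * int r - int x * int r'\<bar>" "3 * ((x * q' + y * q) * m) \<le> N"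
  shows "(x * q' + y * q, m) \<in> set (convergents q' q r' r)"
  using assms
proof (induction q' q r' r arbitrary: x y rule: convergents.induct)
  case (1 q' q r' r)
  have s: "r < r'" "q' \<le> q" "q > 0" "coprime r' r" and N: "N = q * r' + q' * r" using 1(2) by (simp_all add: euclid_state_def)
  show ?case
  proof (cases "r = 0")
    case True
    then have "r' = 1" using s by simp
    then have "1 * q * 1 \<le> (x * q' + y * q) * m" 
      using 1 by (intro mult_le_mono) (auto intro: trans_le_add2)
    then show ?thesis using 1(7) N True \<open>r' = 1\<close> s by simp
  next
    case r: False
    note st = euclid_state_step[OF 1(2)]
    define d where "d = r' div r"
    have conv: "convergents q' q r' r = (q, r) # convergents q (q' + d * q) r (r' mod r)"
      using r by (subst convergents.simps) (simp add: d_def)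
    show ?thesis
    \<comment> \<open>x = 0 forces y = 1 by coprimality, so the vector is the current
      convergent.\<close>
    proof (cases "x = 0")
      case True
      then show ?thesis using 1(3,6) by (simp add: conv)
    next
      case x: False
      show ?thesis
      proof (cases "d * x \<le> y")
        case True
        \<comment> \<open>The vector lies in the cone of the next basis, where its coordinates are
          \<open>y'\<close> and x.\<close>
        define y' where "y' = y - d * x"
        have y: "y = y' + d * x" using True by (simp add: y'_def)
        have cop: "coprime y' x" using 1(3) unfolding y
          by (metis coprime_commute coprime_iff_gcd_eq_1 gcd_add_mult add.commute mult.commute)
        have rr: "int r' = int d * int r + int (r' mod r)"
          unfolding of_nat_mult[symmetric] of_nat_add[symmetric] d_def by simp
        have "int x * int (r' mod r) - int y' * int r = - (int y * int r - int x * int r')"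
          unfolding rr y by (simp add: algebra_simps)
        then have m: "int m = \<bar>int x * int (r' mod r) - int y' * int r\<bar>" using 1(6) by simp
        have e: "y' * q + x * (q' + d * q) = x * q' + y * q" unfolding y by (simp add: algebra_simps)
        have "(y' * q + x * (q' + d * q), m) \<in> set (convergents q (q' + d * q) r (r' mod r))"
          using 1(1)[OF r _ cop _ 1(5) m] x 1(7) st r unfolding e d_def[symmetric] by simp
        then show ?thesis unfolding conv e by simp
      next
        case False
        \<comment> \<open>Now m = x r' - y r \<ge> r. If y r is at most half of x r', then m \<ge>
          r' / 2 while the first coordinate is at least q' + q; otherwise 2 y r > r' and m \<ge> r
          are combined. Both give N \<le> 2 (x q' + y q) m, against the factor 3 in the
          hypothesis.\<close>
        have "y + 1 \<le> d * x" using False by simp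
        then have "(y + 1) * r \<le> (d * x) * r" by (rule mult_le_mono1)
        also have "\<dots> = x * (d * r)" by simp
        also have "\<dots> \<le> x * r'" by (intro mult_le_mono2) (simp add: d_def)
        finally have yr: "y * r + r \<le> x * r'" by simp
        then have "int (y * r + r) \<le> int (x * r')" unfolding of_nat_le_iff .
        then have "int m = int (x * r') - int (y * r)" using 1(6) by simp
        then have "int (m + y * r) = int (x * r')" by simp
        then have m: "m + y * r = x * r'" unfolding of_nat_eq_iff .
        have "N \<le> 2 * ((x * q' + y * q) * m)"
        proof (cases "2 * (y * r) \<le> x * r'")
          case True
          have "r' \<le> x * r'" using x by simp
          also have "x * r' \<le> 2 * m" using m True by linarith
          finally have "r' \<le> 2 * m" .
          have "N \<le> (q' + q) * r'" unfolding N using s by (simp add: algebra_simps)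
          also have "\<dots> \<le> (x * q' + y * q) * (2 * m)"
            using x 1(4) \<open>r' \<le> 2 * m\<close> by (intro mult_le_mono add_mono) auto
          finally show ?thesis by simp
        next
          case False
          have "N \<le> q * (2 * (y * r)) + 2 * (x * q') * r"
          proof -
            have "r' \<le> x * r'" using x by simp
            then have "q * r' \<le> q * (2 * (y * r))" using False by (intro mult_le_mono2) linarith
            moreover have "q' * r \<le> 2 * (x * q') * r" using x by (intro mult_le_mono1) simp
            ultimately show ?thesis unfolding N by linarith
          qed
          also have "\<dots> = 2 * ((x * q' + y * q) * r)" by (simp add: algebra_simps)
          also have "\<dots> \<le> 2 * ((x * q' + y * q) * m)" using yr m by (intro mult_le_mono2) linarith
          finally show ?thesis .
        qed
        moreover have "(x * q' + y * q) * m > 0" using 1(4,5) s by simp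
        ultimately show ?thesis using 1(7) by linarith
      qed
    qed
  qed
qed

text \<open>\<sigma> is the alternating sign of q a - p N. The determinant identity gives q' p - q
  p' = - \<sigma>, hence coprimality of p and q.\<close>

lemma convergents_primitive:
  fixes p p' \<sigma> :: int
  assumes "euclid_state N q' q r' r" "\<sigma> = 1 \<or> \<sigma> = -1" "N > 0"
    and "int q * int a - p * int N = \<sigma> * int r" "int q' * int a - p' * int N = - \<sigma> * int r'"
    and "(x, y) \<in> set (convergents q' q r' r)"
  shows "primitive_pair N a x y"
  using assms
proof (induction q' q r' r arbitrary: p p' \<sigma> rule: convergents.induct)
  case (1 q' q r' r)
  have s: "r < r'" "q' \<le> q" "q > 0" and N: "N = q * r' + q' * r" using 1(2) by (simp_all add: euclid_state_def)
  show ?case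
  proof (cases "r = 0")
    case True then show ?thesis using 1(7) by (simp add: convergents.simps)
  next
    case r: False
    define d where "d = r' div r"
    have conv: "convergents q' q r' r = (q, r) # convergents q (q' + d * q) r (r' mod r)"
      using r by (subst convergents.simps) (simp add: d_def)
    show ?thesis
    proof (cases "(x, y) = (q, r)")
      case True
      have "int N * (int q' * p - int q * p') = int q * (int q' * int a - p' * int N) - int q' * (int q * int a - p * int N)"
        by (simp add: algebra_simps)
      also have "\<dots> = int (q * r' + q' * r) * (- \<sigma>)" unfolding 1(5,6) by (simp add: algebra_simps)
      also have "q * r' + q' * r = N" using N by simp
      finally have det: "int q' * p - int q * p' = - \<sigma>" using 1(4) by (subst (asm) mult_cancel_left) simp
      have "coprime p (int q)"
      proof (rule coprimeI)
        fix g assume "g dvd p" "g dvd int q"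
        then have "g dvd int q' * p - int q * p'" by simp
        then show "is_unit g" unfolding det using 1(3) by auto
      qed
      moreover have "\<bar>int q * int a - p * int N\<bar> = int r" unfolding 1(5) using 1(3) by auto
      ultimately show ?thesis using True s r unfolding primitive_pair_def by auto
    next
      case False
      then have mem: "(x, y) \<in> set (convergents q (q' + r' div r * q) r (r' mod r))" using 1(7) unfolding conv d_def by auto
      have rr: "int (r' mod r) = int r' - int d * int r"
        unfolding d_def by (simp add: zmod_int minus_div_mult_eq_mod[symmetric] zdiv_int)
      show ?thesis
      proof (rule 1(1)[OF r _ _ 1(4) _ _ mem])
        show "euclid_state N q (q' + r' div r * q) r (r' mod r)" using euclid_state_step 1(2) r by simp
        show "- \<sigma> = 1 \<or> - \<sigma> = -1" using 1(3) by auto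
        show "int q * int a - p * int N = - (- \<sigma>) * int r" using 1(5) by simp
        have "int (q' + r' div r * q) * int a - (p' + int d * p) * int N =
           (int q' * int a - p' * int N) + int d * (int q * int a - p * int N)"
          unfolding d_def[symmetric] by (simp add: algebra_simps)
        also have "\<dots> = - \<sigma> * int (r' mod r)" unfolding 1(5,6) rr by (simp add: algebra_simps)
        finally show "int (q' + r' div r * q) * int a - (p' + int d * p) * int N = - \<sigma> * int (r' mod r)" .
      qed
    qed
  qed
qed

section \<open>Counting triples instead of summing partial quotients\<close>

text \<open>A pair (q, m) occurs with N div (q m) - 2 values of \<tau>, so counting triples sums the
  partial quotients up to a bounded error per convergent. Levels start at 3, from where on primitive
  pairs are convergents.\<close>

definition quality_triples :: "nat \<Rightarrow> nat \<Rightarrow> ((nat \<times> nat) \<times> nat) set" where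
  "quality_triples N a = {((q, m), \<tau>). 3 \<le> \<tau> \<and> \<tau> * (q * m) \<le> N \<and> primitive_pair N a q m}"

lemma initial_euclid_state: "a < N \<Longrightarrow> coprime a N \<Longrightarrow> euclid_state N 0 1 N a"
  by (simp add: euclid_state_def coprime_commute)

lemma primitive_pair_convergent:
  assumes a: "0 < a" "a < N" "coprime a N" and "primitive_pair N a q m" "3 * (q * m) \<le> N"
  shows "(q, m) \<in> set (convergents 0 1 N a)"
proof -
  obtain p where p: "coprime p (int q)" "\<bar>int q * int a - p * int N\<bar> = int m" and pos: "q > 0" "m > 0"
    using assms(4) unfolding primitive_pair_def by blast
  have "1 * m \<le> q * m" using pos by (intro mult_le_mono1) auto
  then have mN: "m < N" using assms(5) pos by linarith
  have "p \<ge> 0"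
  proof (rule ccontr)
    assume "\<not> p \<ge> 0"
    then have "p * int N \<le> (-1) * int N" by (intro mult_right_mono) auto
    then have "int q * int a - p * int N \<ge> int N" using mult_nonneg_nonneg[of "int q" "int a"] by linarith
    then show False using p(2) mN by linarith
  qed
  then obtain x where x: "p = int x" using nonneg_int_cases by blast
  \<comment> \<open>In the initial basis, with denominators 0, 1 and remainders N, a, the
    coordinates of the vector are p and q.\<close>
  have "(x * 0 + q * 1, m) \<in> set (convergents 0 1 N a)"
    using p x pos assms(5) by (intro convergents_complete[OF initial_euclid_state[OF a(2,3)]]) auto
  then show ?thesis by simp
qed

lemma quality_triples_eq:
  assumes a: "0 < a" "a < N" "coprime a N"
  shows "quality_triples N a = (SIGMA v:set (convergents 0 1 N a). {3..N div (fst v * snd v)})"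
proof (intro equalityI subsetI)
  fix z assume "z \<in> quality_triples N a"
  then obtain q m \<tau> where z: "z = ((q, m), \<tau>)" and t: "3 \<le> \<tau>" "\<tau> * (q * m) \<le> N" "primitive_pair N a q m"
    by (auto simp: quality_triples_def)
  have "3 * (q * m) \<le> \<tau> * (q * m)" using t by (intro mult_le_mono1)
  then have "3 * (q * m) \<le> N" using t by linarith
  then have "(q, m) \<in> set (convergents 0 1 N a)" using primitive_pair_convergent[OF a] t by blast
  moreover have "q * m > 0" using t by (simp add: primitive_pair_def)
  ultimately show "z \<in> (SIGMA v:set (convergents 0 1 N a). {3..N div (fst v * snd v)})"
    using t z by (auto simp: less_eq_div_iff_mult_less_eq)
next
  fix z assume "z \<in> (SIGMA v:set (convergents 0 1 N a). {3..N div (fst v * snd v)})"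
  then obtain q m \<tau> where z: "z = ((q, m), \<tau>)" and t: "(q, m) \<in> set (convergents 0 1 N a)" "3 \<le> \<tau>" "\<tau> \<le> N div (q * m)"
    by auto
  have pp: "primitive_pair N a q m"
    using convergents_primitive[OF initial_euclid_state[OF a(2,3)], where a=a and p=0 and p'=1 and \<sigma>=1] t(1) a by auto
  then have "q * m > 0" by (simp add: primitive_pair_def)
  then show "z \<in> quality_triples N a" using t z pp by (auto simp: quality_triples_def less_eq_div_iff_mult_less_eq)
qed

text \<open>N div (q m) exceeds the partial quotient by at most 1, and leaving out the levels 1 and
  2 removes at most 2. So the error is at most 2 for each of at most 1 + 4 ln N convergents.\<close>

lemma sum_partial_quotients_quality_triples:
  assumes a: "0 < a" "a < N" "coprime a N"
  shows "\<bar>real (sum_partial_quotients (real a / real N)) - real (card (quality_triples N a))\<bar> \<le> 2 + 8 * ln N"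
    and "finite (quality_triples N a)"
proof -
  let ?L = "convergents 0 1 N a"
  note st = initial_euclid_state[OF a(2,3)]
  define s where "s = (\<Sum>(x, y)\<leftarrow>?L. N div (x * y))"
  have s: "s = (\<Sum>v\<in>set ?L. N div (fst v * snd v))"
    unfolding s_def using convergents_distinct[OF st] by (simp add: sum_list_distinct_conv_sum_set case_prod_beta)
  have card: "card (quality_triples N a) = (\<Sum>v\<in>set ?L. N div (fst v * snd v) - 2)"
    unfolding quality_triples_eq[OF a] by (simp add: eval_nat_numeral)
  have le: "card (quality_triples N a) \<le> s" unfolding s card by (intro sum_mono) simp
  have "s \<le> (\<Sum>v\<in>set ?L. (N div (fst v * snd v) - 2) + 2)" unfolding s by (intro sum_mono) simp
  also have "\<dots> = card (quality_triples N a) + 2 * card (set ?L)" unfolding card sum.distrib by simp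
  also have "card (set ?L) = length ?L" using convergents_distinct[OF st] by (rule distinct_card)
  finally have le2: "s \<le> card (quality_triples N a) + 2 * length ?L" .
  have S: "sum_partial_quotients (real a / real N) \<le> s \<and> s \<le> sum_partial_quotients (real a / real N) + length ?L"
    using convergents_sum[OF st a(1)] unfolding s_def .
  have "2 ^ length ?L \<le> 2 * a * N" by (rule convergents_length[OF st a(1)])
  also have "\<dots> \<le> 2 * N * N" using a by simp
  finally have "real (2 ^ length ?L) \<le> real (2 * N * N)" by (rule of_nat_mono)
  then have "ln (2 ^ length ?L) \<le> ln (2 * real N * real N)" using a by (subst ln_le_cancel_iff) auto
  then have "length ?L * ln 2 \<le> ln 2 + 2 * ln N" using a by (simp add: ln_mult ln_realpow)
  then have "(real (length ?L) - 1) * ln 2 \<le> 2 * ln N" by (simp add: algebra_simps)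
  moreover have "(real (length ?L) - 1) * (1/2) \<le> (real (length ?L) - 1) * ln 2"
  proof (rule mult_left_mono)
    show "1/2 \<le> ln (2::real)" using ln2_ge_two_thirds by simp
    have "?L \<noteq> []" using a by (subst convergents.simps) simp
    then show "0 \<le> real (length ?L) - 1" by (cases ?L) auto
  qed
  ultimately have "(real (length ?L) - 1) * (1/2) \<le> 2 * ln N" by (rule order_trans[rotated])
  then have len: "real (length ?L) \<le> 1 + 4 * ln N" by simp
  show "\<bar>real (sum_partial_quotients (real a / real N)) - real (card (quality_triples N a))\<bar> \<le> 2 + 8 * ln N"
    using S le le2 len by linarith
  show "finite (quality_triples N a)" unfolding quality_triples_eq[OF a] by simp
qed

section \<open>The second moment\<close>

text \<open>4 / p exceeds 1 only for the primes 2 and 3, whose product of factors is 8/3. An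
  exponent below 1 on n is needed to make the error series in \<open>compatible_sum_le\<close>
  converge.\<close>

lemma two_power_prime_factors_le_sqrt:
  fixes n :: nat
  assumes "n > 0"
  shows "2 ^ card (prime_factors n) \<le> 2 * sqrt n"
proof -
  let ?P = "prime_factors n"
  have "(\<Prod>p\<in>?P. 4 / real p) = (\<Prod>p\<in>?P \<inter> {2,3}. 4 / real p) * (\<Prod>p\<in>?P - {2,3}. 4 / real p)"
    by (subst prod.union_disjoint[symmetric]) (auto simp: Un_Diff_Int intro!: prod.cong)
  also have "\<dots> \<le> 4 * 1"
  proof (intro mult_mono prod_le_1)
    have "?P \<inter> {2,3} = {} \<or> ?P \<inter> {2,3} = {2} \<or> ?P \<inter> {2,3} = {3} \<or> ?P \<inter> {2,3} = {2,3}" by blast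
    then show "(\<Prod>p\<in>?P \<inter> {2,3}. 4 / real p) \<le> 4" by (elim disjE) simp_all
    fix p assume p: "p \<in> ?P - {2,3}"
    then have "p \<ge> 2" using prime_ge_2_nat by auto
    then have "p \<ge> 4" using p by (cases "p = 2 \<or> p = 3") auto
    then show "0 \<le> 4 / real p \<and> 4 / real p \<le> 1" by simp
  qed (auto intro!: prod_nonneg)
  finally have le: "(\<Prod>p\<in>?P. 4 / real p) \<le> 4" by simp
  have "0 < (\<Prod>p\<in>?P. real p)"
    by (intro prod_pos) (auto intro: prime_gt_0_nat)
  with le have "4 ^ card ?P \<le> 4 * real (\<Prod>?P)"
    by (simp add: prod_dividef divide_le_eq)
  also have "int (\<Prod>?P) dvd int n" by (subst prod_primes_dvd_iff) auto
  then have "\<Prod>?P \<le> n" unfolding int_dvd_int_iff by (rule dvd_imp_le[OF _ assms])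
  finally have "4 ^ card ?P \<le> 4 * real n" by simp
  moreover have "(2 ^ card ?P)\<^sup>2 = (4::real) ^ card ?P" by (simp add: power2_eq_square power_mult_distrib[symmetric])
  ultimately have "2 ^ card ?P \<le> sqrt (4 * real n)" by (intro real_le_rsqrt) simp
  then show ?thesis by (simp add: real_sqrt_mult)
qed

text \<open>Here the sieve is run without truncation: \<open>r\<close> exceeds the number of primes,
  so no subset has size \<open>r\<close>, and all \<open>2 ^ card ?P\<close> subsets contribute to
  the error. The antiderivative of 1 / y^2 is - 1 / y.\<close>

lemma coprime_inverse_square_sum_le:
  fixes Y Z \<delta> :: real
  assumes n: "n > 0" and Y: "Y > 0"
  shows "(\<Sum>\<alpha>\<in>{\<alpha>::int. Y \<le> \<alpha> + \<delta> \<and> \<alpha> + \<delta> \<le> Z \<and> coprime \<alpha> (int n)}. 1 / (\<alpha> + \<delta>)\<^sup>2)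
    \<le> real (totient n) / real n / Y + 4 * sqrt n / Y\<^sup>2"
proof (cases "Y \<le> Z")
  case False
  then have "{\<alpha>::int. Y \<le> \<alpha> + \<delta> \<and> \<alpha> + \<delta> \<le> Z \<and> coprime \<alpha> (int n)} = {}" by auto
  then have "(\<Sum>\<alpha>\<in>{\<alpha>::int. Y \<le> \<alpha> + \<delta> \<and> \<alpha> + \<delta> \<le> Z \<and> coprime \<alpha> (int n)}. 1 / (\<alpha> + \<delta>)\<^sup>2) = 0"
    by (simp only: sum.empty)
  also have "\<dots> \<le> real (totient n) / real n / Y + 4 * sqrt n / Y\<^sup>2" using Y by simp
  finally show ?thesis .
next
  case True
  let ?P = "prime_factors n"
  let ?r = "card ?P + 1"
  have e: "{X. X \<subseteq> ?P \<and> card X = ?r} = {}"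
    using card_mono[of ?P] by (auto dest: card_mono[of ?P, rotated])
  have "{X. X \<subseteq> ?P \<and> card X \<le> ?r} = Pow ?P" using card_mono[of ?P] by (auto intro: le_SucI)
  then have c: "card {X. X \<subseteq> ?P \<and> card X \<le> ?r} = 2 ^ card ?P" by (simp add: card_Pow)
  have lo: "1 / y'\<^sup>2 * (y' - y) \<le> - 1 / y' - - 1 / y" and hi: "- 1 / y' - - 1 / y \<le> 1 / y\<^sup>2 * (y' - y)"
    if "Y \<le> y" "y \<le> y'" for y y' :: real
  proof -
    have pos: "y > 0" "y' > 0" using that Y by auto
    have d: "- 1 / y' - - 1 / y = (y' - y) / (y * y')" using pos by (simp add: field_simps)
    have "y * y' \<le> y'\<^sup>2" "y\<^sup>2 \<le> y * y'" using that pos by (simp_all add: power2_eq_square mult_mono)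
    then have "(y' - y) / y'\<^sup>2 \<le> (y' - y) / (y * y')" "(y' - y) / (y * y') \<le> (y' - y) / y\<^sup>2"
      using that pos by (auto intro!: divide_left_mono)
    then show "1 / y'\<^sup>2 * (y' - y) \<le> - 1 / y' - - 1 / y" "- 1 / y' - - 1 / y \<le> 1 / y\<^sup>2 * (y' - y)"
      unfolding d by simp_all
  qed
  have "\<bar>(\<Sum>\<alpha>\<in>{\<alpha>::int. Y \<le> \<alpha> + \<delta> \<and> \<alpha> + \<delta> \<le> Z \<and> coprime \<alpha> (int n)}. 1 / (\<alpha> + \<delta>)\<^sup>2) - (- 1 / Z - - 1 / Y) * (real (totient n) / real n)\<bar>
    \<le> 2 * (- 1 / Z - - 1 / Y) * (\<Sum>X | X \<subseteq> ?P \<and> card X = ?r. 1 / real (\<Prod>X)) + 2 * (1 / Y\<^sup>2) * card {X. X \<subseteq> ?P \<and> card X \<le> ?r}"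
    by (rule coprime_sum_antitone[where f="\<lambda>y. 1 / y\<^sup>2" and F="\<lambda>y. - 1 / y"]) (use n True lo hi in auto)
  then have "(\<Sum>\<alpha>\<in>{\<alpha>::int. Y \<le> \<alpha> + \<delta> \<and> \<alpha> + \<delta> \<le> Z \<and> coprime \<alpha> (int n)}. 1 / (\<alpha> + \<delta>)\<^sup>2)
    \<le> (1 / Y - 1 / Z) * (real (totient n) / real n) + 2 * (1 / Y\<^sup>2) * 2 ^ card ?P"
    unfolding e c by (simp add: abs_le_iff)
  also have "\<dots> \<le> (1 / Y) * (real (totient n) / real n) + 2 * (1 / Y\<^sup>2) * (2 * sqrt n)"
    using Y True n two_power_prime_factors_le_sqrt[OF n] by (intro add_mono mult_right_mono mult_left_mono) auto
  finally show ?thesis by (simp add: mult.commute)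
qed

text \<open>For denominator 1 both 0/1 and 1/1 are present, since a/N may be close to either end of
  the unit interval.\<close>

definition fractions :: "nat \<Rightarrow> (nat \<times> nat) set" where
  "fractions Q = {(q, p). 1 \<le> q \<and> q \<le> Q \<and> p \<le> q \<and> coprime p q}"

lemma finite_fractions [simp]: "finite (fractions Q)"
  by (rule finite_subset[of _ "{..Q} \<times> {..Q}"]) (auto simp: fractions_def)

text \<open>Necessary for \<open>a/N\<close> to be close to \<open>p/q\<close> at level \<open>\<tau>\<close> and to \<open>p2/q2\<close> at any level,
  when \<open>q < q2\<close>.\<close>

definition compatible :: "nat \<Rightarrow> nat \<Rightarrow> nat \<Rightarrow> nat \<Rightarrow> nat \<Rightarrow> bool" where
  "compatible q p \<tau> q2 p2 \<longleftrightarrow> int p * int q2 \<noteq> int p2 * int q \<and>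
     (real_of_int \<bar>int p * int q2 - int p2 * int q\<bar> * real \<tau> - 1/2) * real q \<le> real q2"

lemma sum_nonzero_abs:
  fixes h :: "nat \<Rightarrow> real"
  shows "(\<Sum>\<beta>\<in>{\<beta>::int. \<beta> \<noteq> 0 \<and> \<bar>\<beta>\<bar> \<le> int m}. h (nat \<bar>\<beta>\<bar>)) = 2 * (\<Sum>n=1..m. h n)"
proof -
  have e: "{\<beta>::int. \<beta> \<noteq> 0 \<and> \<bar>\<beta>\<bar> \<le> int m} = int ` {1..m} \<union> (\<lambda>n. - int n) ` {1..m}"
  proof (intro equalityI subsetI)
    fix \<beta> :: int assume b: "\<beta> \<in> {\<beta>. \<beta> \<noteq> 0 \<and> \<bar>\<beta>\<bar> \<le> int m}"
    then have "nat \<bar>\<beta>\<bar> \<in> {1..m}" "\<beta> = int (nat \<bar>\<beta>\<bar>) \<or> \<beta> = - int (nat \<bar>\<beta>\<bar>)" by auto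
    then show "\<beta> \<in> int ` {1..m} \<union> (\<lambda>n. - int n) ` {1..m}" by blast
  qed auto
  have "(\<Sum>\<beta>\<in>int ` {1..m} \<union> (\<lambda>n. - int n) ` {1..m}. h (nat \<bar>\<beta>\<bar>)) =
    (\<Sum>\<beta>\<in>int ` {1..m}. h (nat \<bar>\<beta>\<bar>)) + (\<Sum>\<beta>\<in>(\<lambda>n. - int n) ` {1..m}. h (nat \<bar>\<beta>\<bar>))"
    by (rule sum.union_disjoint) auto
  also have "\<dots> = (\<Sum>n=1..m. h n) + (\<Sum>n=1..m. h n)"
    by (subst (1 2) sum.reindex) (auto simp: inj_on_def)
  finally show ?thesis unfolding e by simp
qed

text \<open>Choose p', q' with p q' - p' q = 1 and write (q2, p2) = \<alpha> (q, p) + \<beta> (q',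
  p'). Then \<beta> is the determinant p q2 - p2 q, \<alpha> and \<beta> are coprime, and q2 / q =
  \<alpha> + \<beta> \<theta> with \<theta> = q' / q. Compatibility confines \<alpha> + \<beta>
  \<theta> to values from |\<beta>| \<tau> - 1/2 on. The sum over \<alpha> is then about totient
  |\<beta>| / (|\<beta>|^2 \<tau>), and the two signs of \<beta> rebuild \<open>totient_sum\<close>
  at Q div q.\<close>

lemma compatible_sum_le:
  "\<exists>K\<ge>0. \<forall>Q q p \<tau>. 1 \<le> q \<longrightarrow> q \<le> Q \<longrightarrow> coprime p q \<longrightarrow> 3 \<le> \<tau> \<longrightarrow>
     (\<Sum>(q2, p2)\<in>{(q2, p2)\<in>fractions Q. compatible q p \<tau> q2 p2}. 1 / (real q2)\<^sup>2)
     \<le> (totient_sum (Q div q) + K) / ((real q)\<^sup>2 * real \<tau>)"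
proof -
  define K0 where "K0 = (\<Sum>k. real k powr (-3/2))"
  have s: "summable (\<lambda>k. real k powr (-3/2))" by (simp add: summable_real_powr_iff)
  have K0: "(\<Sum>n=1..m. sqrt n / (real n)\<^sup>2) \<le> K0" for m
  proof -
    have "(\<Sum>n=1..m. sqrt n / (real n)\<^sup>2) = (\<Sum>n=1..m. real n powr (-3/2))"
    proof (rule sum.cong[OF refl])
      fix n assume "n \<in> {1..m}"
      then have n: "real n > 0" by simp
      have "real n powr (-2) = 1 / (real n)\<^sup>2" using n by (simp add: powr_minus_divide)
      then have "sqrt n / (real n)\<^sup>2 = real n powr (1/2) * real n powr (-2)" using n by (simp add: powr_half_sqrt)
      also have "\<dots> = real n powr (-3/2)" by (simp add: powr_add[symmetric])
      finally show "sqrt n / (real n)\<^sup>2 = real n powr (-3/2)" .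
    qed
    also have "\<dots> \<le> K0" unfolding K0_def by (rule sum_le_suminf[OF s]) auto
    finally show ?thesis .
  qed
  have K00: "K0 \<ge> 0" using K0[of 0] by simp
  show ?thesis
  \<comment> \<open>34 = 2 * 17 for the two signs of \<beta>. In 17 = 16 + 1, the 16 is the sieve
    error 4 sqrt n after replacing w - 1/2 by w / 2, and the 1 is the error of 1 / (w - 1/2) against
    1 / w.\<close>
  proof (intro exI[of _ "34 * K0"] conjI allI impI)
    fix Q q p \<tau> :: nat assume q: "1 \<le> q" "q \<le> Q" and cop: "coprime p q" and \<tau>: "3 \<le> \<tau>"
    obtain u v :: int where uv: "u * int p + v * int q = gcd (int p) (int q)" using bezout_int by blast
    define q' p' where "q' = u" and "p' = - v"
    have det: "int p * q' - p' * int q = 1" using uv cop by (simp add: q'_def p'_def mult.commute coprime_iff_gcd_eq_1[symmetric])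
    define \<theta> where "\<theta> = real_of_int q' / real q"
    define Z where "Z = real Q / real q"
    define m where "m = Q div q"
    define A where "A = {(q2, p2)\<in>fractions Q. compatible q p \<tau> q2 p2}"
    define S where "S \<beta> = {\<alpha>::int. real_of_int \<bar>\<beta>\<bar> * real \<tau> - 1/2 \<le> \<alpha> + \<beta> * \<theta> \<and> \<alpha> + \<beta> * \<theta> \<le> Z \<and> coprime \<alpha> (int (nat \<bar>\<beta>\<bar>))}" for \<beta> :: int
    define B where "B = {\<beta>::int. \<beta> \<noteq> 0 \<and> \<bar>\<beta>\<bar> \<le> int m}"
    define f where "f = (\<lambda>(q2, p2). (int p * int q2 - int p2 * int q, q' * int p2 - p' * int q2))"
    have finA: "finite A" by (rule finite_subset[OF _ finite_fractions[of Q]]) (auto simp: A_def)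
    have finB: "finite B" unfolding B_def by (rule finite_subset[of _ "{- int m..int m}"]) auto
    have finS: "finite (S \<beta>)" for \<beta> unfolding S_def
      by (rule finite_subset[OF _ finite_ints_between[of "real_of_int \<bar>\<beta>\<bar> * real \<tau> - 1/2" "\<beta> * \<theta>" Z]]) auto
    have q2: "int q2 = (q' * int p2 - p' * int q2) * int q + (int p * int q2 - int p2 * int q) * q'" for q2 p2
    proof -
      have "(q' * int p2 - p' * int q2) * int q + (int p * int q2 - int p2 * int q) * q' = int q2 * (int p * q' - p' * int q)"
        by (simp add: algebra_simps)
      then show ?thesis using det by simp
    qed
    have p2: "int p2 = (q' * int p2 - p' * int q2) * int p + (int p * int q2 - int p2 * int q) * p'" for q2 p2
    proof -
      have "(q' * int p2 - p' * int q2) * int p + (int p * int q2 - int p2 * int q) * p' = int p2 * (int p * q' - p' * int q)"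
        by (simp add: algebra_simps)
      then show ?thesis using det by simp
    qed
    have inj: "inj_on f A"
    proof (rule inj_onI)
      fix x y assume xy: "f x = f y"
      obtain x1 x2 y1 y2 where e: "x = (x1, x2)" "y = (y1, y2)" by (cases x, cases y) auto
      have h: "int p * int x1 - int x2 * int q = int p * int y1 - int y2 * int q" "q' * int x2 - p' * int x1 = q' * int y2 - p' * int y1"
        using xy by (auto simp: f_def e)
      have "int x1 = int y1" using q2[of x1 x2] q2[of y1 y2] h by simp
      moreover have "int x2 = int y2" using p2[of x2 x1] p2[of y2 y1] h by simp
      ultimately show "x = y" by (simp add: e)
    qed
    have img: "f ` A \<subseteq> (SIGMA \<beta>:B. S \<beta>)"
    proof (rule image_subsetI)
      fix x assume x: "x \<in> A"
      obtain x1 x2 where e: "x = (x1, x2)" by (cases x) auto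
      have fr: "1 \<le> x1" "x1 \<le> Q" "coprime x2 x1" and co: "compatible q p \<tau> x1 x2"
        using x by (auto simp: A_def e fractions_def)
      define \<beta> \<alpha> where "\<beta> = int p * int x1 - int x2 * int q" and "\<alpha> = q' * int x2 - p' * int x1"
      have x1: "int x1 = \<alpha> * int q + \<beta> * q'" using q2[of x1 x2] by (simp add: \<beta>_def \<alpha>_def)
      have x2: "int x2 = \<alpha> * int p + \<beta> * p'" using p2[of x2 x1] by (simp add: \<beta>_def \<alpha>_def)
      have \<beta>0: "\<beta> \<noteq> 0" and cb: "(real_of_int \<bar>\<beta>\<bar> * real \<tau> - 1/2) * real q \<le> real x1"
        using co by (auto simp: compatible_def \<beta>_def)
      have "real x1 = real_of_int (int x1)" by simp
      then have ab: "\<alpha> + \<beta> * \<theta> = real x1 / real q" unfolding x1 using q by (simp add: \<theta>_def field_simps)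
      have low: "real_of_int \<bar>\<beta>\<bar> * real \<tau> - 1/2 \<le> \<alpha> + \<beta> * \<theta>" unfolding ab using cb q by (simp add: le_divide_eq)
      have up: "\<alpha> + \<beta> * \<theta> \<le> Z" unfolding ab Z_def using fr by (simp add: divide_right_mono)
      have "coprime \<alpha> \<beta>"
      proof (rule coprimeI)
        fix d assume "d dvd \<alpha>" "d dvd \<beta>"
        then have "d dvd int x1" "d dvd int x2" unfolding x1 x2 by simp_all
        moreover have "coprime (int x2) (int x1)" using fr by simp
        ultimately show "is_unit d" using coprime_common_divisor by blast
      qed
      then have c: "coprime \<alpha> (int (nat \<bar>\<beta>\<bar>))" by simp
      \<comment> \<open>3 |\<beta>| - 1/2 \<le> Z and |\<beta>| \<ge> 1 imply |\<beta>| \<le> Z = Q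
        / q.\<close>
      have "\<bar>\<beta>\<bar> \<le> int m"
      proof -
        have b1: "real_of_int \<bar>\<beta>\<bar> \<ge> 1" using \<beta>0 by linarith
        have "real_of_int \<bar>\<beta>\<bar> * 3 \<le> real_of_int \<bar>\<beta>\<bar> * real \<tau>" using \<tau> by (intro mult_left_mono) auto
        then have "real_of_int \<bar>\<beta>\<bar> \<le> Z" using low up b1 by linarith
        then have "real_of_int \<bar>\<beta>\<bar> * real q \<le> real Q" using q by (simp add: Z_def le_divide_eq)
        then have "\<bar>\<beta>\<bar> * int q \<le> int Q" by (metis of_int_le_iff of_int_mult of_int_of_nat_eq)
        then have "nat \<bar>\<beta>\<bar> * q \<le> Q" by (metis abs_ge_zero int_nat_eq of_nat_le_iff of_nat_mult)
        then have "nat \<bar>\<beta>\<bar> \<le> m" using q by (simp add: m_def less_eq_div_iff_mult_less_eq)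
        then show ?thesis by simp
      qed
      then show "f x \<in> (SIGMA \<beta>:B. S \<beta>)"
        using \<beta>0 low up c by (simp add: f_def e B_def S_def flip: \<beta>_def \<alpha>_def)
    qed
    have per: "(\<Sum>\<alpha>\<in>S \<beta>. 1 / (\<alpha> + \<beta> * \<theta>)\<^sup>2) \<le> (1 / \<tau>) * (real (totient (nat \<bar>\<beta>\<bar>)) / (real (nat \<bar>\<beta>\<bar>))\<^sup>2 + 17 * (sqrt (nat \<bar>\<beta>\<bar>) / (real (nat \<bar>\<beta>\<bar>))\<^sup>2))"
      if "\<beta> \<in> B" for \<beta>
    proof -
      define n where "n = nat \<bar>\<beta>\<bar>"
      have n: "n > 0" "real_of_int \<bar>\<beta>\<bar> = real n" using that by (auto simp: n_def B_def)
      define w where "w = real n * real \<tau>"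
      have "1 * 3 \<le> w" unfolding w_def using n \<tau> by (intro mult_mono) auto
      then have w3: "w \<ge> 3" by simp
      have Y: "w - 1/2 > 0" using w3 by simp
      have "(\<Sum>\<alpha>\<in>S \<beta>. 1 / (\<alpha> + \<beta> * \<theta>)\<^sup>2) \<le> real (totient n) / real n / (w - 1/2) + 4 * sqrt n / (w - 1/2)\<^sup>2"
        unfolding S_def n(2) w_def[symmetric] n_def[symmetric] by (rule coprime_inverse_square_sum_le[OF n(1) Y])
      also have "\<dots> \<le> (real (totient n) / real n) * (1 / w + 1 / w\<^sup>2) + 4 * sqrt n * (4 / w\<^sup>2)"
      proof -
        have "1 / (w - 1/2) \<le> 1 / w + 1 / w\<^sup>2"
          using w3 Y by (simp add: field_simps power2_eq_square)
        moreover have "1 / (w - 1/2)\<^sup>2 \<le> 4 / w\<^sup>2"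
        proof -
          have "(w / 2)\<^sup>2 \<le> (w - 1/2)\<^sup>2" using w3 by (intro power_mono) auto
          then have "1 / (w - 1/2)\<^sup>2 \<le> 1 / (w / 2)\<^sup>2" using w3 Y by (intro divide_left_mono) auto
          then show ?thesis by (simp add: power_divide)
        qed
        ultimately have "(real (totient n) / real n) * (1 / (w - 1/2)) + 4 * sqrt n * (1 / (w - 1/2)\<^sup>2) \<le>
          (real (totient n) / real n) * (1 / w + 1 / w\<^sup>2) + 4 * sqrt n * (4 / w\<^sup>2)"
          by (intro add_mono mult_left_mono) auto
        then show ?thesis by simp
      qed
      also have "\<dots> \<le> real (totient n) / real n * (1 / w) + sqrt n * (1 / w\<^sup>2) + 16 * sqrt n * (1 / w\<^sup>2)"
      proof -
        have "real (totient n) / real n \<le> 1" using n totient_le[of n] by simp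
        also have "1 \<le> sqrt n" using n by simp
        finally have "real (totient n) / real n * (1 / w\<^sup>2) \<le> sqrt n * (1 / w\<^sup>2)" by (intro mult_right_mono) auto
        moreover have "(real (totient n) / real n) * (1 / w + 1 / w\<^sup>2) = real (totient n) / real n * (1 / w) + real (totient n) / real n * (1 / w\<^sup>2)"
          by (simp only: distrib_left)
        moreover have "4 * sqrt n * (4 / w\<^sup>2) = 16 * sqrt n * (1 / w\<^sup>2)" by simp
        ultimately show ?thesis by linarith
      qed
      also have "\<dots> = real (totient n) / real n * (1 / w) + 17 * sqrt n * (1 / w\<^sup>2)" by simp
      also have "\<dots> \<le> (1 / \<tau>) * (real (totient n) / (real n)\<^sup>2 + 17 * (sqrt n / (real n)\<^sup>2))"
      proof -
        have "1 / w\<^sup>2 \<le> (1 / \<tau>) * (1 / (real n)\<^sup>2)"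
          using n \<tau> by (simp add: w_def power_mult_distrib field_simps power2_eq_square)
        then have "17 * sqrt n * (1 / w\<^sup>2) \<le> 17 * sqrt n * ((1 / \<tau>) * (1 / (real n)\<^sup>2))" by (intro mult_left_mono) auto
        then show ?thesis using n \<tau> by (simp add: w_def power2_eq_square algebra_simps)
      qed
      finally show ?thesis unfolding n_def .
    qed
    have "(\<Sum>(q2, p2)\<in>A. 1 / (real q2)\<^sup>2) = (\<Sum>x\<in>A. (case f x of (\<beta>, \<alpha>) \<Rightarrow> (1 / (real q)\<^sup>2) * (1 / (\<alpha> + \<beta> * \<theta>)\<^sup>2)))"
    proof (rule sum.cong[OF refl])
      fix x assume x: "x \<in> A"
      obtain x1 x2 where e: "x = (x1, x2)" by (cases x) auto
      define \<beta> \<alpha> where "\<beta> = int p * int x1 - int x2 * int q" and "\<alpha> = q' * int x2 - p' * int x1"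
      have x1: "int x1 = \<alpha> * int q + \<beta> * q'" using q2[of x1 x2] by (simp add: \<beta>_def \<alpha>_def)
      have "real x1 = real_of_int (int x1)" by simp
      then have ab: "\<alpha> + \<beta> * \<theta> = real x1 / real q" unfolding x1 using q by (simp add: \<theta>_def field_simps)
      have "1 / (real x1)\<^sup>2 = (1 / (real q)\<^sup>2) * (1 / (\<alpha> + \<beta> * \<theta>)\<^sup>2)" unfolding ab using q by (simp add: power_divide)
      then show "(case x of (q2, p2) \<Rightarrow> 1 / (real q2)\<^sup>2) = (case f x of (\<beta>, \<alpha>) \<Rightarrow> (1 / (real q)\<^sup>2) * (1 / (\<alpha> + \<beta> * \<theta>)\<^sup>2))"
        by (simp add: e f_def flip: \<beta>_def \<alpha>_def)
    qed
    also have "\<dots> = (\<Sum>(\<beta>, \<alpha>)\<in>f ` A. (1 / (real q)\<^sup>2) * (1 / (\<alpha> + \<beta> * \<theta>)\<^sup>2))"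
      by (simp only: sum.reindex[OF inj] o_def)
    also have "\<dots> \<le> (\<Sum>(\<beta>, \<alpha>)\<in>(SIGMA \<beta>:B. S \<beta>). (1 / (real q)\<^sup>2) * (1 / (\<alpha> + \<beta> * \<theta>)\<^sup>2))"
      using finB finS by (intro sum_mono2[OF _ img]) auto
    also have "\<dots> = (\<Sum>\<beta>\<in>B. \<Sum>\<alpha>\<in>S \<beta>. (1 / (real q)\<^sup>2) * (1 / (\<alpha> + \<beta> * \<theta>)\<^sup>2))"
      using finB finS by (intro sum.Sigma[symmetric]) auto
    also have "\<dots> = (1 / (real q)\<^sup>2) * (\<Sum>\<beta>\<in>B. \<Sum>\<alpha>\<in>S \<beta>. 1 / (\<alpha> + \<beta> * \<theta>)\<^sup>2)"
      by (simp only: sum_distrib_left)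
    also have "\<dots> \<le> (1 / (real q)\<^sup>2) * (\<Sum>\<beta>\<in>B. (1 / \<tau>) * (real (totient (nat \<bar>\<beta>\<bar>)) / (real (nat \<bar>\<beta>\<bar>))\<^sup>2 + 17 * (sqrt (nat \<bar>\<beta>\<bar>) / (real (nat \<bar>\<beta>\<bar>))\<^sup>2)))"
      using per by (intro mult_left_mono sum_mono) auto
    also have "(\<Sum>\<beta>\<in>B. (1 / \<tau>) * (real (totient (nat \<bar>\<beta>\<bar>)) / (real (nat \<bar>\<beta>\<bar>))\<^sup>2 + 17 * (sqrt (nat \<bar>\<beta>\<bar>) / (real (nat \<bar>\<beta>\<bar>))\<^sup>2)))
      = 2 * (\<Sum>n=1..m. (1 / \<tau>) * (real (totient n) / (real n)\<^sup>2 + 17 * (sqrt n / (real n)\<^sup>2)))"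
      unfolding B_def by (rule sum_nonzero_abs)
    also have "\<dots> = (1 / \<tau>) * (totient_sum m + 34 * (\<Sum>n=1..m. sqrt n / (real n)\<^sup>2))"
      by (simp only: totient_sum_def sum_distrib_left sum.distrib[symmetric]) (intro sum.cong refl, simp add: algebra_simps)
    also have "(1 / (real q)\<^sup>2) * ((1 / \<tau>) * (totient_sum m + 34 * (\<Sum>n=1..m. sqrt n / (real n)\<^sup>2)))
       \<le> (1 / (real q)\<^sup>2) * ((1 / \<tau>) * (totient_sum m + 34 * K0))"
      using K0[of m] by (intro mult_left_mono add_left_mono) auto
    also have "\<dots> = (totient_sum m + 34 * K0) / ((real q)\<^sup>2 * real \<tau>)" by simp
    finally show "(\<Sum>(q2, p2)\<in>{(q2, p2)\<in>fractions Q. compatible q p \<tau> q2 p2}. 1 / (real q2)\<^sup>2)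
     \<le> (totient_sum (Q div q) + 34 * K0) / ((real q)\<^sup>2 * real \<tau>)"
      unfolding A_def m_def .
  qed (use K00 in auto)
qed

section \<open>Fractions near a/N and the variance of their number\<close>

text \<open>The condition |a/N - p/q| \<le> 1 / (\<tau> q^2), cleared of denominators.\<close>

definition near :: "nat \<Rightarrow> nat \<Rightarrow> nat \<Rightarrow> nat \<Rightarrow> nat \<Rightarrow> bool" where
  "near N q p \<tau> a \<longleftrightarrow> real \<tau> * real q * \<bar>real q * real a - real p * real N\<bar> \<le> real N"

text \<open>For Q < N this is the number of quality triples with q \<le> Q and \<tau> \<le> T,
  indexed by p in place of m; see \<open>near_count_eq_card\<close>.\<close>

definition near_count :: "nat \<Rightarrow> nat \<Rightarrow> nat \<Rightarrow> nat \<Rightarrow> real" where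
  "near_count N Q T a = (\<Sum>(q, p)\<in>fractions Q. \<Sum>\<tau>=3..T. of_bool (near N q p \<tau> a))"

definition truncated_harmonic :: "nat \<Rightarrow> real" where
  "truncated_harmonic T = (\<Sum>\<tau>=3..T. 1 / real \<tau>)"

text \<open>For \<open>q = 1\<close> only half of the interval around \<open>0\<close> or \<open>1\<close> lies in the unit interval.\<close>

definition interval_weight :: "nat \<Rightarrow> real" where
  "interval_weight q = (if q = 1 then 1 else 2 / (real q)\<^sup>2)"

lemma near_bound:
  assumes "near N q p \<tau> a" "1 \<le> q" "3 \<le> \<tau>"
  shows "\<bar>real q * real a - real p * real N\<bar> \<le> real N / (real \<tau> * real q)"
  using assms by (simp add: near_def le_divide_eq mult.commute)

text \<open>A level of at least 3 puts q a within N / 3 of p N, which determines p. In the second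
  moment distinct fractions with equal denominators therefore contribute nothing.\<close>

lemma near_same_denominator:
  assumes "near N q p1 \<tau>1 a" "near N q p2 \<tau>2 a" "1 \<le> q" "3 \<le> \<tau>1" "3 \<le> \<tau>2" "N > 0"
  shows "p1 = p2"
proof -
  have b: "real N / (real \<tau> * real q) \<le> real N / 3" if "3 \<le> \<tau>" for \<tau>
  proof -
    have "3 * 1 \<le> real \<tau> * real q" using that assms by (intro mult_mono) auto
    then show ?thesis using assms by (intro divide_left_mono) auto
  qed
  have "\<bar>real q * real a - real p1 * real N\<bar> \<le> real N / 3" "\<bar>real q * real a - real p2 * real N\<bar> \<le> real N / 3"
    using near_bound[OF assms(1,3,4)] near_bound[OF assms(2,3,5)] b assms by (meson order_trans)+
  then have "\<bar>real p1 * real N - real p2 * real N\<bar> < real N" using assms by linarith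
  then have "\<bar>real p1 - real p2\<bar> * real N < 1 * real N" using assms(6)
    by (simp add: left_diff_distrib[symmetric] abs_mult)
  then have "\<bar>real p1 - real p2\<bar> < 1" using assms(6) by (subst (asm) mult_less_cancel_right_pos) simp_all
  then show ?thesis by linarith
qed

text \<open>With x_i = q_i a - p_i N the determinant n satisfies n N = |q1 x2 - q2 x1|. For \<rho> =
  q2 / q1 the bounds on x_i give n \<tau>1 \<le> \<tau>1 / (3 \<rho>) + \<rho>. Since n \<ge> 1 and
  \<rho> > 1, this already forces \<tau>1 \<le> 3/2 \<rho>, so the first term is at most
  1/2.\<close>

lemma near_compatible:
  assumes "near N q1 p1 \<tau>1 a" "near N q2 p2 \<tau>2 a" "1 \<le> q1" "q1 < q2" "3 \<le> \<tau>1" "3 \<le> \<tau>2" "N > 0"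
    and cop: "coprime p1 q1" "coprime p2 q2"
  shows "compatible q1 p1 \<tau>1 q2 p2"
proof -
  define n where "n = real_of_int \<bar>int p1 * int q2 - int p2 * int q1\<bar>"
  have ne: "int p1 * int q2 \<noteq> int p2 * int q1"
  proof
    assume "int p1 * int q2 = int p2 * int q1"
    then have e: "p1 * q2 = p2 * q1" by (simp flip: of_nat_mult)
    then have "q2 dvd p2 * q1" by (metis dvd_triv_right)
    then have "q2 dvd q1" using cop(2) by (simp add: coprime_commute coprime_dvd_mult_right_iff)
    then show False using assms(3,4) by (auto dest: dvd_imp_le)
  qed
  have n1: "n \<ge> 1" using ne unfolding n_def by linarith
  have pos: "real q1 > 0" "real q2 > 0" "real \<tau>1 \<ge> 3" "real \<tau>2 \<ge> 3" "real N > 0" "real q1 < real q2" using assms by auto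
  define x1 x2 where "x1 = real q1 * real a - real p1 * real N" and "x2 = real q2 * real a - real p2 * real N"
  have b1: "\<bar>x1\<bar> \<le> real N / (real \<tau>1 * real q1)" unfolding x1_def by (rule near_bound[OF assms(1,3,5)])
  have b2: "\<bar>x2\<bar> \<le> real N / (real \<tau>2 * real q2)" unfolding x2_def using assms by (intro near_bound) auto
  have "n * real N = \<bar>real_of_int (int p1 * int q2 - int p2 * int q1) * real N\<bar>" using pos by (simp add: n_def abs_mult)
  also have "real_of_int (int p1 * int q2 - int p2 * int q1) * real N = real q1 * x2 - real q2 * x1"
    by (simp add: x1_def x2_def algebra_simps)
  also have "\<bar>real q1 * x2 - real q2 * x1\<bar> \<le> real q1 * \<bar>x2\<bar> + real q2 * \<bar>x1\<bar>"
    using abs_triangle_ineq4[of "real q1 * x2" "real q2 * x1"] by (simp add: abs_mult)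
  also have "\<dots> \<le> real q1 * (real N / (real \<tau>2 * real q2)) + real q2 * (real N / (real \<tau>1 * real q1))"
    using b1 b2 pos by (intro add_mono mult_left_mono) auto
  also have "\<dots> = (real q1 / (real \<tau>2 * real q2) + real q2 / (real \<tau>1 * real q1)) * real N"
    by (simp add: algebra_simps)
  finally have "n \<le> real q1 / (real \<tau>2 * real q2) + real q2 / (real \<tau>1 * real q1)" using pos by simp
  also have "\<dots> \<le> real q1 / (3 * real q2) + real q2 / (real \<tau>1 * real q1)"
    using pos by (intro add_right_mono divide_left_mono mult_right_mono) auto
  finally have nn: "n \<le> real q1 / (3 * real q2) + real q2 / (real \<tau>1 * real q1)" .
  define \<rho> where "\<rho> = real q2 / real q1"
  have \<rho>: "\<rho> > 1" "real q1 / (3 * real q2) = 1 / (3 * \<rho>)" "real q2 / (real \<tau>1 * real q1) = \<rho> / real \<tau>1"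
    using pos by (auto simp: \<rho>_def field_simps)
  have nr: "n * real \<tau>1 \<le> real \<tau>1 / (3 * \<rho>) + \<rho>"
  proof -
    have "n * real \<tau>1 \<le> (1 / (3 * \<rho>) + \<rho> / real \<tau>1) * real \<tau>1" using nn unfolding \<rho> using pos by (intro mult_right_mono) auto
    also have "\<dots> = real \<tau>1 / (3 * \<rho>) + \<rho>" using pos by (simp add: distrib_right)
    finally show ?thesis .
  qed
  have "real \<tau>1 / (3 * \<rho>) \<le> real \<tau>1 / 3" using \<rho>(1) pos by (intro divide_left_mono) auto
  moreover have "1 * real \<tau>1 \<le> n * real \<tau>1" using n1 by (intro mult_right_mono) auto
  ultimately have "real \<tau>1 \<le> 3 / 2 * \<rho>" using nr by linarith
  then have "real \<tau>1 / (3 * \<rho>) \<le> 1 / 2" using \<rho>(1) by (simp add: divide_le_eq)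
  then have "n * real \<tau>1 - 1/2 \<le> \<rho>" using nr by linarith
  then have "(n * real \<tau>1 - 1/2) * real q1 \<le> real q2" using pos by (simp add: \<rho>_def le_divide_eq)
  then show ?thesis using ne by (simp add: compatible_def n_def)
qed

text \<open>The totient of 1 counts only one of the fractions 0/1 and 1/1, hence the extra
  \<open>f 1\<close>.\<close>

lemma sum_fractions:
  fixes f :: "nat \<Rightarrow> real"
  assumes "Q \<ge> 1"
  shows "(\<Sum>(q, p)\<in>fractions Q. f q) = f 1 + (\<Sum>q=1..Q. real (totient q) * f q)"
proof -
  have "fractions Q = (SIGMA q:{1..Q}. {p. p \<le> q \<and> coprime p q})" by (auto simp: fractions_def)
  then have "(\<Sum>(q, p)\<in>fractions Q. f q) = (\<Sum>q=1..Q. \<Sum>p | p \<le> q \<and> coprime p q. f q)"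
    by (simp only:) (rule sum.Sigma[symmetric], auto)
  also have "\<dots> = (\<Sum>q=1..Q. (if q = 1 then f 1 else 0) + real (totient q) * f q)"
  proof (rule sum.cong[OF refl])
    fix q assume q: "q \<in> {1..Q}"
    show "(\<Sum>p | p \<le> q \<and> coprime p q. f q) = (if q = 1 then f 1 else 0) + real (totient q) * f q"
    proof (cases "q = 1")
      case True
      have "{p. p \<le> (1::nat) \<and> coprime p 1} = {0, 1}" by auto
      then show ?thesis using True by simp
    next
      case False
      have "{p. p \<le> q \<and> coprime p q} = totatives q"
        using q False by (auto simp: totatives_def intro!: gr0I)
      then show ?thesis using False by (simp add: totient_def)
    qed
  qed
  also have "\<dots> = f 1 + (\<Sum>q=1..Q. real (totient q) * f q)"
    using assms by (simp add: sum.distrib)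
  finally show ?thesis .
qed

text \<open>The half intervals at 0 and 1 together weigh as much as one full interval with q = 1, so
  the total is exact.\<close>

lemma sum_interval_weight:
  assumes "Q \<ge> 1"
  shows "(\<Sum>(q, p)\<in>fractions Q. interval_weight q) = totient_sum Q"
proof -
  have "(\<Sum>(q, p)\<in>fractions Q. interval_weight q) = interval_weight 1 + (\<Sum>q=1..Q. real (totient q) * interval_weight q)"
    by (rule sum_fractions[OF assms])
  also have "(\<Sum>q=1..Q. real (totient q) * interval_weight q) = (\<Sum>q=1..Q. 2 * real (totient q) / (real q)\<^sup>2 - (if q = 1 then 1 else 0))"
    by (intro sum.cong refl) (auto simp: interval_weight_def)
  also have "\<dots> = totient_sum Q - 1" using assms by (simp add: sum_subtractf totient_sum_def)
  finally show ?thesis by (simp add: interval_weight_def)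
qed

lemma sum_of_bool_card: "finite A \<Longrightarrow> (\<Sum>x\<in>A. of_bool (P x) :: real) = real (card {x\<in>A. P x})"
  by (simp add: Int_def)

text \<open>In each pair of levels only the condition at the larger one is kept, and it has at most
  \<tau> partners. As level \<tau> has probability of order 1 / \<tau>, the mean of the right-hand
  side is of order T.\<close>

lemma sum_indicators_square_le:
  fixes P :: "nat \<Rightarrow> bool"
  shows "(\<Sum>\<tau>=3..T. of_bool (P \<tau>) :: real)\<^sup>2 \<le> (\<Sum>\<tau>=3..T. 2 * real \<tau> * of_bool (P \<tau>))"
proof -
  have card: "real (card {\<tau>'\<in>{3..T}. \<tau>' \<le> \<tau>}) \<le> real \<tau>" for \<tau>
  proof -
    have "card {\<tau>'\<in>{3..T}. \<tau>' \<le> \<tau>} \<le> card {1..\<tau>}" by (intro card_mono) auto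
    then show ?thesis by simp
  qed
  have "(\<Sum>\<tau>=3..T. of_bool (P \<tau>) :: real)\<^sup>2 = (\<Sum>\<tau>1=3..T. \<Sum>\<tau>2=3..T. of_bool (P \<tau>1) * of_bool (P \<tau>2))"
    by (simp only: power2_eq_square sum_product)
  also have "\<dots> \<le> (\<Sum>\<tau>1=3..T. \<Sum>\<tau>2=3..T. of_bool (\<tau>1 \<le> \<tau>2) * of_bool (P \<tau>2) + of_bool (\<tau>2 \<le> \<tau>1) * of_bool (P \<tau>1))"
    by (intro sum_mono) auto
  also have "\<dots> = (\<Sum>\<tau>1=3..T. \<Sum>\<tau>2=3..T. of_bool (\<tau>1 \<le> \<tau>2) * of_bool (P \<tau>2)) + (\<Sum>\<tau>1=3..T. \<Sum>\<tau>2=3..T. of_bool (\<tau>2 \<le> \<tau>1) * of_bool (P \<tau>1))"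
    by (simp only: sum.distrib)
  also have "(\<Sum>\<tau>1=3..T. \<Sum>\<tau>2=3..T. of_bool (\<tau>1 \<le> \<tau>2) * of_bool (P \<tau>2) :: real) = (\<Sum>\<tau>1=3..T. \<Sum>\<tau>2=3..T. of_bool (\<tau>2 \<le> \<tau>1) * of_bool (P \<tau>1))"
    by (rule sum.swap)
  also have "(\<Sum>\<tau>1=3..T. \<Sum>\<tau>2=3..T. of_bool (\<tau>2 \<le> \<tau>1) * of_bool (P \<tau>1) :: real) \<le> (\<Sum>\<tau>=3..T. real \<tau> * of_bool (P \<tau>))"
  proof (rule sum_mono)
    fix \<tau> :: nat
    have "(\<Sum>\<tau>2=3..T. of_bool (\<tau>2 \<le> \<tau>) :: real) = real (card {\<tau>'\<in>{3..T}. \<tau>' \<le> \<tau>})"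
      by (rule sum_of_bool_card) simp
    then show "(\<Sum>\<tau>2=3..T. of_bool (\<tau>2 \<le> \<tau>) * of_bool (P \<tau>) :: real) \<le> real \<tau> * of_bool (P \<tau>)"
      using card[of \<tau>] by (simp add: sum_distrib_right[symmetric] mult_right_mono)
  qed
  also have "(\<Sum>\<tau>=3..T. real \<tau> * of_bool (P \<tau>)) + (\<Sum>\<tau>=3..T. real \<tau> * of_bool (P \<tau>)) = (\<Sum>\<tau>=3..T. 2 * real \<tau> * of_bool (P \<tau>))"
    unfolding sum.distrib[symmetric] by (intro sum.cong refl) simp
  finally show ?thesis by simp
qed

lemma square_sum_split_by_key:
  fixes z :: "'a \<Rightarrow> real" and k :: "'a \<Rightarrow> nat"
  assumes "finite F" and orth: "\<And>v w. v \<in> F \<Longrightarrow> w \<in> F \<Longrightarrow> k v = k w \<Longrightarrow> v \<noteq> w \<Longrightarrow> z v * z w = 0"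
  shows "(\<Sum>v\<in>F. z v)\<^sup>2 = (\<Sum>v\<in>F. (z v)\<^sup>2) + 2 * (\<Sum>v\<in>F. \<Sum>w\<in>F. of_bool (k v < k w) * (z v * z w))"
proof -
  have "(\<Sum>v\<in>F. z v)\<^sup>2 = (\<Sum>v\<in>F. \<Sum>w\<in>F. z v * z w)" by (simp only: power2_eq_square sum_product)
  also have "\<dots> = (\<Sum>v\<in>F. \<Sum>w\<in>F. of_bool (v = w) * (z v)\<^sup>2 + of_bool (k v < k w) * (z v * z w) + of_bool (k w < k v) * (z w * z v))"
  proof (intro sum.cong refl)
    fix v w assume "v \<in> F" "w \<in> F"
    then show "z v * z w = of_bool (v = w) * (z v)\<^sup>2 + of_bool (k v < k w) * (z v * z w) + of_bool (k w < k v) * (z w * z v)"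
      using orth[of v w] by (cases "k v" "k w" rule: linorder_cases) (auto simp: power2_eq_square)
  qed
  also have "\<dots> = (\<Sum>v\<in>F. \<Sum>w\<in>F. of_bool (v = w) * (z v)\<^sup>2) + (\<Sum>v\<in>F. \<Sum>w\<in>F. of_bool (k v < k w) * (z v * z w)) + (\<Sum>v\<in>F. \<Sum>w\<in>F. of_bool (k w < k v) * (z w * z v))"
    by (simp only: sum.distrib)
  also have "(\<Sum>v\<in>F. \<Sum>w\<in>F. of_bool (k w < k v) * (z w * z v)) = (\<Sum>v\<in>F. \<Sum>w\<in>F. of_bool (k v < k w) * (z v * z w))"
    by (rule sum.swap)
  also have "(\<Sum>v\<in>F. \<Sum>w\<in>F. of_bool (v = w) * (z v)\<^sup>2) = (\<Sum>v\<in>F. (z v)\<^sup>2)"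
    using assms(1) by (intro sum.cong refl) (simp add: of_bool_def if_distrib[of "\<lambda>x. x * _"] cong: if_cong)
  finally show ?thesis by simp
qed

text \<open>Expand the square, with \<open>z v\<close> counting the levels at which a/N is near the
  fraction v. The diagonal is O(T \<Phi>), equal denominators drop out, and for q1 < q2 an upper
  bound is enough because the first moment is known from below. Summing over these pairs leads to
  \<open>totient_sum_convolution_le\<close>, whose main term is cancelled by the squared
  mean.\<close>

lemma near_count_second_moment:
  "\<exists>K\<ge>0. \<forall>N Q T \<epsilon>. N \<ge> 2 \<longrightarrow> Q \<ge> 1 \<longrightarrow> 0 \<le> \<epsilon> \<longrightarrow> \<epsilon> \<le> 1 \<longrightarrow>
     (\<forall>q p \<tau>. (q, p) \<in> fractions Q \<longrightarrow> 3 \<le> \<tau> \<longrightarrow> \<tau> \<le> T \<longrightarrow>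
       \<bar>real (card {a\<in>totatives N. near N q p \<tau> a}) - real (totient N) * interval_weight q / \<tau>\<bar>
         \<le> \<epsilon> * (real (totient N) * interval_weight q / \<tau>)) \<longrightarrow>
     (\<Sum>a\<in>totatives N. (near_count N Q T a - truncated_harmonic T * totient_sum Q)\<^sup>2)
       \<le> real (totient N) * (4 * real T * totient_sum Q + K * (truncated_harmonic T)\<^sup>2 * totient_sum Q
            + 3 * \<epsilon> * (truncated_harmonic T * totient_sum Q)\<^sup>2)"
proof -
  obtain K where K0: "K \<ge> 0" and K': "\<forall>Q q p \<tau>. 1 \<le> q \<longrightarrow> q \<le> Q \<longrightarrow> coprime p q \<longrightarrow> 3 \<le> \<tau> \<longrightarrow>
     (\<Sum>(q2, p2)\<in>{(q2, p2)\<in>fractions Q. compatible q p \<tau> q2 p2}. 1 / (real q2)\<^sup>2)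
     \<le> (totient_sum (Q div q) + K) / ((real q)\<^sup>2 * real \<tau>)"
    using compatible_sum_le by (elim exE conjE) (rule that)
  note K = K'[rule_format]
  obtain K1 where K10: "K1 \<ge> 0" and K1': "\<forall>Q\<ge>1. 2 * (\<Sum>q=1..Q. 2 * real (totient q) / (real q)\<^sup>2 * totient_sum (Q div q))
     \<le> (totient_sum Q)\<^sup>2 + K1 * totient_sum Q"
    using totient_sum_convolution_le by (elim exE conjE) (rule that)
  note K1 = K1'[rule_format]
  \<comment> \<open>\<open>K1\<close> comes from the convolution, 4 from the second fraction with q
    = 1, and 4 K collects the constant of \<open>compatible_sum_le\<close> with the help of \<Phi>
    \<ge> 2.\<close>
  define K2 where "K2 = K1 + 4 + 4 * K"
  have "(\<Sum>a\<in>totatives N. (near_count N Q T a - truncated_harmonic T * totient_sum Q)\<^sup>2)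
       \<le> real (totient N) * (4 * real T * totient_sum Q + 2 * K2 * (truncated_harmonic T)\<^sup>2 * totient_sum Q
            + 3 * \<epsilon> * (truncated_harmonic T * totient_sum Q)\<^sup>2)"
    if N: "N \<ge> 2" and Q: "Q \<ge> 1" and \<epsilon>: "0 \<le> \<epsilon>" "\<epsilon> \<le> 1"
      and equi: "\<And>q p \<tau>. (q, p) \<in> fractions Q \<Longrightarrow> 3 \<le> \<tau> \<Longrightarrow> \<tau> \<le> T \<Longrightarrow>
       \<bar>real (card {a\<in>totatives N. near N q p \<tau> a}) - real (totient N) * interval_weight q / \<tau>\<bar>
         \<le> \<epsilon> * (real (totient N) * interval_weight q / \<tau>)" for N Q T \<epsilon>
  proof -
    define \<phi> where "\<phi> = real (totient N)"
    define \<Phi> where "\<Phi> = totient_sum Q"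
    define h where "h = truncated_harmonic T"
    define F where "F = fractions Q"
    define z where "z v a = (\<Sum>\<tau>=3..T. of_bool (near N (fst v) (snd v) \<tau> a) :: real)" for v a
    define C where "C a = (\<Sum>v\<in>F. \<Sum>w\<in>F. of_bool (fst v < fst w) * (z v a * z w a))" for a
    have finF: "finite F" by (simp add: F_def)
    have \<phi>0: "\<phi> \<ge> 0" by (simp add: \<phi>_def)
    have h0: "h \<ge> 0" by (simp add: h_def truncated_harmonic_def sum_nonneg)
    have \<Phi>2: "\<Phi> \<ge> 2" unfolding \<Phi>_def by (rule totient_sum_ge_2[OF Q])
    have z0: "z v a \<ge> 0" for v a by (simp add: z_def sum_nonneg)
    have zz: "z v a = 0" if "\<forall>\<tau>\<in>{3..T}. \<not> near N (fst v) (snd v) \<tau> a" for v a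
      unfolding z_def using that by (intro sum.neutral) auto
    have Fv: "1 \<le> fst v" "fst v \<le> Q" "coprime (snd v) (fst v)" "(fst v, snd v) \<in> fractions Q" if "v \<in> F" for v
      using that by (auto simp: F_def fractions_def)
    have Z: "near_count N Q T a = (\<Sum>v\<in>F. z v a)" for a
      by (simp add: near_count_def F_def z_def case_prod_beta)
    have cnt_sum: "(\<Sum>a\<in>totatives N. of_bool (near N q p \<tau> a) :: real) = real (card {a\<in>totatives N. near N q p \<tau> a})" for q p \<tau>
      by (rule sum_of_bool_card) simp
    have rel: "x \<le> (1 + \<epsilon>) * y \<and> (1 - \<epsilon>) * y \<le> x" if "\<bar>x - y\<bar> \<le> \<epsilon> * y" for x y
      using that by (auto simp: abs_le_iff algebra_simps)
    have up: "(\<Sum>a\<in>totatives N. of_bool (near N (fst v) (snd v) \<tau> a) :: real) \<le> (1 + \<epsilon>) * (\<phi> * interval_weight (fst v) / \<tau>)"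
      if "v \<in> F" "\<tau> \<in> {3..T}" for v \<tau>
      unfolding cnt_sum \<phi>_def using that by (intro conjunct1[OF rel] equi Fv(4)) auto
    have lo: "(\<Sum>a\<in>totatives N. of_bool (near N (fst v) (snd v) \<tau> a) :: real) \<ge> (1 - \<epsilon>) * (\<phi> * interval_weight (fst v) / \<tau>)"
      if "v \<in> F" "\<tau> \<in> {3..T}" for v \<tau>
      unfolding cnt_sum \<phi>_def using that by (intro conjunct2[OF rel] equi Fv(4)) auto
    have \<mu>: "(\<Sum>v\<in>F. interval_weight (fst v)) = \<Phi>"
      using sum_interval_weight[OF Q] by (simp add: F_def \<Phi>_def case_prod_beta)
    have hsum: "(\<Sum>\<tau>=3..T. c / \<tau>) = c * h" for c :: real
      by (simp add: h_def truncated_harmonic_def sum_distrib_left)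
    have first: "(\<Sum>a\<in>totatives N. near_count N Q T a) \<ge> (1 - \<epsilon>) * (\<phi> * (h * \<Phi>))"
    proof -
      have "(1 - \<epsilon>) * (\<phi> * (h * \<Phi>)) = (\<Sum>v\<in>F. \<Sum>\<tau>=3..T. (1 - \<epsilon>) * (\<phi> * interval_weight (fst v) / \<tau>))"
        unfolding sum_distrib_left[symmetric] hsum \<mu>[symmetric] by (simp add: sum_distrib_left sum_distrib_right mult_ac)
      also have "\<dots> \<le> (\<Sum>v\<in>F. \<Sum>\<tau>=3..T. \<Sum>a\<in>totatives N. of_bool (near N (fst v) (snd v) \<tau> a))"
        by (intro sum_mono lo)
      also have "\<dots> = (\<Sum>v\<in>F. \<Sum>a\<in>totatives N. z v a)" unfolding z_def by (intro sum.cong refl sum.swap)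
      also have "\<dots> = (\<Sum>a\<in>totatives N. near_count N Q T a)" unfolding Z by (rule sum.swap)
      finally show ?thesis .
    qed
    have sq: "(near_count N Q T a)\<^sup>2 = (\<Sum>v\<in>F. (z v a)\<^sup>2) + 2 * C a" for a
      unfolding Z C_def
    proof (rule square_sum_split_by_key[OF finF])
      fix v w assume vw: "v \<in> F" "w \<in> F" "fst v = fst w" "v \<noteq> w"
      have "\<not> (near N (fst v) (snd v) \<tau>1 a \<and> near N (fst w) (snd w) \<tau>2 a)" if "\<tau>1 \<in> {3..T}" "\<tau>2 \<in> {3..T}" for \<tau>1 \<tau>2
        using near_same_denominator[of N "fst v" "snd v" \<tau>1 a "snd w" \<tau>2] vw that Fv(1)[of v] N by (auto simp: prod_eq_iff)
      then have "(\<forall>\<tau>\<in>{3..T}. \<not> near N (fst v) (snd v) \<tau> a) \<or> (\<forall>\<tau>\<in>{3..T}. \<not> near N (fst w) (snd w) \<tau> a)" by blast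
      then have "z v a = 0 \<or> z w a = 0" using zz by blast
      then show "z v a * z w a = 0" by auto
    qed
    have diag: "(\<Sum>a\<in>totatives N. \<Sum>v\<in>F. (z v a)\<^sup>2) \<le> (1 + \<epsilon>) * (\<phi> * (2 * real T * \<Phi>))"
    proof -
      have "(\<Sum>a\<in>totatives N. \<Sum>v\<in>F. (z v a)\<^sup>2) \<le> (\<Sum>a\<in>totatives N. \<Sum>v\<in>F. \<Sum>\<tau>=3..T. 2 * real \<tau> * of_bool (near N (fst v) (snd v) \<tau> a))"
        unfolding z_def by (intro sum_mono sum_indicators_square_le)
      also have "\<dots> = (\<Sum>v\<in>F. \<Sum>a\<in>totatives N. \<Sum>\<tau>=3..T. 2 * real \<tau> * of_bool (near N (fst v) (snd v) \<tau> a))"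
        by (rule sum.swap)
      also have "\<dots> = (\<Sum>v\<in>F. \<Sum>\<tau>=3..T. \<Sum>a\<in>totatives N. 2 * real \<tau> * of_bool (near N (fst v) (snd v) \<tau> a))"
        by (intro sum.cong refl sum.swap)
      also have "\<dots> = (\<Sum>v\<in>F. \<Sum>\<tau>=3..T. 2 * real \<tau> * (\<Sum>a\<in>totatives N. of_bool (near N (fst v) (snd v) \<tau> a)))"
        by (simp only: sum_distrib_left)
      also have "\<dots> \<le> (\<Sum>v\<in>F. \<Sum>\<tau>=3..T. 2 * real \<tau> * ((1 + \<epsilon>) * (\<phi> * interval_weight (fst v) / \<tau>)))"
        by (intro sum_mono mult_left_mono up) auto
      also have "\<dots> = (\<Sum>v\<in>F. \<Sum>\<tau>=3..T. 2 * ((1 + \<epsilon>) * (\<phi> * interval_weight (fst v))))"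
        by (intro sum.cong refl) simp
      also have "\<dots> \<le> (\<Sum>v\<in>F. real T * (2 * ((1 + \<epsilon>) * (\<phi> * interval_weight (fst v)))))"
      proof (rule sum_mono)
        fix v assume "v \<in> F"
        have "0 \<le> 2 * ((1 + \<epsilon>) * (\<phi> * interval_weight (fst v)))" using \<epsilon> \<phi>0 by (simp add: interval_weight_def)
        then show "(\<Sum>\<tau>=3..T. 2 * ((1 + \<epsilon>) * (\<phi> * interval_weight (fst v)))) \<le> real T * (2 * ((1 + \<epsilon>) * (\<phi> * interval_weight (fst v))))"
          unfolding sum_constant by (intro mult_right_mono) auto
      qed
      also have "\<dots> = (1 + \<epsilon>) * (\<phi> * (2 * real T * \<Phi>))"
        unfolding \<mu>[symmetric] by (simp add: sum_distrib_left mult_ac)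
      finally show ?thesis .
    qed
    have cross: "(\<Sum>a\<in>totatives N. C a) \<le> (1 + \<epsilon>) * (\<phi> * (2 * h\<^sup>2)) * (\<Sum>v\<in>F. (totient_sum (Q div fst v) + K) / (real (fst v))\<^sup>2)"
    proof -
      have zw: "(\<Sum>a\<in>totatives N. z w a) \<le> (1 + \<epsilon>) * \<phi> * h * (2 / (real (fst w))\<^sup>2)" if "w \<in> F" "fst w > 1" for w
      proof -
        have "(\<Sum>a\<in>totatives N. z w a) = (\<Sum>\<tau>=3..T. \<Sum>a\<in>totatives N. of_bool (near N (fst w) (snd w) \<tau> a))"
          unfolding z_def by (rule sum.swap)
        also have "\<dots> \<le> (\<Sum>\<tau>=3..T. (1 + \<epsilon>) * (\<phi> * interval_weight (fst w) / \<tau>))" by (intro sum_mono up that)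
        also have "\<dots> = (1 + \<epsilon>) * (\<phi> * interval_weight (fst w) * h)" unfolding sum_distrib_left[symmetric] hsum ..
        finally show ?thesis using that by (simp add: interval_weight_def mult_ac)
      qed
      have "(\<Sum>a\<in>totatives N. C a) = (\<Sum>v\<in>F. \<Sum>w\<in>F. \<Sum>a\<in>totatives N. of_bool (fst v < fst w) * (z v a * z w a))"
        unfolding C_def by (subst sum.swap) (intro sum.cong refl sum.swap)
      also have "\<dots> \<le> (\<Sum>v\<in>F. \<Sum>w\<in>F. \<Sum>\<tau>=3..T. of_bool (compatible (fst v) (snd v) \<tau> (fst w) (snd w)) * ((1 + \<epsilon>) * \<phi> * h * (2 / (real (fst w))\<^sup>2)))"
      proof (intro sum_mono)
        fix v w assume vw: "v \<in> F" "w \<in> F"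
        define c where "c \<tau> = (of_bool (compatible (fst v) (snd v) \<tau> (fst w) (snd w)) :: real)" for \<tau>
        have R0: "0 \<le> (1 + \<epsilon>) * \<phi> * h * (2 / (real (fst w))\<^sup>2)" using \<epsilon> \<phi>0 h0 by simp
        show "(\<Sum>a\<in>totatives N. of_bool (fst v < fst w) * (z v a * z w a)) \<le> (\<Sum>\<tau>=3..T. of_bool (compatible (fst v) (snd v) \<tau> (fst w) (snd w)) * ((1 + \<epsilon>) * \<phi> * h * (2 / (real (fst w))\<^sup>2)))"
        proof (cases "fst v < fst w")
          case False
          then show ?thesis using R0 by (auto intro!: sum_nonneg mult_nonneg_nonneg)
        next
          case True
          \<comment> \<open>Nearness to the first fraction is relaxed to compatibility, which does
            not involve a. Equidistribution is then applied to the second interval alone, and never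
            to intersections of intervals.\<close>
          have "z v a * z w a \<le> (\<Sum>\<tau>=3..T. c \<tau>) * z w a" for a
          proof (cases "z w a = 0")
            case False
            then obtain \<tau>2 where t2: "\<tau>2 \<in> {3..T}" "near N (fst w) (snd w) \<tau>2 a"
              using zz by blast
            have "z v a \<le> (\<Sum>\<tau>=3..T. c \<tau>)" unfolding z_def c_def
            proof (rule sum_mono)
              fix \<tau> assume t: "\<tau> \<in> {3..T}"
              show "(of_bool (near N (fst v) (snd v) \<tau> a) :: real) \<le> of_bool (compatible (fst v) (snd v) \<tau> (fst w) (snd w))"
                using near_compatible[of N "fst v" "snd v" \<tau> a "fst w" "snd w" \<tau>2] t t2 True N Fv[OF vw(1)] Fv[OF vw(2)] by auto
            qed
            then show ?thesis using z0 by (intro mult_right_mono)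
          qed simp
          then have "(\<Sum>a\<in>totatives N. z v a * z w a) \<le> (\<Sum>a\<in>totatives N. (\<Sum>\<tau>=3..T. c \<tau>) * z w a)" by (rule sum_mono)
          also have "\<dots> = (\<Sum>\<tau>=3..T. c \<tau>) * (\<Sum>a\<in>totatives N. z w a)" by (simp only: sum_distrib_left)
          also have "\<dots> \<le> (\<Sum>\<tau>=3..T. c \<tau>) * ((1 + \<epsilon>) * \<phi> * h * (2 / (real (fst w))\<^sup>2))"
            using zw[OF vw(2)] True Fv(1)[OF vw(1)] by (intro mult_left_mono) (auto simp: c_def sum_nonneg)
          finally have fin: "(\<Sum>a\<in>totatives N. z v a * z w a) \<le> (\<Sum>\<tau>=3..T. c \<tau>) * ((1 + \<epsilon>) * \<phi> * h * (2 / (real (fst w))\<^sup>2))" .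
          have "(\<Sum>a\<in>totatives N. of_bool (fst v < fst w) * (z v a * z w a)) = (\<Sum>a\<in>totatives N. z v a * z w a)"
            using True by simp
          then show ?thesis unfolding c_def[symmetric] sum_distrib_right[symmetric] using fin by (simp only:)
        qed
      qed
      also have "\<dots> = (\<Sum>v\<in>F. \<Sum>\<tau>=3..T. \<Sum>w\<in>F. of_bool (compatible (fst v) (snd v) \<tau> (fst w) (snd w)) * ((1 + \<epsilon>) * \<phi> * h * (2 / (real (fst w))\<^sup>2)))"
        by (intro sum.cong refl sum.swap)
      also have "\<dots> \<le> (\<Sum>v\<in>F. \<Sum>\<tau>=3..T. (1 + \<epsilon>) * \<phi> * h * 2 * ((totient_sum (Q div fst v) + K) / ((real (fst v))\<^sup>2 * real \<tau>)))"
      proof (intro sum_mono)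
        fix v \<tau> assume v: "v \<in> F" and t: "\<tau> \<in> {3..T}"
        have "(\<Sum>w\<in>F. of_bool (compatible (fst v) (snd v) \<tau> (fst w) (snd w)) * ((1 + \<epsilon>) * \<phi> * h * (2 / (real (fst w))\<^sup>2)))
          = (1 + \<epsilon>) * \<phi> * h * 2 * (\<Sum>w\<in>F. of_bool (compatible (fst v) (snd v) \<tau> (fst w) (snd w)) * (1 / (real (fst w))\<^sup>2))"
          unfolding sum_distrib_left by (intro sum.cong refl) simp
        also have "(\<Sum>w\<in>F. of_bool (compatible (fst v) (snd v) \<tau> (fst w) (snd w)) * (1 / (real (fst w))\<^sup>2)) = (\<Sum>(q2, p2)\<in>{(q2, p2)\<in>fractions Q. compatible (fst v) (snd v) \<tau> q2 p2}. 1 / (real q2)\<^sup>2)"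
          unfolding F_def by (rule sum.mono_neutral_cong_right) auto
        also have "(1 + \<epsilon>) * \<phi> * h * 2 * \<dots> \<le> (1 + \<epsilon>) * \<phi> * h * 2 * ((totient_sum (Q div fst v) + K) / ((real (fst v))\<^sup>2 * real \<tau>))"
          using K[of "fst v" Q "snd v" \<tau>] Fv[OF v] t \<epsilon> \<phi>0 h0 by (intro mult_left_mono) auto
        finally show "(\<Sum>w\<in>F. of_bool (compatible (fst v) (snd v) \<tau> (fst w) (snd w)) * ((1 + \<epsilon>) * \<phi> * h * (2 / (real (fst w))\<^sup>2)))
          \<le> (1 + \<epsilon>) * \<phi> * h * 2 * ((totient_sum (Q div fst v) + K) / ((real (fst v))\<^sup>2 * real \<tau>))" .
      qed
      also have "\<dots> = (\<Sum>v\<in>F. (1 + \<epsilon>) * \<phi> * h * 2 * ((totient_sum (Q div fst v) + K) / (real (fst v))\<^sup>2) * h)"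
        by (intro sum.cong refl) (subst hsum[symmetric], simp)
      also have "\<dots> = (1 + \<epsilon>) * (\<phi> * (2 * h\<^sup>2)) * (\<Sum>v\<in>F. (totient_sum (Q div fst v) + K) / (real (fst v))\<^sup>2)"
        unfolding sum_distrib_left by (intro sum.cong refl) (simp add: power2_eq_square)
      finally show ?thesis .
    qed
    have "4 * (\<Sum>v\<in>F. (totient_sum (Q div fst v) + K) / (real (fst v))\<^sup>2) \<le> \<Phi>\<^sup>2 + K2 * \<Phi>"
    proof -
      have "(\<Sum>v\<in>F. (totient_sum (Q div fst v) + K) / (real (fst v))\<^sup>2) =
         (totient_sum (Q div 1) + K) / (real 1)\<^sup>2 + (\<Sum>q=1..Q. real (totient q) * ((totient_sum (Q div q) + K) / (real q)\<^sup>2))"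
        using sum_fractions[OF Q, of "\<lambda>q. (totient_sum (Q div q) + K) / (real q)\<^sup>2"] by (simp add: F_def case_prod_beta)
      then have "4 * (\<Sum>v\<in>F. (totient_sum (Q div fst v) + K) / (real (fst v))\<^sup>2) =
         4 * (\<Phi> + K) + 4 * (\<Sum>q=1..Q. real (totient q) * ((totient_sum (Q div q) + K) / (real q)\<^sup>2))"
        by (simp add: \<Phi>_def)
      also have "4 * (\<Sum>q=1..Q. real (totient q) * ((totient_sum (Q div q) + K) / (real q)\<^sup>2)) =
         2 * (\<Sum>q=1..Q. 2 * real (totient q) / (real q)\<^sup>2 * totient_sum (Q div q)) + 2 * K * (\<Sum>q=1..Q. 2 * real (totient q) / (real q)\<^sup>2)"
        unfolding sum_distrib_left sum.distrib[symmetric]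
        by (intro sum.cong refl) (simp add: field_simps)
      also have "\<dots> \<le> (\<Phi>\<^sup>2 + K1 * \<Phi>) + 2 * K * \<Phi>"
        using K1[OF Q] unfolding \<Phi>_def by (simp add: totient_sum_def)
      finally have "4 * (\<Sum>v\<in>F. (totient_sum (Q div fst v) + K) / (real (fst v))\<^sup>2) \<le> 4 * (\<Phi> + K) + ((\<Phi>\<^sup>2 + K1 * \<Phi>) + 2 * K * \<Phi>)"
        by simp
      moreover have "K * 2 \<le> K * \<Phi>" using K0 \<Phi>2 by (intro mult_left_mono)
      ultimately show ?thesis by (simp add: K2_def algebra_simps)
    qed
    then have "(1 + \<epsilon>) * (\<phi> * h\<^sup>2) * (4 * (\<Sum>v\<in>F. (totient_sum (Q div fst v) + K) / (real (fst v))\<^sup>2)) \<le> (1 + \<epsilon>) * (\<phi> * h\<^sup>2) * (\<Phi>\<^sup>2 + K2 * \<Phi>)"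
      using \<epsilon> \<phi>0 by (intro mult_left_mono) auto
    then have cross2: "2 * (\<Sum>a\<in>totatives N. C a) \<le> (1 + \<epsilon>) * (\<phi> * h\<^sup>2) * (\<Phi>\<^sup>2 + K2 * \<Phi>)"
      using cross by (simp add: algebra_simps)
    have sumsq: "(\<Sum>a\<in>totatives N. (near_count N Q T a)\<^sup>2) \<le> (1 + \<epsilon>) * (\<phi> * (2 * real T * \<Phi>)) + (1 + \<epsilon>) * (\<phi> * h\<^sup>2) * (\<Phi>\<^sup>2 + K2 * \<Phi>)"
      unfolding sq sum.distrib sum_distrib_left[symmetric] using diag cross2 by linarith
    have "(\<Sum>a\<in>totatives N. (near_count N Q T a - h * \<Phi>)\<^sup>2) = (\<Sum>a\<in>totatives N. (near_count N Q T a)\<^sup>2) - 2 * (h * \<Phi>) * (\<Sum>a\<in>totatives N. near_count N Q T a) + \<phi> * (h * \<Phi>)\<^sup>2"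
      unfolding power2_diff sum.distrib sum_subtractf sum_distrib_left \<phi>_def by (simp add: totient_def mult_ac)
    also have "\<dots> \<le> (1 + \<epsilon>) * (\<phi> * (2 * real T * \<Phi>)) + (1 + \<epsilon>) * (\<phi> * h\<^sup>2) * (\<Phi>\<^sup>2 + K2 * \<Phi>) - 2 * (h * \<Phi>) * ((1 - \<epsilon>) * (\<phi> * (h * \<Phi>))) + \<phi> * (h * \<Phi>)\<^sup>2"
      using sumsq first h0 \<Phi>2 \<phi>0 by (intro add_mono diff_mono mult_left_mono) auto
    \<comment> \<open>The coefficient of (h \<Phi>)^2 is (1 + \<epsilon>) - 2 (1 - \<epsilon>) + 1 =
      3 \<epsilon>.\<close>
    also have "\<dots> = \<phi> * ((1 + \<epsilon>) * (2 * real T * \<Phi>) + (1 + \<epsilon>) * (K2 * h\<^sup>2 * \<Phi>) + 3 * \<epsilon> * (h * \<Phi>)\<^sup>2)"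
      by (simp add: power2_eq_square algebra_simps)
    also have "\<dots> \<le> \<phi> * (2 * (2 * real T * \<Phi>) + 2 * (K2 * h\<^sup>2 * \<Phi>) + 3 * \<epsilon> * (h * \<Phi>)\<^sup>2)"
      using \<epsilon> \<phi>0 \<Phi>2 K0 K10 by (intro mult_left_mono add_mono mult_right_mono) (auto simp: K2_def)
    finally show ?thesis by (simp add: \<phi>_def h_def \<Phi>_def mult_ac)
  qed
  then show ?thesis by (intro exI[of _ "2 * K2"]) (use K0 K10 in \<open>auto simp: K2_def\<close>)
qed

section \<open>Equidistribution and the middle range\<close>

lemma card_totatives_interval:
  fixes Y Z :: real
  assumes N: "N \<ge> 2" and P: "\<And>a. a \<in> totatives N \<Longrightarrow> P a \<longleftrightarrow> Y \<le> real a \<and> real a \<le> Z"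
    and Y: "Y \<ge> 0" and Z: "Z \<le> real N"
  shows "card {a\<in>totatives N. P a} = card {\<alpha>::int. Y \<le> \<alpha> \<and> \<alpha> \<le> Z \<and> coprime \<alpha> (int N)}"
proof -
  have "{\<alpha>::int. Y \<le> \<alpha> \<and> \<alpha> \<le> Z \<and> coprime \<alpha> (int N)} = int ` {a\<in>totatives N. P a}"
  proof (intro equalityI subsetI)
    fix \<alpha> :: int assume a: "\<alpha> \<in> {\<alpha>. Y \<le> \<alpha> \<and> \<alpha> \<le> Z \<and> coprime \<alpha> (int N)}"
    then have "real_of_int \<alpha> \<ge> 0" "real_of_int \<alpha> \<le> real N" using Y Z by (auto intro: order_trans)
    then have b: "\<alpha> \<ge> 0" "\<alpha> \<le> int N" by linarith+
    have "\<alpha> \<noteq> 0" using a N by auto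
    then obtain n where n: "\<alpha> = int n" "n > 0" "n \<le> N" using b nonneg_int_cases[OF b(1)] by (metis of_nat_le_iff of_nat_0 neq0_conv)
    then have "n \<in> totatives N" using a by (simp add: in_totatives_iff)
    then show "\<alpha> \<in> int ` {a\<in>totatives N. P a}" using P[of n] a n by auto
  next
    fix \<alpha> assume "\<alpha> \<in> int ` {a\<in>totatives N. P a}"
    then show "\<alpha> \<in> {\<alpha>. Y \<le> \<alpha> \<and> \<alpha> \<le> Z \<and> coprime \<alpha> (int N)}"
      using P by (auto simp: in_totatives_iff)
  qed
  then show ?thesis by (simp add: card_image)
qed

text \<open>For q \<ge> 2 the numerator lies between 1 and q - 1, so an interval of radius at most N
  / q around p N / q stays within [0, N]. For q = 1 the outer half is cut off, as in
  \<open>interval_weight\<close>.\<close>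

lemma near_iff_interval:
  assumes N: "N \<ge> 2" and v: "(q, p) \<in> fractions Q" and \<tau>: "3 \<le> \<tau>"
  shows "\<exists>Y Z. 0 \<le> Y \<and> Z \<le> real N \<and> Z - Y = real N * interval_weight q / real \<tau> \<and>
    (\<forall>a\<in>totatives N. near N q p \<tau> a \<longleftrightarrow> Y \<le> real a \<and> real a \<le> Z)"
proof -
  have qp: "1 \<le> q" "p \<le> q" "coprime p q" using v by (auto simp: fractions_def)
  have t3: "real \<tau> \<ge> 3" using \<tau> by simp
  have N0: "real N > 0" using N by simp
  have aN: "0 < real a" "real a \<le> real N" if "a \<in> totatives N" for a using that by (auto simp: in_totatives_iff)
  have Nt: "0 \<le> real N / \<tau>" "real N / \<tau> \<le> real N" using t3 N0 by (auto simp: divide_le_eq)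
  show ?thesis
  proof (cases "q = 1")
    case True
    then have "p = 0 \<or> p = 1" using qp by auto
    then show ?thesis
    proof
      assume p: "p = 0"
      show ?thesis
        by (rule exI[of _ 0], rule exI[of _ "real N / \<tau>"])
          (use True p Nt t3 in \<open>auto simp: near_def interval_weight_def field_simps\<close>)
    next
      assume p: "p = 1"
      have "near N q p \<tau> a \<longleftrightarrow> real N - real N / \<tau> \<le> real a \<and> real a \<le> real N" if "a \<in> totatives N" for a
        using True p t3 aN[OF that] by (auto simp: near_def field_simps)
      then show ?thesis using True Nt
        by (intro exI[of _ "real N - real N / \<tau>"] exI[of _ "real N"]) (auto simp: interval_weight_def)
    qed
  next
    case False
    then have q2: "q \<ge> 2" using qp by simp
    have p: "1 \<le> p" "p + 1 \<le> q"
      using qp False by (auto simp: Suc_le_eq intro!: gr0I) (metis coprime_self le_neq_implies_less nat_dvd_1_iff_1 One_nat_def)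
    define x e where "x = real p * real N / real q" and "e = real N / (real \<tau> * (real q)\<^sup>2)"
    have qr: "real q \<ge> 2" "real p \<ge> 1" "real p + 1 \<le> real q" using q2 p by linarith+
    have e0: "e \<ge> 0" by (simp add: e_def)
    have "1 * real q \<le> real \<tau> * (real q)\<^sup>2" using t3 qr unfolding power2_eq_square mult.assoc[symmetric]
      by (intro mult_right_mono) (auto intro: order_trans[OF _ mult_mono[of 1 "real \<tau>" 1 "real q"]])
    then have eq: "e \<le> real N / real q" unfolding e_def using qr N0 by (intro divide_left_mono) auto
    have Y: "0 \<le> x - e"
    proof -
      have "real N / real q \<le> x" unfolding x_def using qr N0 by (intro divide_right_mono) auto
      then show ?thesis using eq by linarith
    qed
    have Z: "x + e \<le> real N"
    proof -
      have "x + real N / real q = (real p + 1) * real N / real q" by (simp add: x_def add_divide_distrib algebra_simps)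
      also have "\<dots> \<le> real q * real N / real q" using qr N0 by (intro divide_right_mono mult_right_mono) auto
      also have "\<dots> = real N" using qr by simp
      finally show ?thesis using eq by linarith
    qed
    have "near N q p \<tau> a \<longleftrightarrow> x - e \<le> real a \<and> real a \<le> x + e" for a
    proof -
      have "real q * real a - real p * real N = real q * (real a - x)" using qr by (simp add: x_def field_simps)
      then have "near N q p \<tau> a \<longleftrightarrow> (real \<tau> * (real q)\<^sup>2) * \<bar>real a - x\<bar> \<le> real N"
        by (simp add: near_def abs_mult power2_eq_square mult.assoc)
      also have "\<dots> \<longleftrightarrow> \<bar>real a - x\<bar> \<le> e" unfolding e_def using t3 qr by (subst pos_le_divide_eq) (auto simp: mult.commute)
      finally show ?thesis by (auto simp: abs_le_iff)
    qed
    moreover have "(x + e) - (x - e) = real N * interval_weight q / real \<tau>"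
      using False by (simp add: e_def interval_weight_def field_simps)
    ultimately show ?thesis using Y Z by blast
  qed
qed

text \<open>By q^2 \<le> N exp(- 22 l^2) with l = ln ln N, the expected count exceeds the sieve
  error exp(21 l^2) by at least a factor exp(l^2 - l) / \<tau>, which outgrows the powers of ln N in
  \<tau> and in the required accuracy.\<close>

lemma near_equidistribution:
  fixes C :: real
  shows "\<forall>\<^sub>F N in at_top. \<forall>Q T q p \<tau>. real Q \<le> sqrt N * exp (- 11 * (ln (ln N))\<^sup>2) \<longrightarrow>
     real T \<le> exp (C * ln (ln N)) \<longrightarrow> (q, p) \<in> fractions Q \<longrightarrow> 3 \<le> \<tau> \<longrightarrow> \<tau> \<le> T \<longrightarrow>
       \<bar>real (card {a\<in>totatives N. near N q p \<tau> a}) - real (totient N) * interval_weight q / \<tau>\<bar>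
         \<le> 1 / ln N * (real (totient N) * interval_weight q / \<tau>)"
proof -
  have e1: "\<forall>\<^sub>F N in at_top. 2 * sqrt (4 * ln (real N) + 1) \<le> ln N" by real_asymp
  have e3: "\<forall>\<^sub>F N in at_top. ln (real N) > 1" by real_asymp
  have ll: "filterlim (\<lambda>N. ln (ln (real N))) at_top at_top" by real_asymp
  \<comment> \<open>For such l = ln ln N, 2 l + C l - l^2 \<le> - l \<le> - 1, and exp(- 1) \<le>
    1/2 finishes the comparison.\<close>
  have e2: "\<forall>\<^sub>F N in at_top. ln (ln (real N)) \<ge> \<bar>C\<bar> + 3"
    using ll by (simp add: filterlim_at_top)
  show ?thesis using totative_equidistribution e1 e2 eventually_ge_at_top[of 3] e3
  proof eventually_elim
    case (elim N)
    define L where "L = ln (real N)"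
    define l where "l = ln L"
    have N: "N \<ge> 2" "N > 0" using elim by auto
    have l3: "l \<ge> \<bar>C\<bar> + 3" using elim by (simp add: l_def L_def)
    have "L > 1" using elim(5) by (simp add: L_def)
    then have L: "L = exp l" "L > 0" by (auto simp: l_def)
    define \<phi> where "\<phi> = real (totient N)"
    have \<phi>0: "\<phi> > 0" using N by (simp add: \<phi>_def)
    have "real N / \<phi> \<le> L" using order_trans[OF ratio_totient_le_sqrt_ln[OF N(2)] elim(2)] by (simp add: \<phi>_def L_def)
    then have \<phi>N: "real N \<le> L * \<phi>" using \<phi>0 by (simp add: divide_le_eq)
    show ?case
    proof (intro allI impI)
      fix Q T q p \<tau> :: nat
      assume Q: "real Q \<le> sqrt N * exp (- 11 * (ln (ln N))\<^sup>2)" and T: "real T \<le> exp (C * ln (ln N))"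
        and v: "(q, p) \<in> fractions Q" and \<tau>: "3 \<le> \<tau>" "\<tau> \<le> T"
      have q: "1 \<le> q" "q \<le> Q" using v by (auto simp: fractions_def)
      obtain Y Z where YZ: "0 \<le> Y" "Z \<le> real N" "Z - Y = real N * interval_weight q / real \<tau>"
        and nr: "\<And>a. a \<in> totatives N \<Longrightarrow> near N q p \<tau> a \<longleftrightarrow> Y \<le> real a \<and> real a \<le> Z"
        using near_iff_interval[OF N(1) v \<tau>(1)] by blast
      define \<mu> where "\<mu> = interval_weight q"
      have \<mu>0: "\<mu> \<ge> 1 / (real q)\<^sup>2" "\<mu> \<ge> 0" using q by (auto simp: \<mu>_def interval_weight_def divide_right_mono)
      have "Y \<le> Z" using YZ(3) \<mu>0 by (simp add: \<mu>_def) (metis diff_ge_0_iff_ge divide_nonneg_nonneg mult_nonneg_nonneg of_nat_0_le_iff)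
      have card: "card {a\<in>totatives N. near N q p \<tau> a} = card {\<alpha>::int. Y \<le> \<alpha> \<and> \<alpha> \<le> Z \<and> coprime \<alpha> (int N)}"
        by (rule card_totatives_interval[OF N(1) nr YZ(1,2)])
      define m where "m = \<phi> * \<mu> / \<tau>"
      have m: "(Z - Y) * (\<phi> / real N) = m" unfolding YZ(3) m_def \<mu>_def using N by simp
      have "\<bar>real (card {\<alpha>::int. Y \<le> \<alpha> \<and> \<alpha> \<le> Z \<and> coprime \<alpha> (int N)}) - m\<bar> \<le> m / (2 * L) + exp (21 * l\<^sup>2)"
        using elim(1) \<open>Y \<le> Z\<close> unfolding m[symmetric] \<phi>_def L_def l_def by blast
      moreover have "exp (21 * l\<^sup>2) \<le> m / (2 * L)"
      proof -
        have "(real q)\<^sup>2 \<le> (sqrt N * exp (- 11 * l\<^sup>2))\<^sup>2" using q Q by (intro power_mono) (auto simp: l_def L_def)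
        also have "\<dots> = real N * exp (- 22 * l\<^sup>2)" by (simp add: power_mult_distrib exp_double[symmetric])
        finally have q2: "(real q)\<^sup>2 \<le> real N * exp (- 22 * l\<^sup>2)" .
        have "real \<tau> \<le> exp (C * l)" using \<tau> T by (simp add: l_def L_def)
        then have "2 * L * exp (21 * l\<^sup>2) * real \<tau> * (real q)\<^sup>2 \<le> 2 * L * exp (21 * l\<^sup>2) * exp (C * l) * (real N * exp (- 22 * l\<^sup>2))"
          using q2 L by (intro mult_mono) auto
        also have "\<dots> \<le> 2 * L * exp (21 * l\<^sup>2) * exp (C * l) * ((L * \<phi>) * exp (- 22 * l\<^sup>2))"
          using \<phi>N L by (intro mult_left_mono mult_right_mono) auto
        also have "\<dots> = 2 * exp (2 * l + C * l - l\<^sup>2) * \<phi>"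
          unfolding L(1) by (simp add: exp_add[symmetric] exp_diff mult_ac) (simp add: exp_add[symmetric] exp_minus[symmetric] field_simps)?
        also have "\<dots> \<le> 2 * (1 / 2) * \<phi>"
        proof (intro mult_right_mono mult_left_mono)
          have "C * l \<le> \<bar>C\<bar> * l" using l3 by (intro mult_right_mono) auto
          moreover have "(\<bar>C\<bar> + 3) * l \<le> l * l" using l3 by (intro mult_right_mono) auto
          ultimately have "2 * l + C * l - l\<^sup>2 \<le> - l" by (simp add: power2_eq_square algebra_simps)
          also have "- l \<le> - 1" using l3 by simp
          finally have "exp (2 * l + C * l - l\<^sup>2) \<le> exp (- 1)" by simp
          also have "\<dots> \<le> 1 / 2" using exp_ge_add_one_self[of 1] by (simp add: exp_minus field_simps)
          finally show "exp (2 * l + C * l - l\<^sup>2) \<le> 1 / 2" .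
        qed (use \<phi>0 in auto)
        finally have "2 * L * exp (21 * l\<^sup>2) * real \<tau> * (real q)\<^sup>2 \<le> \<phi>" by simp
        then have "2 * L * exp (21 * l\<^sup>2) * real \<tau> \<le> \<phi> * (1 / (real q)\<^sup>2)" using q by (simp add: le_divide_eq)
        also have "\<dots> \<le> \<phi> * \<mu>" using \<mu>0 \<phi>0 by (intro mult_left_mono) auto
        finally show ?thesis unfolding m_def using L \<tau> by (simp add: field_simps)
      qed
      ultimately show "\<bar>real (card {a\<in>totatives N. near N q p \<tau> a}) - real (totient N) * interval_weight q / \<tau>\<bar>
         \<le> 1 / ln N * (real (totient N) * interval_weight q / \<tau>)"
        unfolding card \<phi>_def[symmetric] \<mu>_def[symmetric] m_def[symmetric] L_def[symmetric] by (simp add: field_simps)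
    qed
  qed
qed

section \<open>The middle range, where both coordinates exceed Q\<close>

text \<open>With g = gcd q N, the residues q a mod N are multiples of g, and each is attained at
  most once in every block of N / g consecutive a, hence at most g times. Common factors of q and N
  thus do no harm.\<close>

lemma card_small_residues_le:
  fixes N q X :: nat
  assumes N: "N > 0"
  shows "card {a\<in>{1..<N}. q * a mod N \<in> {1..X}} \<le> X"
proof -
  define g where "g = gcd q N"
  have g0: "g > 0" using N by (simp add: g_def)
  define q1 N1 where "q1 = q div g" and "N1 = N div g"
  have q1: "q = g * q1" "N = g * N1" by (simp_all add: q1_def N1_def g_def)
  have cop: "coprime q1 N1" unfolding q1_def N1_def g_def using N by (intro div_gcd_coprime) auto
  have N10: "N1 > 0" using N q1 by auto
  let ?S = "{a\<in>{1..<N}. q * a mod N \<in> {1..X}}"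
  define f where "f a = (q * a mod N div g, a div N1)" for a
  have dvd: "g dvd q * a mod N" for a using q1 by (simp add: dvd_mod)
  have "inj_on f ?S"
  proof (rule inj_onI)
    fix a b assume ab: "a \<in> ?S" "b \<in> ?S" "f a = f b"
    have "q * a mod N = q * b mod N" using ab(3) dvd[of a] dvd[of b] unfolding f_def by (metis dvd_mult_div_cancel prod.inject)
    then have "[q1 * a = q1 * b] (mod N1)"
      unfolding q1(1,2) unique_euclidean_semiring_class.cong_def using g0 by (simp add: mult.assoc flip: mult_mod_right)
    then have "[a = b] (mod N1)" using cop by (simp add: cong_mult_lcancel_nat)
    then have "a mod N1 = b mod N1" unfolding unique_euclidean_semiring_class.cong_def .
    moreover have "a div N1 = b div N1" using ab(3) by (simp add: f_def)
    ultimately show "a = b" by (metis div_mult_mod_eq)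
  qed
  moreover have "f ` ?S \<subseteq> {1..X div g} \<times> {..<g}"
  proof (rule image_subsetI)
    fix a assume a: "a \<in> ?S"
    then have r: "1 \<le> q * a mod N" "q * a mod N \<le> X" "a < N" by auto
    have "q * a mod N div g \<ge> 1" using dvd[of a] r g0 by (auto simp: Suc_le_eq div_greater_zero_iff intro: dvd_imp_le)
    moreover have "q * a mod N div g \<le> X div g" using r by (intro div_le_mono)
    moreover have "a div N1 < g" using r(3) q1(2) by (simp add: less_mult_imp_div_less mult.commute)
    ultimately show "f a \<in> {1..X div g} \<times> {..<g}" by (simp add: f_def)
  qed
  ultimately have "card ?S \<le> card ({1..X div g} \<times> {..<g})" by (intro card_inj_on_le) auto
  also have "\<dots> = X div g * g" by simp
  also have "\<dots> \<le> X" by simp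
  finally show ?thesis .
qed

definition middle_triples :: "nat \<Rightarrow> nat \<Rightarrow> nat \<Rightarrow> nat \<Rightarrow> ((nat \<times> nat) \<times> nat) set" where
  "middle_triples N Q T a = {((q, m), \<tau>)\<in>quality_triples N a. Q < q \<and> Q < m \<and> \<tau> \<le> T}"

lemma sum_inverse_interval_le:
  assumes "1 \<le> Q" "Q \<le> M"
  shows "(\<Sum>q=Suc Q..M. 1 / real q) \<le> ln M - ln Q"
  using assms(2)
proof (induction M rule: dec_induct)
  case (step M)
  then show ?case using inverse_le_ln_diff[of "Suc M"] assms(1) by simp
qed simp

lemma middle_triples_first_moment:
  assumes N: "N \<ge> 2" and Q: "1 \<le> Q" "Q * Q \<le> N"
  shows "(\<Sum>a\<in>totatives N. real (card (middle_triples N Q T a))) \<le> 2 * real N * truncated_harmonic T * (ln N - 2 * ln Q)"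
proof -
  define X where "X q \<tau> = N div (\<tau> * q)" for q \<tau>
  define S where "S q \<tau> = {a\<in>{1..<N}. q * a mod N \<in> {1..X q \<tau>}}" for q \<tau>
  \<comment> \<open>These a belong to the negative sign, q a - p N = - m; the reflection of a to N -
    a carries them into \<open>S\<close>.\<close>
  define S' where "S' q \<tau> = {a\<in>{1..<N}. q * (N - a) mod N \<in> {1..X q \<tau>}}" for q \<tau>
  define I where "I = {Suc Q..N div Q} \<times> {3..T}"
  have finI: "finite I" by (simp add: I_def)
  have tot: "totatives N \<subseteq> {1..<N}"
  proof
    fix a assume a: "a \<in> totatives N"
    then have "a \<noteq> N" using N by (auto simp: in_totatives_iff)
    then show "a \<in> {1..<N}" using a by (auto simp: in_totatives_iff)
  qed
  have cS: "card (S q \<tau>) \<le> X q \<tau>" for q \<tau> unfolding S_def using N by (intro card_small_residues_le) simp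
  have cS': "card (S' q \<tau>) \<le> X q \<tau>" for q \<tau>
  proof -
    have "S' q \<tau> \<subseteq> (\<lambda>a. N - a) ` S q \<tau>"
    proof
      fix a assume a: "a \<in> S' q \<tau>"
      then have "a = N - (N - a)" "N - a \<in> S q \<tau>" by (auto simp: S_def S'_def)
      then show "a \<in> (\<lambda>a. N - a) ` S q \<tau>" by blast
    qed
    then have "card (S' q \<tau>) \<le> card ((\<lambda>a. N - a) ` S q \<tau>)" by (intro card_mono) (auto simp: S_def)
    also have "\<dots> \<le> card (S q \<tau>)" by (intro card_image_le) (auto simp: S_def)
    finally show ?thesis using cS[of q \<tau>] by simp
  qed
  have one: "real (card (middle_triples N Q T a)) \<le> (\<Sum>(q, \<tau>)\<in>I. of_bool (a \<in> S q \<tau>) + of_bool (a \<in> S' q \<tau>))"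
    if a: "a \<in> totatives N" for a
  proof -
    have aN: "1 \<le> a" "a < N" using tot a by auto
    define J J' where "J = {x\<in>I. a \<in> S (fst x) (snd x)}" and "J' = {x\<in>I. a \<in> S' (fst x) (snd x)}"
    define f f' where "f = (\<lambda>(q, \<tau>::nat). ((q, q * a mod N), \<tau>))" and "f' = (\<lambda>(q, \<tau>::nat). ((q, q * (N - a) mod N), \<tau>))"
    have finJ: "finite J" "finite J'" using finI by (auto simp: J_def J'_def intro: finite_subset[OF _ finI])
    have "middle_triples N Q T a \<subseteq> f ` J \<union> f' ` J'"
    proof
      fix x assume "x \<in> middle_triples N Q T a"
      then obtain q m \<tau> where x: "x = ((q, m), \<tau>)" and t: "3 \<le> \<tau>" "\<tau> \<le> T" "\<tau> * (q * m) \<le> N" "primitive_pair N a q m" "Q < q" "Q < m"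
        by (auto simp: middle_triples_def quality_triples_def)
      obtain p where p: "\<bar>int q * int a - p * int N\<bar> = int m" and pos: "q > 0" "m > 0"
        using t(4) unfolding primitive_pair_def by blast
      have "1 * (q * Q) \<le> \<tau> * (q * m)" using t by (intro mult_le_mono) auto
      then have "q * Q \<le> N" using t(3) by linarith
      then have "q \<le> N div Q" using Q by (simp add: less_eq_div_iff_mult_less_eq)
      then have I: "(q, \<tau>) \<in> I" using t by (simp add: I_def)
      have mX: "m \<le> X q \<tau>" using t pos by (simp add: X_def less_eq_div_iff_mult_less_eq mult_ac)
      have "3 * (1 * m) \<le> \<tau> * (q * m)" using t pos by (intro mult_le_mono) auto
      then have mN: "m < N" using t pos by linarith
      have "int q * int a - p * int N = int m \<or> p * int N - int q * int a = int m" using p by linarith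
      then show "x \<in> f ` J \<union> f' ` J'"
      proof
        assume "int q * int a - p * int N = int m"
        then have "int (q * a) mod int N = int m mod int N" by (metis diff_add_cancel mod_mult_self1 of_nat_mult add.commute mult.commute)
        then have "q * a mod N = m" using mN by (metis mod_less nat_int of_nat_mod)
        then have "(q, \<tau>) \<in> J" "x = f (q, \<tau>)" using I mX pos aN by (auto simp: J_def S_def f_def x)
        then show ?thesis by blast
      next
        assume e: "p * int N - int q * int a = int m"
        have "int (q * (N - a)) = int m + (int q - p) * int N" using e aN by (simp add: of_nat_diff algebra_simps)
        then have "int (q * (N - a)) mod int N = int m mod int N" by simp
        then have "q * (N - a) mod N = m" using mN by (metis mod_less nat_int of_nat_mod)
        then have "(q, \<tau>) \<in> J'" "x = f' (q, \<tau>)" using I mX pos aN by (auto simp: J'_def S'_def f'_def x)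
        then show ?thesis by blast
      qed
    qed
    then have "card (middle_triples N Q T a) \<le> card (f ` J \<union> f' ` J')" using finJ by (intro card_mono) auto
    also have "\<dots> \<le> card (f ` J) + card (f' ` J')" by (rule card_Un_le)
    also have "\<dots> \<le> card J + card J'" using finJ by (intro add_mono card_image_le)
    finally have "real (card (middle_triples N Q T a)) \<le> real (card J) + real (card J')" by linarith
    also have "real (card J) = (\<Sum>(q, \<tau>)\<in>I. of_bool (a \<in> S q \<tau>))"
      unfolding J_def sum_of_bool_card[OF finI, symmetric] by (simp add: case_prod_beta)
    also have "real (card J') = (\<Sum>(q, \<tau>)\<in>I. of_bool (a \<in> S' q \<tau>))"
      unfolding J'_def sum_of_bool_card[OF finI, symmetric] by (simp add: case_prod_beta)
    finally show ?thesis by (simp add: sum.distrib case_prod_beta)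
  qed
  have "(\<Sum>a\<in>totatives N. real (card (middle_triples N Q T a))) \<le> (\<Sum>a\<in>totatives N. \<Sum>(q, \<tau>)\<in>I. of_bool (a \<in> S q \<tau>) + of_bool (a \<in> S' q \<tau>))"
    by (intro sum_mono one)
  also have "\<dots> \<le> (\<Sum>a\<in>{1..<N}. \<Sum>(q, \<tau>)\<in>I. of_bool (a \<in> S q \<tau>) + of_bool (a \<in> S' q \<tau>))"
    using tot by (intro sum_mono2) (auto intro!: sum_nonneg)
  also have "\<dots> = (\<Sum>x\<in>I. \<Sum>a\<in>{1..<N}. case x of (q, \<tau>) \<Rightarrow> of_bool (a \<in> S q \<tau>) + of_bool (a \<in> S' q \<tau>))"
    by (rule sum.swap)
  also have "\<dots> \<le> (\<Sum>(q, \<tau>)\<in>I. 2 * real N * (1 / real \<tau> * (1 / real q)))"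
  proof (rule sum_mono)
    fix x assume "x \<in> I"
    obtain q \<tau> where x: "x = (q, \<tau>)" by (cases x)
    have "(\<Sum>a\<in>{1..<N}. of_bool (a \<in> S q \<tau>) + of_bool (a \<in> S' q \<tau>) :: real) = real (card {a\<in>{1..<N}. a \<in> S q \<tau>}) + real (card {a\<in>{1..<N}. a \<in> S' q \<tau>})"
      by (simp only: sum.distrib sum_of_bool_card[OF finite_atLeastLessThan])
    also have "{a\<in>{1..<N}. a \<in> S q \<tau>} = S q \<tau>" by (auto simp: S_def)
    also have "{a\<in>{1..<N}. a \<in> S' q \<tau>} = S' q \<tau>" by (auto simp: S'_def)
    also have "real (card (S q \<tau>)) + real (card (S' q \<tau>)) \<le> real (X q \<tau>) + real (X q \<tau>)" using cS[of q \<tau>] cS'[of q \<tau>] by simp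
    also have "\<dots> \<le> 2 * (real N / real (\<tau> * q))" unfolding X_def using of_nat_div_le_of_nat[where 'a=real, of N "\<tau> * q"] by simp
    also have "\<dots> = 2 * real N * (1 / real \<tau> * (1 / real q))" by simp
    finally show "(\<Sum>a\<in>{1..<N}. case x of (q, \<tau>) \<Rightarrow> of_bool (a \<in> S q \<tau>) + of_bool (a \<in> S' q \<tau>)) \<le> (case x of (q, \<tau>) \<Rightarrow> 2 * real N * (1 / real \<tau> * (1 / real q)))"
      unfolding x by simp
  qed
  also have "\<dots> = 2 * real N * ((\<Sum>q=Suc Q..N div Q. 1 / real q) * truncated_harmonic T)"
  proof -
    have "(\<Sum>(q, \<tau>)\<in>I. 2 * real N * (1 / real \<tau> * (1 / real q))) = (\<Sum>q=Suc Q..N div Q. \<Sum>\<tau>=3..T. 2 * real N * (1 / real q * (1 / real \<tau>)))"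
      unfolding I_def by (subst sum.cartesian_product[symmetric]) (simp only: mult.commute)
    also have "\<dots> = 2 * real N * ((\<Sum>q=Suc Q..N div Q. 1 / real q) * truncated_harmonic T)"
      unfolding truncated_harmonic_def sum_product by (simp only: sum_distrib_left)
    finally show ?thesis .
  qed
  also have "\<dots> \<le> 2 * real N * ((ln N - 2 * ln Q) * truncated_harmonic T)"
  proof (intro mult_left_mono mult_right_mono)
    have QN: "Q \<le> N div Q" using Q by (simp add: less_eq_div_iff_mult_less_eq)
    have "(\<Sum>q=Suc Q..N div Q. 1 / real q) \<le> ln (real (N div Q)) - ln Q" by (rule sum_inverse_interval_le[OF Q(1) QN])
    also have "ln (real (N div Q)) \<le> ln N - ln Q" using Q QN by (intro ln_div_bounds(1)) (auto intro: order_trans[OF _ div_le_dividend])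
    finally show "(\<Sum>q=Suc Q..N div Q. 1 / real q) \<le> ln N - 2 * ln Q" by simp
  qed (auto simp: truncated_harmonic_def sum_nonneg)
  finally show ?thesis by (simp add: mult_ac)
qed

section \<open>Concentration\<close>

lemma less_of_totatives: "N \<ge> 2 \<Longrightarrow> a \<in> totatives N \<Longrightarrow> a < N"
  by (metis in_totatives_iff coprime_self le_neq_implies_less nat_dvd_1_iff_1 not_numeral_le_zero numeral_le_one_iff semiring_norm(69) One_nat_def)

lemma near_iff_nat: "near N q p \<tau> a \<longleftrightarrow> \<tau> * (q * nat \<bar>int q * int a - int p * int N\<bar>) \<le> N"
proof -
  define m where "m = nat \<bar>int q * int a - int p * int N\<bar>"
  have "\<bar>real q * real a - real p * real N\<bar> = real m" by (simp add: m_def)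
  then have "near N q p \<tau> a \<longleftrightarrow> real \<tau> * real q * real m \<le> real N" by (simp only: near_def)
  also have "\<dots> \<longleftrightarrow> real (\<tau> * (q * m)) \<le> real N" by (simp add: mult.assoc)
  also have "\<dots> \<longleftrightarrow> \<tau> * (q * m) \<le> N" by (rule of_nat_le_iff)
  finally show ?thesis unfolding m_def .
qed

text \<open>m < N and a \<le> N leave no room for a numerator outside of 0, ..., q.\<close>

lemma near_of_quality_triple:
  assumes a: "a \<le> N" and x: "((q, m), \<tau>) \<in> quality_triples N a" and Q: "q \<le> Q"
  shows "\<exists>k. (q, k) \<in> fractions Q \<and> near N q k \<tau> a \<and> nat \<bar>int q * int a - int k * int N\<bar> = m"
proof -
  have t: "3 \<le> \<tau>" "\<tau> * (q * m) \<le> N" "primitive_pair N a q m" using x by (auto simp: quality_triples_def)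
  obtain p where p: "coprime p (int q)" "\<bar>int q * int a - p * int N\<bar> = int m" and pos: "q > 0" "m > 0"
    using t(3) unfolding primitive_pair_def by blast
  have "3 * (1 * m) \<le> \<tau> * (q * m)" using t pos by (intro mult_le_mono) auto
  then have mN: "int m < int N" using t pos by linarith
  have "p \<ge> 0"
  proof (rule ccontr)
    assume "\<not> p \<ge> 0"
    then have "p * int N \<le> (-1) * int N" by (intro mult_right_mono) auto
    then have "int q * int a - p * int N \<ge> int N" using mult_nonneg_nonneg[of "int q" "int a"] by linarith
    then show False using p(2) mN by linarith
  qed
  then obtain k where k: "p = int k" using nonneg_int_cases by blast
  have "k \<le> q"
  proof (rule ccontr)
    assume "\<not> k \<le> q"
    then have "(int q + 1) * int N \<le> int k * int N" by (intro mult_right_mono) auto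
    moreover have "int q * int a \<le> int q * int N" using a by (intro mult_left_mono) auto
    ultimately have "p * int N - int q * int a \<ge> int N" unfolding k by (simp add: algebra_simps)
    then show False using p(2) mN by linarith
  qed
  have m: "nat \<bar>int q * int a - int k * int N\<bar> = m" using p(2) k by simp
  have "(q, k) \<in> fractions Q" using Q pos p \<open>k \<le> q\<close> k by (simp add: fractions_def)
  moreover have "near N q k \<tau> a" unfolding near_iff_nat m using t(2) .
  ultimately show ?thesis using m by blast
qed

text \<open>The bijection sends p to m = |q a - p N|. It is injective by
  \<open>near_same_denominator\<close>, and m > 0 because Q < N keeps N from dividing q.\<close>

lemma near_count_eq_card:
  assumes N: "N \<ge> 2" and a: "a \<in> totatives N" and Q: "Q < N"
  shows "near_count N Q T a = real (card {((q, m), \<tau>)\<in>quality_triples N a. q \<le> Q \<and> \<tau> \<le> T})"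
proof -
  have aN: "0 < a" "a < N" "coprime a N" using a less_of_totatives[OF N a] by (auto simp: in_totatives_iff)
  define A where "A = {x\<in>fractions Q \<times> {3..T}. near N (fst (fst x)) (snd (fst x)) (snd x) a}"
  define g where "g = (\<lambda>((q, p), \<tau>::nat). ((q, nat \<bar>int q * int a - int p * int N\<bar>), \<tau>))"
  have "near_count N Q T a = (\<Sum>x\<in>fractions Q \<times> {3..T}. of_bool (near N (fst (fst x)) (snd (fst x)) (snd x) a))"
    unfolding near_count_def case_prod_beta sum.cartesian_product by (rule refl)
  also have "\<dots> = real (card A)" unfolding A_def by (rule sum_of_bool_card) simp
  finally have 1: "near_count N Q T a = real (card A)" .
  have "bij_betw g A {((q, m), \<tau>)\<in>quality_triples N a. q \<le> Q \<and> \<tau> \<le> T}"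
    unfolding bij_betw_def
  proof
    show "inj_on g A"
    proof (rule inj_onI)
      fix x y assume xy: "x \<in> A" "y \<in> A" "g x = g y"
      obtain q p \<tau> where x: "x = ((q, p), \<tau>)" by (cases x) auto
      obtain q' p' \<tau>' where y: "y = ((q', p'), \<tau>')" by (cases y) auto
      have e: "q' = q" "\<tau>' = \<tau>" using xy(3) by (auto simp: x y g_def)
      have "near N q p \<tau> a" "near N q p' \<tau> a" "1 \<le> q" "3 \<le> \<tau>" using xy(1,2) by (auto simp: A_def x y e fractions_def)
      then have "p = p'" using near_same_denominator N by (metis order_less_le_trans pos2)
      then show "x = y" by (simp add: x y e)
    qed
    show "g ` A = {((q, m), \<tau>)\<in>quality_triples N a. q \<le> Q \<and> \<tau> \<le> T}"
    proof (intro equalityI subsetI)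
      fix z assume "z \<in> g ` A"
      then obtain x where x': "x \<in> A" "z = g x" by blast
      obtain q p \<tau> where x: "x = ((q, p), \<tau>)" by (cases x) auto
      have t: "3 \<le> \<tau>" "\<tau> \<le> T" "1 \<le> q" "q \<le> Q" "coprime p q" "near N q p \<tau> a"
        using x' by (auto simp: A_def x fractions_def)
      define m where "m = nat \<bar>int q * int a - int p * int N\<bar>"
      have "int q * int a - int p * int N \<noteq> 0"
      proof
        assume "int q * int a - int p * int N = 0"
        then have "q * a = p * N" by (simp flip: of_nat_mult)
        then have "N dvd q * a" by simp
        then have "N dvd q" using aN by (simp add: coprime_commute coprime_dvd_mult_left_iff)
        then show False using t Q by (auto dest: dvd_imp_le)
      qed
      then have m: "m > 0" "\<bar>int q * int a - int p * int N\<bar> = int m" by (auto simp: m_def)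
      have "primitive_pair N a q m" unfolding primitive_pair_def using m t by (auto intro!: exI[of _ "int p"])
      moreover have "\<tau> * (q * m) \<le> N" using t near_iff_nat unfolding m_def by blast
      ultimately show "z \<in> {((q, m), \<tau>)\<in>quality_triples N a. q \<le> Q \<and> \<tau> \<le> T}"
        using t by (simp add: x'(2) x g_def quality_triples_def m_def)
    next
      fix z assume "z \<in> {((q, m), \<tau>)\<in>quality_triples N a. q \<le> Q \<and> \<tau> \<le> T}"
      then obtain q m \<tau> where z: "z = ((q, m), \<tau>)" and t: "\<tau> \<le> T" "q \<le> Q" "((q, m), \<tau>) \<in> quality_triples N a"
        by auto
      obtain k where k: "(q, k) \<in> fractions Q" "near N q k \<tau> a" "nat \<bar>int q * int a - int k * int N\<bar> = m"
        using near_of_quality_triple[OF less_imp_le[OF aN(2)] t(3,2)] by blast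
      have "((q, k), \<tau>) \<in> A" using t k by (simp add: A_def quality_triples_def)
      moreover have "g ((q, k), \<tau>) = z" by (simp add: g_def z k)
      ultimately show "z \<in> g ` A" by (metis imageI)
    qed
  qed
  then show ?thesis using 1 bij_betw_same_card by fastforce
qed

lemma card_quality_triples_swap:
  assumes "int a * int b = 1 + j * int N"
  shows "card {((q, m), \<tau>)\<in>quality_triples N a. m \<le> Q \<and> \<tau> \<le> T} = card {((q, m), \<tau>)\<in>quality_triples N b. q \<le> Q \<and> \<tau> \<le> T}"
proof (rule bij_betw_same_card)
  have ab: "primitive_pair N b m q" if "primitive_pair N a q m" for q m using primitive_pair_swap[OF assms that] .
  have ba: "primitive_pair N a m q" if "primitive_pair N b q m" for q m
    using primitive_pair_swap[of b a j N q m] assms that by (simp add: mult.commute)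
  show "bij_betw (\<lambda>((q, m), \<tau>). ((m, q), \<tau>)) {((q, m), \<tau>)\<in>quality_triples N a. m \<le> Q \<and> \<tau> \<le> T} {((q, m), \<tau>)\<in>quality_triples N b. q \<le> Q \<and> \<tau> \<le> T}"
    by (rule bij_betw_byWitness[where f'="\<lambda>((q, m), \<tau>). ((m, q), \<tau>)"])
       (auto simp: quality_triples_def mult.commute[of _ "_::nat"] dest: ab ba)
qed

text \<open>The levels admissible for a pair form an initial segment from 3 on, so excluding level T
  + 1 bounds them all by T. It also excludes q \<le> Q and m \<le> Q together, since then (T + 1) q
  m \<le> N; this makes the two halves disjoint.\<close>

lemma card_quality_triples_decomposition:
  assumes N: "N \<ge> 2" and a: "a \<in> totatives N" "b \<in> totatives N" "int a * int b = 1 + j * int N"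
    and Q: "Q < N" "(T + 1) * (Q * Q) \<le> N" and T: "T \<ge> 2"
    and small: "\<And>q m. ((q, m), T + 1) \<notin> quality_triples N a"
  shows "real (card (quality_triples N a)) = near_count N Q T a + near_count N Q T b + real (card (middle_triples N Q T a))"
proof -
  have fin: "finite (quality_triples N a)"
    using a less_of_totatives[OF N a(1)] by (intro sum_partial_quotients_quality_triples(2)) (auto simp: in_totatives_iff)
  have le: "\<tau> \<le> T" if "((q, m), \<tau>) \<in> quality_triples N a" for q m \<tau>
  proof (rule ccontr)
    assume "\<not> \<tau> \<le> T"
    then have "(T + 1) * (q * m) \<le> \<tau> * (q * m)" by (intro mult_le_mono1) simp
    then have "((q, m), T + 1) \<in> quality_triples N a" using that T by (simp add: quality_triples_def)
    then show False using small by blast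
  qed
  define A B where "A = {((q, m), \<tau>)\<in>quality_triples N a. q \<le> Q \<and> \<tau> \<le> T}" and "B = {((q, m), \<tau>)\<in>quality_triples N a. m \<le> Q \<and> \<tau> \<le> T}"
  have disj: "A \<inter> B = {}"
  proof -
    have False if "((q, m), \<tau>) \<in> quality_triples N a" "q \<le> Q" "m \<le> Q" for q m \<tau>
    proof -
      have "(T + 1) * (q * m) \<le> (T + 1) * (Q * Q)" using that by (intro mult_le_mono2 mult_le_mono)
      then have "((q, m), T + 1) \<in> quality_triples N a" using that Q T by (simp add: quality_triples_def)
      then show False using small by blast
    qed
    then show ?thesis by (auto simp: A_def B_def)
  qed
  have un: "quality_triples N a = (A \<union> B) \<union> middle_triples N Q T a"
    using le by (auto simp: A_def B_def middle_triples_def)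
  have finAB: "finite A" "finite B" "finite (middle_triples N Q T a)"
    by (rule finite_subset[OF _ fin], auto simp: A_def B_def middle_triples_def)+
  have "card (quality_triples N a) = card (A \<union> B) + card (middle_triples N Q T a)"
    unfolding un using finAB by (intro card_Un_disjoint) (auto simp: A_def B_def middle_triples_def)
  also have "card (A \<union> B) = card A + card B" using finAB disj by (intro card_Un_disjoint)
  finally have "real (card (quality_triples N a)) = real (card A) + real (card B) + real (card (middle_triples N Q T a))" by simp
  then show ?thesis
    unfolding A_def B_def card_quality_triples_swap[OF a(3)] near_count_eq_card[OF N a(1) Q(1)] near_count_eq_card[OF N a(2) Q(1)] .
qed

text \<open>Injectivity is what transfers bounds for exceptional sets from a to its inverse.\<close>

lemma totatives_inverse_exists:
  assumes N: "N \<ge> 2"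
  shows "\<exists>f. inj_on f (totatives N) \<and> f ` totatives N \<subseteq> totatives N \<and>
    (\<forall>a\<in>totatives N. \<exists>j. int a * int (f a) = 1 + j * int N)"
proof -
  have "\<exists>b. b \<in> totatives N \<and> (\<exists>j. int a * int b = 1 + j * int N)" if a: "a \<in> totatives N" for a
  proof -
    obtain u v :: int where uv: "u * int a + v * int N = gcd (int a) (int N)" using bezout_int by blast
    have "gcd (int a) (int N) = 1" using a by (simp add: in_totatives_iff flip: coprime_iff_gcd_eq_1)
    then have u: "u * int a + v * int N = 1" using uv by simp
    define b where "b = nat (u mod int N)"
    have b: "int b = u mod int N" "b < N" using N by (auto simp: b_def nat_less_iff)
    have "int b = u - (u div int N) * int N" using b by (simp add: minus_div_mult_eq_mod)
    then have "int a * int b = 1 + (- v - int a * (u div int N)) * int N" 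
    proof -
      have "int a * int b = (u * int a + v * int N) + (- v - int a * (u div int N)) * int N"
        unfolding \<open>int b = u - (u div int N) * int N\<close> by (simp add: algebra_simps)
      then show ?thesis unfolding u .
    qed
    then obtain j where j: "int a * int b = 1 + j * int N" by blast
    have cop: "coprime (int b) (int N)"
    proof (rule coprimeI)
      fix d assume "d dvd int b" "d dvd int N"
      then have "d dvd int a * int b - j * int N" by simp
      then show "is_unit d" unfolding j by simp
    qed
    have "b \<noteq> 0" using j N
      by (metis add.commute add_cancel_right_left dvd_def mult.commute mult_zero_right of_nat_0 one_dvd zdvd1_eq add_eq_0_iff dvd_minus_iff abs_of_nat of_nat_eq_1_iff not_less_eq_eq numeral_2_eq_2 le_refl One_nat_def)
    then have "b \<in> totatives N" using b(2) cop unfolding in_totatives_iff coprime_int_iff by simp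
    then show ?thesis using j by blast
  qed
  then obtain f where f: "\<And>a. a \<in> totatives N \<Longrightarrow> f a \<in> totatives N \<and> (\<exists>j. int a * int (f a) = 1 + j * int N)" by metis
  have "inj_on f (totatives N)"
  proof (rule inj_onI)
    fix a c assume ac: "a \<in> totatives N" "c \<in> totatives N" "f a = f c"
    obtain j where j: "int a * int (f a) = 1 + j * int N" using f[OF ac(1)] by blast
    obtain k where k: "int c * int (f a) = 1 + k * int N" using f[OF ac(2)] ac(3) by auto
    have "int a - int c = int a * (int c * int (f a) - k * int N) - int c * (int a * int (f a) - j * int N)" unfolding j k by simp
    also have "\<dots> = int N * (int c * j - int a * k)" by (simp add: algebra_simps)
    finally have "int N dvd int a - int c" by simp
    moreover have "\<bar>int a - int c\<bar> < int N" using less_of_totatives[OF N ac(1)] less_of_totatives[OF N ac(2)] by linarith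
    ultimately have "int a - int c = 0" using zdvd_imp_le[of "int N" "\<bar>int a - int c\<bar>"] by (cases "int a = int c") auto
    then show "a = c" by simp
  qed
  then show ?thesis using f by blast
qed

lemma truncated_harmonic_bounds:
  assumes "T \<ge> 3"
  shows "ln T - 3/2 \<le> truncated_harmonic T" "truncated_harmonic T \<le> ln T"
proof -
  have "{1..T} = {1, 2} \<union> {3..T}" using assms by auto
  then have "(\<Sum>k=1..T. 1 / real k) = 3/2 + truncated_harmonic T"
    unfolding truncated_harmonic_def by (simp add: sum.union_disjoint)
  then show "ln T - 3/2 \<le> truncated_harmonic T" "truncated_harmonic T \<le> ln T"
    using harmonic_sum_bounds[of T] assms by simp_all
qed

lemma card_le_sum_div:
  fixes f :: "'a \<Rightarrow> real"
  assumes "finite A" "\<And>x. x \<in> A \<Longrightarrow> f x \<ge> 0" "c > 0"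
  shows "real (card {x\<in>A. f x \<ge> c}) \<le> sum f A / c"
proof -
  have "c * real (card {x\<in>A. f x \<ge> c}) = (\<Sum>x\<in>{x\<in>A. f x \<ge> c}. c)" by simp
  also have "\<dots> \<le> (\<Sum>x\<in>{x\<in>A. f x \<ge> c}. f x)" by (intro sum_mono) auto
  also have "\<dots> \<le> sum f A" using assms by (intro sum_mono2) auto
  finally show ?thesis using assms by (simp add: field_simps)
qed

lemma card_preimage_le:
  assumes "inj_on f A" "X \<subseteq> A" "finite A"
  shows "card {a\<in>A. f a \<in> X} \<le> card X"
  using assms by (intro card_inj_on_le[of f]) (auto intro: inj_on_subset finite_subset)

lemma eventually_ln_ln:
  assumes "\<forall>\<^sub>F x in at_top. P x"
  shows "\<forall>\<^sub>F N in at_top. P (ln (ln (real N)))"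
proof -
  have "filterlim (\<lambda>N. ln (ln (real N))) at_top at_top" by real_asymp
  then show ?thesis using assms by (rule eventually_compose_filterlim[rotated])
qed

text \<open>Exceptional are \<open>E1\<close> (large deviation of the count), \<open>B1\<close> (a
  fraction with q \<le> Q near at level T + 1), their preimages under inversion modulo N, and
  \<open>B3\<close> (many middle triples). Each has O(totient N / t) elements. Elsewhere the number
  of triples is 2 h \<Phi> + O(t L) = c L ln L + O(t L).\<close>

lemma concentration_large_N:
  fixes C :: real
  assumes C: "C > 0"
  shows "\<exists>K\<ge>1. \<forall>\<^sub>F N in at_top. \<forall>t\<ge>1. t \<le> ln (real N) powr C \<longrightarrow>
    real (card {a\<in>totatives N. \<bar>real (sum_partial_quotients (real a / real N)) - 12 / pi\<^sup>2 * ln (real N) * ln (ln (real N))\<bar> \<ge> K * t * ln (real N)})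
      \<le> K * real (totient N) / t"
proof -
  obtain K1 where K10: "K1 \<ge> 0" and K1': "\<forall>N Q T \<epsilon>. N \<ge> 2 \<longrightarrow> Q \<ge> 1 \<longrightarrow> 0 \<le> \<epsilon> \<longrightarrow> \<epsilon> \<le> 1 \<longrightarrow>
     (\<forall>q p \<tau>. (q, p) \<in> fractions Q \<longrightarrow> 3 \<le> \<tau> \<longrightarrow> \<tau> \<le> T \<longrightarrow>
       \<bar>real (card {a\<in>totatives N. near N q p \<tau> a}) - real (totient N) * interval_weight q / \<tau>\<bar>
         \<le> \<epsilon> * (real (totient N) * interval_weight q / \<tau>)) \<longrightarrow>
     (\<Sum>a\<in>totatives N. (near_count N Q T a - truncated_harmonic T * totient_sum Q)\<^sup>2)
       \<le> real (totient N) * (4 * real T * totient_sum Q + K1 * (truncated_harmonic T)\<^sup>2 * totient_sum Q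
            + 3 * \<epsilon> * (truncated_harmonic T * totient_sum Q)\<^sup>2)"
    using near_count_second_moment by (elim exE conjE) (rule that)
  obtain K2 where K20: "K2 \<ge> 0" and K2: "\<forall>n\<ge>1. \<bar>totient_sum n - 12 / pi\<^sup>2 * ln n\<bar> \<le> K2"
    using totient_sum_asymptotic by (elim exE conjE) (rule that)
  define c where "c = 12 / pi\<^sup>2"
  have "pi\<^sup>2 \<ge> 2\<^sup>2" using pi_ge_two by (intro power_mono) auto
  then have c: "c > 0" "c \<le> 3" by (auto simp: c_def field_simps)
  \<comment> \<open>233 + 32 K1 is needed for the number of exceptions and 26 for the
    deviation.\<close>
  define K where "K = 300 + 32 * K1"
  \<comment> \<open>\<open>f2\<close> absorbs the error of replacing \<Phi> by c L / 2, which is of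
    order (ln L)^2, times 2 h. Similarly \<open>f7\<close> absorbs the mean number of middle
    triples.\<close>
  have f2: "\<forall>\<^sub>F N in at_top. 2 * (ln (ln (real N)) + 4) * (K2 + 33 * (ln (ln (real N)))\<^sup>2 + 3) \<le> exp (ln (ln (real N)))"
    by (rule eventually_ln_ln) real_asymp
  have f3: "\<forall>\<^sub>F N in at_top. sqrt (real N) * exp (- 11 * (ln (ln (real N)))\<^sup>2) \<ge> 2" by real_asymp
  have f4: "\<forall>\<^sub>F N in at_top. ln (real N) \<ge> 2 * K2 + 3"
  proof -
    have "filterlim (\<lambda>N. ln (real N)) at_top at_top" by real_asymp
    then show ?thesis by (simp add: filterlim_at_top)
  qed
  have f6: "\<forall>\<^sub>F N in at_top. ln (ln (real N)) \<ge> C + 2"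
    by (rule eventually_ln_ln) (rule eventually_ge_at_top)
  have f7: "\<forall>\<^sub>F N in at_top. 4 * (2 * sqrt (4 * exp (ln (ln (real N))) + 1)) * ((C + 2) * ln (ln (real N)) * (22 * (ln (ln (real N)))\<^sup>2 + 2)) \<le> exp (ln (ln (real N)))"
    by (rule eventually_ln_ln) (use C in real_asymp)
  show ?thesis
  proof (intro exI[of _ K] conjI)
    show "1 \<le> K" using K10 by (simp add: K_def)
    show "\<forall>\<^sub>F N in at_top. \<forall>t\<ge>1. t \<le> ln (real N) powr C \<longrightarrow>
      real (card {a\<in>totatives N. \<bar>real (sum_partial_quotients (real a / real N)) - 12 / pi\<^sup>2 * ln (real N) * ln (ln (real N))\<bar> \<ge> K * t * ln (real N)})
      \<le> K * real (totient N) / t"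
      \<comment> \<open>The exponent is C + 2 because T + 1 \<le> 2 t L \<le> L^(C + 2).\<close>
      using near_equidistribution[of "C + 2"] f2 f3 f4 f6 f7 eventually_ge_at_top[of 3]
    proof eventually_elim
      case (elim N)
      define L where "L = ln (real N)"
      define l where "l = ln L"
      have N: "N \<ge> 2" "N > 0" "real N > 0" using elim(7) by auto
      have L3: "L \<ge> 3" and L2: "L \<ge> 2 * K2" using elim(4) K20 by (auto simp: L_def)
      have Le: "L = exp l" using L3 by (simp add: l_def)
      have lC: "l \<ge> C + 2" using elim(5) by (simp add: l_def L_def)
      then have l1: "l \<ge> 1" using C by simp
      have g2: "2 * (l + 4) * (K2 + 33 * l\<^sup>2 + 3) \<le> L" using elim(2) unfolding l_def[symmetric] L_def[symmetric] Le[symmetric] by (simp only: L_def[symmetric] l_def[symmetric] Le[symmetric])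
      have g7: "4 * (2 * sqrt (4 * L + 1)) * ((C + 2) * l * (22 * l\<^sup>2 + 2)) \<le> L" using elim(6) by (simp only: L_def[symmetric] l_def[symmetric] Le[symmetric])
      define x where "x = sqrt (real N) * exp (- 11 * l\<^sup>2)"
      have x2: "x \<ge> 2" using elim(3) by (simp add: x_def l_def L_def)
      define Q where "Q = nat \<lfloor>x\<rfloor>"
      have Qx: "real Q \<le> x" "real Q \<ge> x / 2" using x2 unfolding Q_def by linarith+
      have Q1: "Q \<ge> 1" using Qx x2 by linarith
      have lnx: "ln x = L / 2 - 11 * l\<^sup>2" using N by (simp add: x_def ln_mult ln_sqrt L_def)
      have lnQ: "ln Q \<le> L / 2 - 11 * l\<^sup>2" "ln Q \<ge> L / 2 - 11 * l\<^sup>2 - 1"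
      proof -
        have "ln Q \<le> ln x" using Qx Q1 by (subst ln_le_cancel_iff) auto
        then show "ln Q \<le> L / 2 - 11 * l\<^sup>2" using lnx by simp
        have "ln (x / 2) \<le> ln Q" using Qx Q1 x2 by (subst ln_le_cancel_iff) auto
        moreover have "ln (x / 2) = ln x - ln 2" using x2 by (simp add: ln_div)
        moreover have "ln 2 \<le> (1::real)" using ln_le_minus_one[of 2] by simp
        ultimately show "ln Q \<ge> L / 2 - 11 * l\<^sup>2 - 1" using lnx by linarith
      qed
      have lnQ_half: "ln Q \<le> L / 2" using lnQ(1) zero_le_power2[of l] by linarith
      define \<phi> where "\<phi> = real (totient N)"
      define \<Phi> where "\<Phi> = totient_sum Q"
      have \<phi>0: "\<phi> > 0" using N by (simp add: \<phi>_def)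
      have N\<phi>: "real N \<le> 2 * sqrt (4 * L + 1) * \<phi>"
        using ratio_totient_le_sqrt_ln[OF N(2)] \<phi>0 by (simp add: \<phi>_def L_def divide_le_eq)
      have \<Phi>c: "\<bar>\<Phi> - c * ln Q\<bar> \<le> K2" using K2 Q1 by (simp add: \<Phi>_def c_def)
      have \<Phi>0: "\<Phi> \<ge> 2" unfolding \<Phi>_def by (rule totient_sum_ge_2[OF Q1])
      have \<Phi>2L: "\<Phi> \<le> 2 * L"
      proof -
        have "c * ln Q \<le> 3 * (L / 2)" using c Q1 lnQ_half by (intro mult_mono) auto
        then show ?thesis using \<Phi>c L2 by linarith
      qed
      have \<Phi>L: "\<bar>\<Phi> - c * (L / 2)\<bar> \<le> K2 + 33 * l\<^sup>2 + 3"
      proof -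
        have "c * (L / 2 - ln Q) \<le> 3 * (11 * l\<^sup>2 + 1)" using c lnQ lnQ_half by (intro mult_mono) auto
        moreover have "c * (L / 2 - ln Q) \<ge> 0" using c lnQ_half by simp
        moreover have "\<Phi> - c * (L / 2) = (\<Phi> - c * ln Q) - c * (L / 2 - ln Q)" by (simp add: right_diff_distrib)
        moreover have "\<bar>(\<Phi> - c * ln Q) - c * (L / 2 - ln Q)\<bar> \<le> \<bar>\<Phi> - c * ln Q\<bar> + \<bar>c * (L / 2 - ln Q)\<bar>"
          by (rule abs_triangle_ineq4)
        ultimately show ?thesis using \<Phi>c by simp
      qed
      obtain f where f: "inj_on f (totatives N)" "f ` totatives N \<subseteq> totatives N"
        "\<forall>a\<in>totatives N. \<exists>j. int a * int (f a) = 1 + j * int N"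
        using totatives_inverse_exists[OF N(1)] by blast
      have NQ2: "(real Q)\<^sup>2 \<le> real N * exp (- 22 * l\<^sup>2)"
      proof -
        have "(real Q)\<^sup>2 \<le> x\<^sup>2" using Qx by (intro power_mono) auto
        also have "\<dots> = real N * exp (- 22 * l\<^sup>2)" by (simp add: x_def power_mult_distrib exp_double[symmetric])
        finally show ?thesis .
      qed
      show ?case
      proof (intro allI impI)
        fix t :: real assume t: "1 \<le> t" "t \<le> ln (real N) powr C"
        define T where "T = nat \<lceil>t * L\<rceil>"
        have "1 * 3 \<le> t * L" using t L3 by (intro mult_mono) auto
        then have tL: "t * L \<ge> 3" by simp
        have Lle: "L \<le> t * L" using t L3 by simp
        have Tb: "real T \<ge> t * L" "real T \<le> t * L + 1" using tL unfolding T_def by linarith+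
        have T3: "T \<ge> 3" using Tb tL by linarith
        have T2: "real T \<le> 2 * (t * L)" using Tb tL by linarith
        define h where "h = truncated_harmonic T"
        have lnT: "ln T \<ge> ln t + l" "ln T \<le> ln t + l + 1"
        proof -
          have e: "ln (t * L) = ln t + l" using t L3 by (simp add: ln_mult l_def)
          have "ln (t * L) \<le> ln T" using Tb tL by (subst ln_le_cancel_iff) auto
          then show "ln T \<ge> ln t + l" using e by simp
          have "ln T \<le> ln (2 * (t * L))" using T2 T3 tL by (subst ln_le_cancel_iff) auto
          also have "\<dots> = ln 2 + ln (t * L)" using tL by (subst ln_mult_pos) auto
          finally show "ln T \<le> ln t + l + 1" using e ln_le_minus_one[of "2::real"] by simp
        qed
        have lnt: "0 \<le> ln t" "ln t \<le> t" using t ln_le_minus_one[of t] by auto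
        have hb: "ln T - 3/2 \<le> h" "h \<le> ln T" unfolding h_def using truncated_harmonic_bounds[OF T3] by auto
        have h0: "h \<ge> 0" by (simp add: h_def truncated_harmonic_def sum_nonneg)
        have hl: "\<bar>h - l\<bar> \<le> 4 * t" using hb lnT lnt t by linarith
        \<comment> \<open>Although h is only logarithmic in T, h^2 = O(T) suffices: it brings the
          terms h^2 \<Phi> and (h \<Phi>)^2 / L of the second moment down to the order T L of the
          diagonal.\<close>
        have h2: "h\<^sup>2 \<le> 8 * (t * L)"
        proof -
          have "ln T = 2 * ln (sqrt T)" using T3 by (simp add: ln_sqrt)
          also have "\<dots> \<le> 2 * sqrt T" using T3 ln_le_minus_one[of "sqrt T"] by simp
          finally have "h \<le> 2 * sqrt T" using hb by simp
          then have "h\<^sup>2 \<le> (2 * sqrt T)\<^sup>2" using h0 by (intro power_mono)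
          then show ?thesis using T2 by (simp add: power_mult_distrib)
        qed
        have tC: "t \<le> exp (C * l)" using t(2) L3 by (simp add: powr_def L_def l_def)
        have T1: "real (T + 1) \<le> exp ((C + 2) * l)"
        proof -
          have "real (T + 1) \<le> 2 * (t * L)" using Tb tL by simp
          also have "\<dots> = t * (2 * L)" by simp
          also have "\<dots> \<le> exp (C * l) * (L * L)" using tC L3 t by (intro mult_mono) auto
          also have "\<dots> = exp ((C + 2) * l)" unfolding Le by (simp add: exp_add[symmetric] algebra_simps)
          finally show ?thesis .
        qed
        have TQ: "(T + 1) * (Q * Q) \<le> N"
        proof -
          have "(C + 2) * l \<le> l * l" using lC l1 by (intro mult_right_mono) auto
          also have "\<dots> \<le> 22 * l\<^sup>2" by (simp add: power2_eq_square)
          finally have "exp ((C + 2) * l) \<le> exp (22 * l\<^sup>2)" by simp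
          then have "real (T + 1) \<le> exp (22 * l\<^sup>2)" using T1 by (rule order_trans[rotated])
          then have "real (T + 1) * (real Q)\<^sup>2 \<le> exp (22 * l\<^sup>2) * (real N * exp (- 22 * l\<^sup>2))"
            using NQ2 by (intro mult_mono) auto
          also have "\<dots> = real N" by (simp add: exp_minus)
          finally have "real ((T + 1) * (Q * Q)) \<le> real N" by (simp only: of_nat_mult power2_eq_square)
          then show ?thesis unfolding of_nat_le_iff .
        qed
        have QQ: "Q * Q \<le> N"
          using TQ by (metis add.commute le_add1 le_trans mult_le_mono1 nat_mult_1)
        have QN: "Q < N"
        proof -
          have "3 * Q \<le> (T + 1) * (Q * Q)" using T3 Q1 by (intro mult_le_mono) auto
          then show ?thesis using TQ Q1 by linarith
        qed
        have equi: "\<bar>real (card {a\<in>totatives N. near N q p \<tau> a}) - \<phi> * interval_weight q / \<tau>\<bar>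
            \<le> 1 / L * (\<phi> * interval_weight q / \<tau>)" if "(q, p) \<in> fractions Q" "3 \<le> \<tau>" "\<tau> \<le> T + 1" for q p \<tau>
          using elim(1) Qx(1) T1 that unfolding \<phi>_def L_def l_def x_def by blast
        have L1: "0 \<le> 1 / L" "1 / L \<le> 1" using L3 by auto
        define Z where "Z a = near_count N Q T a" for a
        define E1 where "E1 = {a\<in>totatives N. (Z a - h * \<Phi>)\<^sup>2 \<ge> (t * L)\<^sup>2}"
        \<comment> \<open>112 = 16 + 96, from 4 T \<Phi> \<le> 16 t L^2 and 3 (h \<Phi>)^2 / L \<le>
          96 t L^2.\<close>
        have cE1: "real (card E1) \<le> (112 + 16 * K1) * \<phi> / t"
        proof -
          have "(\<Sum>a\<in>totatives N. (Z a - h * \<Phi>)\<^sup>2) \<le> \<phi> * (4 * real T * \<Phi> + K1 * h\<^sup>2 * \<Phi> + 3 * (1 / L) * (h * \<Phi>)\<^sup>2)"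
            unfolding Z_def h_def \<Phi>_def \<phi>_def using equi[unfolded \<phi>_def]
            by (intro K1'[rule_format, OF N(1) Q1 L1]) auto
          also have "\<dots> \<le> \<phi> * (4 * (2 * (t * L)) * (2 * L) + K1 * (8 * (t * L)) * (2 * L) + 3 * (1 / L) * ((8 * (t * L)) * (2 * L)\<^sup>2))"
            unfolding power_mult_distrib[of h] using T2 h2 \<Phi>2L \<Phi>0 K10 \<phi>0 L3 t
            by (intro mult_left_mono add_mono mult_mono power_mono) auto
          also have "\<dots> = (112 + 16 * K1) * \<phi> * (t * L\<^sup>2)" using L3 by (simp add: power2_eq_square algebra_simps)
          finally have s: "(\<Sum>a\<in>totatives N. (Z a - h * \<Phi>)\<^sup>2) \<le> (112 + 16 * K1) * \<phi> * (t * L\<^sup>2)" .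
          have "real (card E1) \<le> (\<Sum>a\<in>totatives N. (Z a - h * \<Phi>)\<^sup>2) / (t * L)\<^sup>2"
            unfolding E1_def using t L3 by (intro card_le_sum_div) auto
          also have "\<dots> \<le> (112 + 16 * K1) * \<phi> * (t * L\<^sup>2) / (t * L)\<^sup>2" using s by (intro divide_right_mono) auto
          also have "\<dots> = (112 + 16 * K1) * \<phi> / t" using t L3 by (simp add: power2_eq_square)
          finally show ?thesis .
        qed
        define B1 where "B1 = {a\<in>totatives N. \<exists>v\<in>fractions Q. near N (fst v) (snd v) (T + 1) a}"
        have cB1: "real (card B1) \<le> 4 * \<phi> / t"
        proof -
          have "B1 = (\<Union>v\<in>fractions Q. {a\<in>totatives N. near N (fst v) (snd v) (T + 1) a})" by (auto simp: B1_def)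
          then have "card B1 \<le> (\<Sum>v\<in>fractions Q. card {a\<in>totatives N. near N (fst v) (snd v) (T + 1) a})"
            by (simp only: card_UN_le finite_fractions)
          then have "real (card B1) \<le> (\<Sum>v\<in>fractions Q. real (card {a\<in>totatives N. near N (fst v) (snd v) (T + 1) a}))"
            by (simp flip: of_nat_sum)
          also have "\<dots> \<le> (\<Sum>v\<in>fractions Q. 2 * (\<phi> * interval_weight (fst v) / real (T + 1)))"
          proof (rule sum_mono)
            fix v assume v: "v \<in> fractions Q"
            have "\<phi> * interval_weight (fst v) / real (T + 1) \<ge> 0" using \<phi>0 by (simp add: interval_weight_def)
            then have "1 / L * (\<phi> * interval_weight (fst v) / real (T + 1)) \<le> 1 * (\<phi> * interval_weight (fst v) / real (T + 1))"
              using L1 by (intro mult_right_mono) auto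
            then show "real (card {a\<in>totatives N. near N (fst v) (snd v) (T + 1) a}) \<le> 2 * (\<phi> * interval_weight (fst v) / real (T + 1))"
              using equi[of "fst v" "snd v" "T + 1"] v T3 by (simp add: abs_le_iff)
          qed
          also have "\<dots> = 2 * \<phi> / real (T + 1) * (\<Sum>v\<in>fractions Q. interval_weight (fst v))"
            unfolding sum_distrib_left by (intro sum.cong refl) simp
          also have "(\<Sum>v\<in>fractions Q. interval_weight (fst v)) = \<Phi>"
            using sum_interval_weight[OF Q1] by (simp add: \<Phi>_def case_prod_beta)
          also have "2 * \<phi> / real (T + 1) * \<Phi> \<le> 2 * \<phi> / (t * L) * (2 * L)"
            using \<Phi>2L \<Phi>0 Tb tL \<phi>0 by (intro mult_mono divide_left_mono) auto
          also have "\<dots> = 4 * \<phi> / t" using L3 by simp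
          finally show ?thesis .
        qed
        \<comment> \<open>Level T + 1 is included on purpose: \<open>B3\<close> also has to catch a
          triple of that level with q, m > Q.\<close>
        define M where "M a = real (card (middle_triples N Q (T + 1) a))" for a
        define B3 where "B3 = {a\<in>totatives N. M a \<ge> t * L / 2}"
        have cB3: "real (card B3) \<le> \<phi> / t"
        proof -
          have h': "truncated_harmonic (T + 1) \<le> (C + 2) * l"
          proof -
            have "truncated_harmonic (T + 1) \<le> ln (real (T + 1))" using T3 by (intro truncated_harmonic_bounds) auto
            also have "\<dots> \<le> ln (exp ((C + 2) * l))" using T1 by (subst ln_le_cancel_iff) auto
            finally show ?thesis by simp
          qed
          have h'0: "truncated_harmonic (T + 1) \<ge> 0" by (simp add: truncated_harmonic_def sum_nonneg)
          have "L - 2 * ln Q \<ge> 0" using lnQ_half by simp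
          have "(\<Sum>a\<in>totatives N. M a) \<le> 2 * real N * truncated_harmonic (T + 1) * (L - 2 * ln Q)"
            unfolding M_def L_def by (rule middle_triples_first_moment[OF N(1) Q1 QQ])
          also have "\<dots> \<le> 2 * (2 * sqrt (4 * L + 1) * \<phi>) * ((C + 2) * l) * (22 * l\<^sup>2 + 2)"
            using N\<phi> h' h'0 lnQ \<open>L - 2 * ln Q \<ge> 0\<close> \<phi>0 L3 C l1 by (intro mult_mono) auto
          finally have s: "(\<Sum>a\<in>totatives N. M a) \<le> 2 * (2 * sqrt (4 * L + 1) * \<phi>) * ((C + 2) * l) * (22 * l\<^sup>2 + 2)" .
          have "real (card B3) \<le> (\<Sum>a\<in>totatives N. M a) / (t * L / 2)"
            unfolding B3_def using tL by (intro card_le_sum_div) (auto simp: M_def)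
          also have "\<dots> \<le> 2 * (2 * sqrt (4 * L + 1) * \<phi>) * ((C + 2) * l) * (22 * l\<^sup>2 + 2) / (t * L / 2)"
            using s tL by (intro divide_right_mono) auto
          also have "\<dots> = (4 * (2 * sqrt (4 * L + 1)) * ((C + 2) * l * (22 * l\<^sup>2 + 2))) * (\<phi> / (t * L))" by simp
          also have "\<dots> \<le> L * (\<phi> / (t * L))" using g7 \<phi>0 tL by (intro mult_right_mono) auto
          also have "\<dots> = \<phi> / t" using L3 by simp
          finally show ?thesis .
        qed
        define W where "W = {a\<in>totatives N. \<bar>real (sum_partial_quotients (real a / real N)) - 12 / pi\<^sup>2 * ln (real N) * ln (ln (real N))\<bar> \<ge> K * t * ln (real N)}"
        define U where "U = ((E1 \<union> {a\<in>totatives N. f a \<in> E1}) \<union> (B1 \<union> {a\<in>totatives N. f a \<in> B1})) \<union> B3"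
        have "W \<subseteq> U"
        proof
          fix a assume aW: "a \<in> W"
          then have a: "a \<in> totatives N" by (simp add: W_def)
          show "a \<in> U"
          proof (rule ccontr)
            assume nU: "a \<notin> U"
            define b where "b = f a"
            have b: "b \<in> totatives N" using f(2) a by (auto simp: b_def)
            obtain j where j: "int a * int b = 1 + j * int N" using f(3) a by (auto simp: b_def)
            have aN: "0 < a" "a < N" "coprime a N" using a less_of_totatives[OF N(1) a] by (auto simp: in_totatives_iff)
            have out: "a \<notin> E1" "b \<notin> E1" "a \<notin> B1" "b \<notin> B1" "a \<notin> B3" using nU a by (auto simp: U_def b_def)
            have fin: "finite (quality_triples N a)" by (rule sum_partial_quotients_quality_triples(2)[OF aN])
            have nearB1: "y \<in> B1" if y: "y \<in> totatives N" and m: "((q, m), T + 1) \<in> quality_triples N y" "q \<le> Q" for y q m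
            proof -
              have "y \<le> N" using y by (simp add: in_totatives_iff)
              then obtain k where "(q, k) \<in> fractions Q" "near N q k (T + 1) y"
                using near_of_quality_triple[OF _ m] by blast
              then have "\<exists>v\<in>fractions Q. near N (fst v) (snd v) (T + 1) y" by force
              then show ?thesis using y by (auto simp: B1_def)
            qed
            have small: "((q, m), T + 1) \<notin> quality_triples N a" for q m
            proof
              assume q: "((q, m), T + 1) \<in> quality_triples N a"
              have q1: "\<not> q \<le> Q" using nearB1[OF a q] out by blast
              have "((m, q), T + 1) \<in> quality_triples N b"
                using q primitive_pair_swap[OF j, of q m] by (auto simp: quality_triples_def mult.commute)
              then have q2: "\<not> m \<le> Q" using nearB1[OF b] out by blast
              \<comment> \<open>A pair admissible at level T + 1 brings along all levels from 3 on,
                that is T - 1 \<ge> t L / 2 middle triples, which puts a into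
                \<open>B3\<close>.\<close>
              have "(\<lambda>\<tau>. ((q, m), \<tau>)) ` {3..T + 1} \<subseteq> middle_triples N Q (T + 1) a"
              proof
                fix z assume "z \<in> (\<lambda>\<tau>. ((q, m), \<tau>)) ` {3..T + 1}"
                then obtain \<tau> where z: "z = ((q, m), \<tau>)" "3 \<le> \<tau>" "\<tau> \<le> T + 1" by auto
                have "\<tau> * (q * m) \<le> (T + 1) * (q * m)" using z by (intro mult_le_mono1)
                then have "\<tau> * (q * m) \<le> N" using q by (simp add: quality_triples_def)
                then show "z \<in> middle_triples N Q (T + 1) a" using q q1 q2 z by (simp add: middle_triples_def quality_triples_def)
              qed
              then have "card ((\<lambda>\<tau>. ((q, m), \<tau>)) ` {3..T + 1}) \<le> card (middle_triples N Q (T + 1) a)"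
                by (intro card_mono finite_subset[OF _ fin]) (auto simp: middle_triples_def)
              moreover have "card ((\<lambda>\<tau>. ((q, m), \<tau>)) ` {3..T + 1}) = T - 1" by (subst card_image) (auto simp: inj_on_def)
              ultimately have "real T - 1 \<le> M a" using T3 unfolding M_def by linarith
              then have "M a \<ge> t * L / 2" using Tb tL by linarith
              then show False using out a by (simp add: B3_def)
            qed
            have dec: "real (card (quality_triples N a)) = Z a + Z b + real (card (middle_triples N Q T a))"
              unfolding Z_def using T3 by (intro card_quality_triples_decomposition[OF N(1) a b j QN TQ _ small]) auto
            have mid: "real (card (middle_triples N Q T a)) \<le> M a" unfolding M_def of_nat_le_iff
              by (intro card_mono finite_subset[OF _ fin]) (auto simp: middle_triples_def)
            have sq: "\<bar>y\<bar> < t * L" if "\<not> y\<^sup>2 \<ge> (t * L)\<^sup>2" for y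
              using that tL abs_le_square_iff[of "t * L" y] by auto
            have d1: "\<bar>Z a - h * \<Phi>\<bar> < t * L" "\<bar>Z b - h * \<Phi>\<bar> < t * L"
              using sq out a b by (auto simp: E1_def)
            have d2: "M a < t * L / 2" "M a \<ge> 0" using out a by (auto simp: B3_def M_def)
            have d3: "\<bar>real (sum_partial_quotients (real a / real N)) - real (card (quality_triples N a))\<bar> \<le> 2 + 8 * L"
              unfolding L_def by (rule sum_partial_quotients_quality_triples(1)[OF aN])
            have d4: "\<bar>2 * (h * \<Phi>) - c * L * l\<bar> \<le> 13 * (t * L)"
            proof -
              have "2 * (h * \<Phi>) - c * L * l = 2 * h * (\<Phi> - c * (L / 2)) + c * L * (h - l)" by (simp add: algebra_simps)
              also have "\<bar>\<dots>\<bar> \<le> \<bar>2 * h * (\<Phi> - c * (L / 2))\<bar> + \<bar>c * L * (h - l)\<bar>" by (rule abs_triangle_ineq)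
              also have "\<bar>2 * h * (\<Phi> - c * (L / 2))\<bar> \<le> 2 * (t * (l + 4)) * (K2 + 33 * l\<^sup>2 + 3)"
              proof -
                have "h \<le> l + 4 * t" using hl by linarith
                also have "\<dots> \<le> t * (l + 4)"
                proof -
                  have "1 * l \<le> t * l" using t l1 by (intro mult_right_mono) auto
                  then show ?thesis by (simp add: algebra_simps)
                qed
                finally have "2 * h \<le> 2 * (t * (l + 4))" by simp
                then show ?thesis unfolding abs_mult[of "2 * h"] using \<Phi>L h0 t l1 by (intro mult_mono) auto
              qed
              also have "2 * (t * (l + 4)) * (K2 + 33 * l\<^sup>2 + 3) = t * (2 * (l + 4) * (K2 + 33 * l\<^sup>2 + 3))" by simp
              also have "\<dots> \<le> t * L" using g2 t by (intro mult_left_mono) auto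
              also have "\<bar>c * L * (h - l)\<bar> \<le> 3 * L * (4 * t)" unfolding abs_mult[of "c * L"]
                using c L3 hl by (intro mult_mono) auto
              finally show ?thesis by (simp add: mult.commute[of t L])
            qed
            \<comment> \<open>In units of t L: 2 for the two halves, 1/2 for the middle range, 9 for
              2 + 8 L in \<open>d3\<close>, and 13 for \<open>d4\<close>.\<close>
            have "\<bar>real (sum_partial_quotients (real a / real N)) - c * L * l\<bar> < 26 * (t * L)"
              using d1 d2 d3 d4 dec mid tL Lle by linarith
            also have "\<dots> \<le> K * (t * L)" using K10 tL by (intro mult_right_mono) (auto simp: K_def)
            finally have "\<bar>real (sum_partial_quotients (real a / real N)) - c * L * l\<bar> < K * t * L" by (simp add: mult.assoc)
            then show False using aW by (simp add: W_def c_def L_def l_def)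
          qed
        qed
        have fA: "finite (totatives N)" by simp
        have sub: "E1 \<subseteq> totatives N" "B1 \<subseteq> totatives N" by (auto simp: E1_def B1_def)
        have finU: "finite U" by (rule finite_subset[OF _ fA]) (auto simp: U_def E1_def B1_def B3_def)
        have "card W \<le> card U" using \<open>W \<subseteq> U\<close> finU by (rule card_mono[rotated])
        also have "card U \<le> ((card E1 + card {a\<in>totatives N. f a \<in> E1}) + (card B1 + card {a\<in>totatives N. f a \<in> B1})) + card B3"
          unfolding U_def by (intro order_trans[OF card_Un_le] add_mono order_refl card_Un_le)
        also have "\<dots> \<le> ((card E1 + card E1) + (card B1 + card B1)) + card B3"
          by (intro add_mono order_refl card_preimage_le[OF f(1) _ fA] sub)
        finally have "real (card W) \<le> 2 * real (card E1) + 2 * real (card B1) + real (card B3)" by linarith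
        also have "\<dots> \<le> 2 * ((112 + 16 * K1) * \<phi> / t) + 2 * (4 * \<phi> / t) + \<phi> / t" using cE1 cB1 cB3 by linarith
        also have "\<dots> = (233 + 32 * K1) * (\<phi> / t)" by (simp add: algebra_simps add_divide_distrib)
        also have "\<dots> \<le> K * (\<phi> / t)" using \<phi>0 t by (intro mult_right_mono) (auto simp: K_def)
        finally show "real (card {a\<in>totatives N. \<bar>real (sum_partial_quotients (real a / real N)) - 12 / pi\<^sup>2 * ln (real N) * ln (ln (real N))\<bar> \<ge> K * t * ln (real N)}) \<le> K * real (totient N) / t"
          unfolding W_def \<phi>_def by simp
      qed
    qed
  qed
qed

theorem theorem1:
  fixes C :: real
  assumes "C > 0"
  shows "\<exists>K::real. \<forall>N::nat. \<forall>t::real. N \<ge> 3 \<longrightarrow> 0 < t \<longrightarrow> t \<le> ln (real N) powr C \<longrightarrow>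
    \<bar>1 / real (totient N) *
       real (card {a \<in> totatives N.
         \<bar>real (sum_partial_quotients (real a / real N))
            - 12 / pi\<^sup>2 * ln (real N) * ln (ln (real N))\<bar> \<ge> t * ln (real N)})\<bar>
      \<le> K * (1 / t)"
proof -
  obtain K where K1: "K \<ge> 1" and ev: "\<forall>\<^sub>F N in at_top. \<forall>t\<ge>1. t \<le> ln (real N) powr C \<longrightarrow>
    real (card {a\<in>totatives N. \<bar>real (sum_partial_quotients (real a / real N)) - 12 / pi\<^sup>2 * ln (real N) * ln (ln (real N))\<bar> \<ge> K * t * ln (real N)})
      \<le> K * real (totient N) / t"
    using concentration_large_N[OF assms] by (elim exE conjE) (rule that)
  from ev obtain N0 where N0: "\<And>N t. N \<ge> N0 \<Longrightarrow> 1 \<le> t \<Longrightarrow> t \<le> ln (real N) powr C \<Longrightarrow>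
    real (card {a\<in>totatives N. \<bar>real (sum_partial_quotients (real a / real N)) - 12 / pi\<^sup>2 * ln (real N) * ln (ln (real N))\<bar> \<ge> K * t * ln (real N)})
      \<le> K * real (totient N) / t"
    unfolding eventually_at_top_linorder by blast
  \<comment> \<open>For N \<ge> N0 and t \<ge> K the bound is used at t / K, which yields K * K. If
    t < K or N < N0, then t \<le> K', and the trivial bound 1 for the proportion is at most K' /
    t.\<close>
  define K' where "K' = K * K + ln (real (N0 + 3)) powr C"
  show ?thesis
  proof (intro exI[of _ K'] allI impI)
    fix N :: nat and t :: real assume N: "N \<ge> 3" and t: "0 < t" "t \<le> ln (real N) powr C"
    define W where "W s = {a \<in> totatives N. \<bar>real (sum_partial_quotients (real a / real N))
            - 12 / pi\<^sup>2 * ln (real N) * ln (ln (real N))\<bar> \<ge> s * ln (real N)}" for s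
    define \<phi> where "\<phi> = real (totient N)"
    have \<phi>0: "\<phi> > 0" using N by (simp add: \<phi>_def)
    have KK: "K \<le> K * K" using K1 by simp
    have K'K: "K * K \<le> K'" "ln (real (N0 + 3)) powr C \<le> K'" using K1 by (auto simp: K'_def)
    have "card (W t) \<le> card (totatives N)" unfolding W_def by (intro card_mono) auto
    then have "real (card (W t)) \<le> \<phi>" by (simp add: \<phi>_def totient_def)
    then have triv: "1 / \<phi> * real (card (W t)) \<le> 1" using \<phi>0 by simp
    have "1 / \<phi> * real (card (W t)) \<le> K' * (1 / t)"
    proof (cases "N \<ge> N0 \<and> t \<ge> K")
      case True
      define s where "s = t / K"
      have "t / K \<le> t" using K1 t by (simp add: divide_le_eq)
      then have "s \<ge> 1" "s \<le> ln (real N) powr C" "K * s = t" using True K1 t by (auto simp: s_def)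
      then have "real (card (W t)) \<le> K * \<phi> / s" using N0[of N s] True by (simp add: W_def \<phi>_def)
      also have "\<dots> = K * K * \<phi> * (1 / t)" using K1 t by (simp add: s_def)
      finally have "1 / \<phi> * real (card (W t)) \<le> K * K * (1 / t)" using \<phi>0 by (simp add: field_simps)
      also have "\<dots> \<le> K' * (1 / t)" using K'K t by (intro mult_right_mono) auto
      finally show ?thesis .
    next
      case False
      have "t \<le> K'"
      proof (cases "N \<ge> N0")
        case True
        then show ?thesis using False KK K'K by linarith
      next
        case F: False
        have "ln (real N) \<le> ln (real (N0 + 3))" using F N by (subst ln_le_cancel_iff) auto
        then have "ln (real N) powr C \<le> ln (real (N0 + 3)) powr C" using assms N by (intro powr_mono2) auto
        then show ?thesis using t K'K by linarith
      qed
      then have "1 \<le> K' * (1 / t)" using t by simp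
      then show ?thesis using triv by linarith
    qed
    moreover have "0 \<le> 1 / \<phi> * real (card (W t))" using \<phi>0 by simp
    ultimately show "\<bar>1 / real (totient N) *
       real (card {a \<in> totatives N.
         \<bar>real (sum_partial_quotients (real a / real N))
            - 12 / pi\<^sup>2 * ln (real N) * ln (ln (real N))\<bar> \<ge> t * ln (real N)})\<bar>
      \<le> K' * (1 / t)"
      unfolding W_def[symmetric] \<phi>_def[symmetric] by simp
  qed
qed

end
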